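(* Let the marks $X_i$ be i.i.d. in the unit square with density $f$ satisfying $\epsilon_1\le f\le\epsilon_2$ for finite positive constants $\epsilon_1,\epsilon_2$, and let the cost factor be $r(X_u,X_v)=\left(\frac{d(X_u,X_v)}{\sqrt2}\right)^\alpha$ with $\alpha>0$ constant. Suppose the edge weight cdf satisfies $F(x)=x^{1/\delta}$ for all $0<x<1$ and some $0<\delta<1$, and $p(u,v)=p=\frac1{n^\beta}$ for all edges $(u,v)$ and some constant $0<\beta<1$. (a) If $\alpha<\frac{2\delta}{1+\delta}$, then $$\mathbb P\left(E_{con}\cap\left\{\frac{D_1n}{(np)^\delta}\le\tau_n\le\frac{D_2n}{(np)^\delta}\right\}\right)=1-o(1)$$ and $$\frac{D_1n}{(np)^\delta}\le\mathbb E\tau_n\le\frac{D_2n}{(np)^\delta}$$ for some constants $D_1,D_2>0$. Moreover, $\frac{\tau_n}{\mathbb E\tau_n}\to1$ in $L^2$ as $n\to\infty$. (b) If $\alpha>\frac{2\delta}{1-\delta}$, then $$\mathbb P\left(E_{con}\cap\left\{\frac{\theta_1n}{(np)^{\alpha/2}}\le\tau_n\le\theta_2n\left(\frac{\log n}{np}\right)^{\alpha/2}\right\}\right)=1-o(1)$$ and $$\frac{\theta_1n}{(np)^{\alpha/2}}\le\mathbb E\tau_n\le\theta_2n\left(\frac{\log n}{np}\right)^{\alpha/2}$$ for some constants $\theta_1,\theta_2>0$. Moreover, if $\beta>\frac{\alpha-2\delta}{1+\alpha-2\delta}$, then $\frac{\tau_n}{\mathbb E\tau_n}\to1$ in $L^2$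 as $n\to\infty$.
   Context: For each integer $n\ge2$ let $K_n$ be the complete graph on $\{1,\dots,n\}$. Let $\{Z(h)\}_{h\in K_n}$ be independent Bernoulli random variables indexed by the edges, with $\mathbb P(Z(h)=1)=p(h)=p(u,v)\in(0,1)$ for $h=(u,v)$. The random graph $G$ has vertex set $\{1,\dots,n\}$ and edge set $\{h:Z(h)=1\}$; $E_{con}$ is the event that $G$ is connected. Each edge $h$ has a positive random weight $W(h)=W(u,v)$ (i.i.d. over edges, with law not depending on $n$), with cdf $F(x)=\mathbb P(W(h)\le x)$. The vertex marks (locations) $X_1,\dots,X_n$ are i.i.d. with common density $f$ on $S=[0,1]^2$; $d(\cdot,\cdot)$ is Euclidean distance. The families $\{Z(h)\},\{W(h)\},\{X_u\}$ are mutually independent. The cost of the edge $(u,v)$ is $c(u,v)=r(X_u,X_v)W(u,v)$. The cost of a tree is the sum of the costs of its edges, and $\tau_n$ is the minimum cost of a spanning tree of the largest component of $G$ (ties between largest components broken by any fixed rule). Constants do not depend on $n$. *)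

theory Defs
  imports "HOL-Probability.Probability"
begin

text \<open>An undirected simple graph on a set of natural numbers is given by its vertex set and the
  set of its edges, the edge between \<open>u < v\<close> being stored once, as the pair \<open>(u, v)\<close>.
  Adjacency is therefore the symmetric closure \<open>E \<union> E\<inverse>\<close>.\<close>

definition complete_edges :: "nat \<Rightarrow> (nat \<times> nat) set" where
  "complete_edges n = {(u, v). 1 \<le> u \<and> u < v \<and> v \<le> n}"

definition connected_graph :: "nat set \<Rightarrow> (nat \<times> nat) set \<Rightarrow> bool" where
  "connected_graph V E \<longleftrightarrow> V \<noteq> {} \<and> (\<forall>u\<in>V. \<forall>v\<in>V. (u, v) \<in> (E \<union> E\<inverse>)\<^sup>*)"

definition components_graph :: "nat set \<Rightarrow> (nat \<times> nat) set \<Rightarrow> nat set set" where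
  "components_graph V E = V // (E \<union> E\<inverse>)\<^sup>*"

definition is_cycle :: "(nat \<times> nat) set \<Rightarrow> nat list \<Rightarrow> bool" where
  "is_cycle E cs \<longleftrightarrow> 3 \<le> length cs \<and> distinct cs \<and>
     (\<forall>i<length cs. (cs ! i, cs ! (Suc i mod length cs)) \<in> E \<union> E\<inverse>)"

definition is_tree :: "nat set \<Rightarrow> (nat \<times> nat) set \<Rightarrow> bool" where
  "is_tree V T \<longleftrightarrow> T \<subseteq> V \<times> V \<and> connected_graph V T \<and> (\<nexists>cs. is_cycle T cs)"

definition spanning_trees :: "nat set \<Rightarrow> (nat \<times> nat) set \<Rightarrow> (nat \<times> nat) set set" where
  "spanning_trees C E = {T. T \<subseteq> E \<and> is_tree C T}"

text \<open>A deterministic way of choosing, for every \<open>n\<close> and every graph on \<open>{1..n}\<close>, one of its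
  components of maximal size.\<close>

definition largest_component_rule :: "(nat \<Rightarrow> (nat \<times> nat) set \<Rightarrow> nat set) \<Rightarrow> bool" where
  "largest_component_rule L \<longleftrightarrow>
     (\<forall>n\<ge>1. \<forall>E. E \<subseteq> complete_edges n \<longrightarrow>
        is_arg_max card (\<lambda>C. C \<in> components_graph {1..n} E) (L n E))"

definition unit_square :: "(real ^ 2) set" where
  "unit_square = {x. \<forall>i. 0 \<le> x $ i \<and> x $ i \<le> 1}"

definition random_edges :: "nat \<Rightarrow> (nat \<times> nat \<Rightarrow> 'a \<Rightarrow> bool) \<Rightarrow> 'a \<Rightarrow> (nat \<times> nat) set" where
  "random_edges n Z \<omega> = {h \<in> complete_edges n. Z h \<omega>}"

definition edge_cost ::
  "(real ^ 2 \<Rightarrow> real ^ 2 \<Rightarrow> real) \<Rightarrow> (nat \<times> nat \<Rightarrow> 'a \<Rightarrow> real) \<Rightarrow> (nat \<Rightarrow> 'a \<Rightarrow> real ^ 2)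
     \<Rightarrow> 'a \<Rightarrow> nat \<times> nat \<Rightarrow> real" where
  "edge_cost r W X \<omega> = (\<lambda>(u, v). r (X u \<omega>) (X v \<omega>) * W (u, v) \<omega>)"

definition mst_cost ::
  "(nat \<Rightarrow> (nat \<times> nat) set \<Rightarrow> nat set) \<Rightarrow> (real ^ 2 \<Rightarrow> real ^ 2 \<Rightarrow> real) \<Rightarrow> nat
     \<Rightarrow> (nat \<times> nat \<Rightarrow> 'a \<Rightarrow> bool) \<Rightarrow> (nat \<times> nat \<Rightarrow> 'a \<Rightarrow> real) \<Rightarrow> (nat \<Rightarrow> 'a \<Rightarrow> real ^ 2)
     \<Rightarrow> 'a \<Rightarrow> real" where
  "mst_cost L r n Z W X \<omega> =
     Min ((\<lambda>T. \<Sum>h\<in>T. edge_cost r W X \<omega> h) `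
       spanning_trees (L n (random_edges n Z \<omega>)) (random_edges n Z \<omega>))"

definition events_of :: "'a measure \<Rightarrow> 'b measure \<Rightarrow> ('a \<Rightarrow> 'b) \<Rightarrow> 'a set set" where
  "events_of M N Y = {Y -` A \<inter> space M | A. A \<in> sets N}"

text \<open>The marked random graph on \<open>{1..n}\<close>. The constant \<open>indep_vars\<close> needs one common
  codomain type, so the mutual independence of all the variables of the three families is stated
  for the \<open>\<sigma>\<close>-algebras they generate, indexed by a disjoint sum.\<close>

locale marked_random_graph = prob_space M for M :: "'a measure" +
  fixes n :: nat
    and p :: "nat \<times> nat \<Rightarrow> real"
    and F :: "real \<Rightarrow> real"
    and f :: "real ^ 2 \<Rightarrow> real"
    and Z :: "nat \<times> nat \<Rightarrow> 'a \<Rightarrow> bool"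
    and W :: "nat \<times> nat \<Rightarrow> 'a \<Rightarrow> real"
    and X :: "nat \<Rightarrow> 'a \<Rightarrow> real ^ 2"
  assumes p_range: "\<And>h. h \<in> complete_edges n \<Longrightarrow> 0 < p h \<and> p h < 1"
    and Z_measurable: "\<And>h. h \<in> complete_edges n \<Longrightarrow> random_variable (count_space UNIV) (Z h)"
    and Z_bernoulli: "\<And>h. h \<in> complete_edges n \<Longrightarrow>
          distr M (count_space UNIV) (Z h) = measure_pmf (bernoulli_pmf (p h))"
    and W_measurable: "\<And>h. h \<in> complete_edges n \<Longrightarrow> random_variable borel (W h)"
    and W_pos: "\<And>h. h \<in> complete_edges n \<Longrightarrow> AE \<omega> in M. 0 < W h \<omega>"
    and W_cdf: "\<And>h x. h \<in> complete_edges n \<Longrightarrow> cdf (distr M borel (W h)) x = F x"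
    and X_density: "\<And>u. u \<in> {1..n} \<Longrightarrow>
          distributed M lborel (X u) (\<lambda>x. ennreal (f x * indicator unit_square x))"
    and independent: "indep_sets
          (\<lambda>i. case i of
             Inl h \<Rightarrow> events_of M (count_space UNIV) (Z h)
           | Inr (Inl h) \<Rightarrow> events_of M borel (W h)
           | Inr (Inr u) \<Rightarrow> events_of M borel (X u))
          (complete_edges n <+> (complete_edges n <+> {1..n}))"

text \<open>Convergence in \<open>L\<^sup>2\<close> to a constant, for variables that may live on a different
  probability space for each index. Square integrability is demanded explicitly because the
  Bochner integral of a non-integrable function is 0.\<close>

definition tendsto_L2 :: "(nat \<Rightarrow> 'a measure) \<Rightarrow> (nat \<Rightarrow> 'a \<Rightarrow> real) \<Rightarrow> real \<Rightarrow> bool" where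
  "tendsto_L2 M Y c \<longleftrightarrow>
     (\<forall>\<^sub>F n in sequentially. Y n \<in> borel_measurable (M n) \<and>
        integrable (M n) (\<lambda>\<omega>. (Y n \<omega> - c)\<^sup>2)) \<and>
     (\<lambda>n. \<integral>\<omega>. (Y n \<omega> - c)\<^sup>2 \<partial>M n) \<longlonglongrightarrow> 0"

end

theory Submission
  imports Defs "HOL-Real_Asymp.Real_Asymp"
begin

text \<open>
  Let \<open>\<gamma> = \<delta>\<close> in (a) and \<open>\<gamma> = \<alpha> / 2\<close> in (b). In both regimes an edge is present with cost at most
  \<open>x\<close> with probability \<open>O(p x\<^sup>1\<^sup>/\<^sup>\<gamma>)\<close>, even conditionally on the location of one end point. Hence
  fewer than \<open>n / 4\<close> edges cost less than a small multiple of \<open>(n p)\<^sup>-\<^sup>\<gamma>\<close> on average, which bounds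
  the mean from below. At the level \<open>l = (C log n / (n p))\<^sup>\<gamma>\<close> the graph of cheap edges is connected
  up to a polynomially small probability: in (a) because it contains an Erdos-Renyi graph of mean
  degree \<open>C log n\<close>; in (b) because every vertex outside a corner cell of a grid with order
  \<open>(n p / log n)\<^sup>1\<^sup>/\<^sup>2\<close> cells per side has a neighbour in an adjacent cell closer to the corner, while the vertices of
  the corner cell form a connected Erdos-Renyi graph. On this event \<open>\<tau>\<^sub>n\<close> equals the cost of the
  minimal spanning tree of the complete graph in which every other edge costs \<open>l\<close>. For this capped
  functional a star gives the upper bound \<open>n l\<close> of (b), and joining each vertex to its cheapest
  predecessor gives the upper bound of (a), without the logarithm. It moves by at most \<open>l\<close> times
  the number of cheap edges affected when one variable changes, so the Efron-Stein inequality bounds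
  its variance by \<open>n l\<^sup>2\<close> up to powers of \<open>log n\<close>, which is negligible against the squared mean.
  The high-probability bounds follow from the bounds on the mean and Chebyshev's inequality.
\<close>

section \<open>Minimal connected subgraphs\<close>

text \<open>The minimal spanning tree of the largest component reacts badly to single variables,
  since one edge may change the component itself. The capped functional removes this obstacle: it
  lives on the complete graph, it is Lipschitz in the edge costs, and resetting an edge to the cap
  \<open>l\<close> moves it by at most \<open>l\<close>, and only if the edge was cheap. A location
  influences all edges at its vertex, so the variance calls for the second moment of the number of
  cheap edges there. These edges are dependent through the shared location, which is why
  probabilities are bounded uniformly in that location, by fixing its grid cell. The cost law of an
  edge comes from a dyadic series. Over lengths its ratio is
  \<open>2 powr (\<alpha> / \<delta>) / 4\<close>, over weights
  \<open>2 powr (2 / \<alpha> - 1 / \<delta>)\<close>; these are below 1 for \<alpha> < 2 * \<delta>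
  and \<alpha> > 2 * \<delta>, respectively. The failure probability is pushed below
  \<open>n powr (- (3 + 2 * \<gamma>))\<close> because on the exceptional event the squared
  difference is only bounded by n^4, while the squared mean has a lower bound of order n^(2 - 2 *
  \<gamma>).\<close>

lemma connected_graph_mono:
  assumes "connected_graph V E" "E \<subseteq> E'"
  shows "connected_graph V E'"
proof -
  have "(E \<union> E\<inverse>)\<^sup>* \<subseteq> (E' \<union> E'\<inverse>)\<^sup>*"
    using assms(2) by (intro rtrancl_mono) auto
  thus ?thesis using assms(1) unfolding connected_graph_def by blast
qed

lemma sym_closure_rtrancl: "sym ((E \<union> E\<inverse>)\<^sup>*)"
  by (intro sym_rtrancl) (auto simp: sym_def)

lemma reach_sym: "(x, y) \<in> (E \<union> E\<inverse>)\<^sup>* \<Longrightarrow> (y, x) \<in> (E \<union> E\<inverse>)\<^sup>*"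
  using sym_closure_rtrancl symD by metis

text \<open>Every use of the deleted edge in a walk can be replaced by the detour between its end
  points.\<close>

lemma connected_graph_remove_edge:
  assumes con: "connected_graph V E"
    and xy: "(x, y) \<in> ((E - {(x, y)}) \<union> (E - {(x, y)})\<inverse>)\<^sup>*"
  shows "connected_graph V (E - {(x, y)})"
proof -
  let ?R = "((E - {(x, y)}) \<union> (E - {(x, y)})\<inverse>)\<^sup>*"
  have "E \<union> E\<inverse> \<subseteq> ?R"
  proof
    fix e assume e: "e \<in> E \<union> E\<inverse>"
    obtain a b where ab: "e = (a, b)" by (cases e)
    have yx: "(y, x) \<in> ?R" using reach_sym[OF xy] .
    show "e \<in> ?R"
    proof (cases "e = (x, y) \<or> e = (y, x)")
      case True
      thus ?thesis using xy yx by blast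
    next
      case False
      hence "e \<in> (E - {(x, y)}) \<union> (E - {(x, y)})\<inverse>" using e ab by auto
      thus ?thesis by blast
    qed
  qed
  hence "(E \<union> E\<inverse>)\<^sup>* \<subseteq> ?R\<^sup>*" by (rule rtrancl_mono)
  hence "(E \<union> E\<inverse>)\<^sup>* \<subseteq> ?R" by simp
  thus ?thesis using con unfolding connected_graph_def by blast
qed

lemma nth_path_reach:
  assumes "\<And>i. a \<le> i \<Longrightarrow> i < b \<Longrightarrow> (g i, g (Suc i)) \<in> R" "a \<le> b"
  shows "(g a, g b) \<in> R\<^sup>*"
  using assms(2,1)
proof (induction b rule: dec_induct)
  case (step m)
  hence "(g a, g m) \<in> R\<^sup>*" "(g m, g (Suc m)) \<in> R" by auto
  thus ?case by (rule rtrancl_into_rtrancl)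
qed simp

text \<open>The edge between the first two entries of the cycle is deleted; the rest of the cycle is
  the detour.\<close>

lemma connected_graph_break_cycle:
  assumes con: "connected_graph V E" and cyc: "is_cycle E cs"
    and lt: "\<And>u v. (u, v) \<in> E \<Longrightarrow> u < v"
  shows "\<exists>e\<in>E. connected_graph V (E - {e})"
proof -
  let ?n = "length cs"
  have n3: "3 \<le> ?n" and dist: "distinct cs"
    and ed: "\<And>i. i < ?n \<Longrightarrow> (cs ! i, cs ! (Suc i mod ?n)) \<in> E \<union> E\<inverse>"
    using cyc unfolding is_cycle_def by auto
  have e01: "(cs ! 0, cs ! 1) \<in> E \<union> E\<inverse>"
  proof -
    have "Suc 0 mod ?n = 1" "0 < ?n" using n3 by auto
    thus ?thesis using ed[of 0] by metis
  qed
  \<comment> \<open>The first two entries are adjacent, but the edge may be stored in either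
    orientation.\<close>
  define e where "e = (if (cs ! 0, cs ! 1) \<in> E then (cs ! 0, cs ! 1) else (cs ! 1, cs ! 0))"
  have eE: "e \<in> E" using e01 by (auto simp: e_def)
  let ?R = "(E - {e}) \<union> (E - {e})\<inverse>"
  have step: "(cs ! i, cs ! (Suc i mod ?n)) \<in> ?R" if i: "1 \<le> i" "i < ?n" for i
  proof -
    have "Suc i mod ?n \<noteq> i" using i by (cases "Suc i = ?n") auto
    have s: "Suc i mod ?n < ?n" using n3 by (intro mod_less_divisor) auto
    have n0: "0 < ?n" "1 < ?n" using n3 by auto
    have "cs ! i \<noteq> cs ! 0" using i nth_eq_iff_index_eq[OF dist i(2) n0(1)] by auto
    moreover have "cs ! (Suc i mod ?n) \<noteq> cs ! 1"
    proof
      assume "cs ! (Suc i mod ?n) = cs ! 1"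
      hence "Suc i mod ?n = 1" using nth_eq_iff_index_eq[OF dist s n0(2)] by auto
      thus False using i n3 by (cases "Suc i = ?n") auto
    qed
    \<comment> \<open>Here the length of at least three enters: a cycle through two vertices would
      return along the deleted edge.\<close>
    moreover have "cs ! (Suc i mod ?n) \<noteq> cs ! 0 \<or> cs ! i \<noteq> cs ! 1"
    proof (rule ccontr)
      assume "\<not> ?thesis"
      hence "Suc i mod ?n = 0" "i = 1"
        using nth_eq_iff_index_eq[OF dist s n0(1)] nth_eq_iff_index_eq[OF dist i(2) n0(2)] by auto
      thus False using n3 by auto
    qed
    ultimately show ?thesis using ed[OF i(2)] by (auto simp: e_def split: if_splits)
  qed
  have "(cs ! 1, cs ! (?n - 1)) \<in> ?R\<^sup>*"
  proof (rule nth_path_reach[of 1 "?n - 1" "\<lambda>i. cs ! i"])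
    fix i assume "1 \<le> i" "i < ?n - 1"
    thus "(cs ! i, cs ! Suc i) \<in> ?R" using step[of i] by auto
  qed (use n3 in auto)
  moreover have "(cs ! (?n - 1), cs ! 0) \<in> ?R"
  proof -
    have "Suc (?n - 1) = ?n" "1 \<le> ?n - 1" "?n - 1 < ?n" using n3 by auto
    thus ?thesis using step[of "?n - 1"] by (metis mod_self)
  qed
  ultimately have r: "(cs ! 1, cs ! 0) \<in> ?R\<^sup>*" by (rule rtrancl_into_rtrancl)
  obtain x y where xy: "e = (x, y)" by (cases e)
  have "(x, y) \<in> ?R\<^sup>*" using r reach_sym[OF r] xy by (auto simp: e_def split: if_splits)
  thus ?thesis using connected_graph_remove_edge[OF con, of x y] xy eE by blast
qed

lemma spanning_tree_exists:
  assumes con: "connected_graph V E" and fin: "finite E" and sub: "E \<subseteq> V \<times> V"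
    and lt: "\<And>u v. (u, v) \<in> E \<Longrightarrow> u < v"
  shows "\<exists>T\<subseteq>E. is_tree V T"
  using fin con sub lt
proof (induction E rule: finite_psubset_induct)
  case (psubset E)
  show ?case
  proof (cases "\<exists>cs. is_cycle E cs")
    case True
    then obtain e where e: "e \<in> E" "connected_graph V (E - {e})"
      using connected_graph_break_cycle psubset.prems by blast
    have "\<exists>T\<subseteq>E - {e}. is_tree V T"
      using psubset.IH[of "E - {e}"] e psubset.prems by blast
    thus ?thesis by blast
  next
    case False
    thus ?thesis using psubset.prems unfolding is_tree_def by blast
  qed
qed

text \<open>The minimum below runs over connected sets of edges that may contain cycles. For nonnegative
  costs it is the cost of a minimal spanning tree, and edges can be exchanged without having to
  preserve acyclicity.\<close>

definition connectors :: "nat \<Rightarrow> (nat \<times> nat) set set" where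
  "connectors n = {T. T \<subseteq> complete_edges n \<and> connected_graph {1..n} T}"

definition connection_cost :: "nat \<Rightarrow> (nat \<times> nat \<Rightarrow> real) \<Rightarrow> real" where
  "connection_cost n c = Min (sum c ` connectors n)"

lemma finite_complete_edges [simp]: "finite (complete_edges n)"
  by (rule finite_subset[of _ "{1..n} \<times> {1..n}"]) (auto simp: complete_edges_def)

lemma complete_edges_subset: "complete_edges n \<subseteq> {1..n} \<times> {1..n}"
  by (auto simp: complete_edges_def)

lemma card_complete_edges_le: "card (complete_edges n) \<le> n * n"
  using card_mono[OF _ complete_edges_subset, of n] by (simp add: card_cartesian_product)

lemma finite_connectors [simp]: "finite (connectors n)"
  by (rule finite_subset[of _ "Pow (complete_edges n)"]) (auto simp: connectors_def)

text \<open>Following parents decreases the label until vertex 1 is reached. This is the one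
  construction behind both upper bounds on the mean: the star and the choice of a cheapest
  predecessor are instances.\<close>

lemma recursive_connector:
  assumes par: "\<And>i. 2 \<le> i \<Longrightarrow> i \<le> n \<Longrightarrow> 1 \<le> par i \<and> par i < i" and n: "1 \<le> n"
  shows "(\<lambda>i. (par i, i)) ` {2..n} \<in> connectors n"
proof -
  let ?T = "(\<lambda>i. (par i, i)) ` {2..n}"
  let ?R = "(?T \<union> ?T\<inverse>)\<^sup>*"
  have r1: "(1, i) \<in> ?R" if "1 \<le> i" "i \<le> n" for i
    using that
  proof (induction i rule: less_induct)
    case (less i)
    show ?case
    proof (cases "i = 1")
      case False
      hence i: "2 \<le> i" "i \<le> n" using less.prems by auto
      have "(1, par i) \<in> ?R" using less.IH[of "par i"] par[OF i] i by auto
      moreover have "(par i, i) \<in> ?T \<union> ?T\<inverse>" using i by auto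
      ultimately show ?thesis by (rule rtrancl_into_rtrancl)
    qed simp
  qed
  have "connected_graph {1..n} ?T"
    unfolding connected_graph_def
  proof (intro conjI ballI)
    fix u v assume "u \<in> {1..n}" "v \<in> {1..n}"
    hence "(u, 1) \<in> ?R" "(1, v) \<in> ?R" using r1 reach_sym[OF r1] by auto
    thus "(u, v) \<in> ?R" by (rule rtrancl_trans)
  qed (use n in auto)
  moreover have "?T \<subseteq> complete_edges n" using par by (fastforce simp: complete_edges_def)
  ultimately show ?thesis by (simp add: connectors_def)
qed

lemma connectors_nonempty: "1 \<le> n \<Longrightarrow> connectors n \<noteq> {}"
  using recursive_connector[of n "\<lambda>_. 1"] by auto

lemma connection_cost_le: "T \<in> connectors n \<Longrightarrow> connection_cost n c \<le> sum c T"
  unfolding connection_cost_def by (intro Min_le) auto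

lemma connection_cost_attained:
  assumes "1 \<le> n"
  obtains T where "T \<in> connectors n" "connection_cost n c = sum c T"
proof -
  have "connection_cost n c \<in> sum c ` connectors n"
    unfolding connection_cost_def using connectors_nonempty[OF assms] by (intro Min_in) auto
  thus ?thesis using that by blast
qed

lemma connection_cost_le_recursive:
  assumes par: "\<And>i. 2 \<le> i \<Longrightarrow> i \<le> n \<Longrightarrow> 1 \<le> par i \<and> par i < i" and n: "1 \<le> n"
  shows "connection_cost n c \<le> (\<Sum>i=2..n. c (par i, i))"
proof -
  have "inj_on (\<lambda>i. (par i, i)) {2..n}" by (auto simp: inj_on_def)
  thus ?thesis
    using connection_cost_le[OF recursive_connector[OF par n], of c] by (simp add: sum.reindex)
qed

text \<open>An optimal connector for one cost function is a candidate for the other. In the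
  Efron-Stein inequality this turns the influence of a variable into a sum over the edges whose cost
  it changes.\<close>

lemma connection_cost_lipschitz:
  assumes n: "1 \<le> n"
  shows "\<bar>connection_cost n c - connection_cost n c'\<bar> \<le> (\<Sum>h\<in>complete_edges n. \<bar>c h - c' h\<bar>)"
proof -
  have *: "connection_cost n c \<le> connection_cost n c' + (\<Sum>h\<in>complete_edges n. \<bar>c h - c' h\<bar>)" for c c'
  proof -
    obtain T where T: "T \<in> connectors n" "connection_cost n c' = sum c' T"
      using connection_cost_attained[OF n] .
    have "connection_cost n c \<le> sum c T" by (rule connection_cost_le[OF T(1)])
    also have "\<dots> \<le> sum c' T + (\<Sum>h\<in>T. \<bar>c h - c' h\<bar>)"
      unfolding sum.distrib[symmetric] by (intro sum_mono) auto
    also have "(\<Sum>h\<in>T. \<bar>c h - c' h\<bar>) \<le> (\<Sum>h\<in>complete_edges n. \<bar>c h - c' h\<bar>)"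
      using T(1) by (intro sum_mono2) (auto simp: connectors_def)
    finally show ?thesis using T(2) by simp
  qed
  have "connection_cost n c' \<le> connection_cost n c + (\<Sum>h\<in>complete_edges n. \<bar>c h - c' h\<bar>)"
    using *[of c' c] by (simp add: abs_minus_commute)
  thus ?thesis using *[of c c'] by linarith
qed

section \<open>Exchange of edges across cuts\<close>

lemma reach_crossing:
  assumes "(x, y) \<in> (E \<union> E\<inverse>)\<^sup>*" "x \<in> S" "y \<notin> S"
  shows "\<exists>(a, b)\<in>E. (a \<in> S) \<noteq> (b \<in> S)"
  using assms
proof (induction rule: rtrancl_induct)
  case (step y z)
  thus ?case by (cases "y \<in> S") auto
qed simp

text \<open>Without \<open>e\<close> the vertices fall into the side of \<open>x\<close> and the
  side of \<open>y\<close>. Any other connected graph has an edge across this cut, and that edge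
  joins the two sides again.\<close>

lemma connected_swap:
  assumes con: "connected_graph V T" and e: "e \<in> T"
    and dis: "\<not> connected_graph V (T - {e})" and con': "connected_graph V E" and "E \<subseteq> V \<times> V" "T \<subseteq> V \<times> V"
  shows "\<exists>e'\<in>E. e' \<notin> T - {e} \<and> connected_graph V (insert e' (T - {e}))"
proof -
  obtain x y where xy: "e = (x, y)" by (cases e)
  let ?R = "((T - {e}) \<union> (T - {e})\<inverse>)\<^sup>*"
  have xyV: "x \<in> V" "y \<in> V" using assms xy by auto
  have nxy: "(x, y) \<notin> ?R" using connected_graph_remove_edge[OF con, of x y] dis xy by auto
  \<comment> \<open>Along a walk from \<open>x\<close> in \<open>T\<close> the only lost step is the
    one between \<open>x\<close> and \<open>y\<close>, and after it the walk stands at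
    \<open>x\<close> or \<open>y\<close> itself.\<close>
  have xor: "(x, z) \<in> ?R \<or> (y, z) \<in> ?R" if "z \<in> V" for z
  proof -
    have "(x, z) \<in> (T \<union> T\<inverse>)\<^sup>*" using con xyV that by (auto simp: connected_graph_def)
    thus ?thesis
    proof (induction rule: rtrancl_induct)
      case (step a b)
      have "(a, b) \<in> (T - {e}) \<union> (T - {e})\<inverse> \<or> b = x \<or> b = y"
        using step.hyps xy by auto
      thus ?case
      proof (elim disjE)
        assume ab: "(a, b) \<in> (T - {e}) \<union> (T - {e})\<inverse>"
        show ?thesis using step.IH
        proof
          assume "(x, a) \<in> ?R"
          from rtrancl_into_rtrancl[OF this ab] show ?thesis ..
        next
          assume "(y, a) \<in> ?R"
          from rtrancl_into_rtrancl[OF this ab] show ?thesis ..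
        qed
      qed simp_all
    qed simp
  qed
  define S where "S = {z. (x, z) \<in> ?R}"
  have "\<exists>(a, b)\<in>E. (a \<in> S) \<noteq> (b \<in> S)"
    using con' xyV nxy by (intro reach_crossing[of x y]) (auto simp: connected_graph_def S_def)
  then obtain a b where ab: "(a, b) \<in> E" "(a \<in> S) \<noteq> (b \<in> S)" by blast
  have abV: "a \<in> V" "b \<in> V" using ab assms by auto
  have nin: "(a, b) \<notin> T - {e}"
  proof
    assume h: "(a, b) \<in> T - {e}"
    have r: "(a, b) \<in> ?R" using h by (intro r_into_rtrancl) auto
    have "(x, a) \<in> ?R \<longleftrightarrow> (x, b) \<in> ?R"
      using rtrancl_trans[OF _ r, of x] rtrancl_trans[OF _ reach_sym[OF r], of x] by blast
    thus False using ab(2) unfolding S_def by simp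
  qed
  let ?T = "insert (a, b) (T - {e})"
  let ?Q = "(?T \<union> ?T\<inverse>)\<^sup>*"
  have RQ: "?R \<subseteq> ?Q" by (intro rtrancl_mono) auto
  have abQ: "(a, b) \<in> ?Q" by (intro r_into_rtrancl) auto
  have baQ: "(b, a) \<in> ?Q" by (rule reach_sym[OF abQ])
  have "(x, y) \<in> ?Q"
  proof (cases "a \<in> S")
    case True
    hence "(x, a) \<in> ?R" "(y, b) \<in> ?R" using ab(2) xor[OF abV(2)] by (auto simp: S_def)
    hence "(x, a) \<in> ?Q" "(b, y) \<in> ?Q" using RQ reach_sym[of y b] by blast+
    thus ?thesis using abQ by (meson rtrancl_trans)
  next
    case False
    hence "(x, b) \<in> ?R" "(y, a) \<in> ?R" using ab(2) xor[OF abV(1)] by (auto simp: S_def)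
    hence "(x, b) \<in> ?Q" "(a, y) \<in> ?Q" using RQ reach_sym[of y a] by blast+
    thus ?thesis using baQ by (meson rtrancl_trans)
  qed
  hence x_all: "(x, z) \<in> ?Q" if "z \<in> V" for z
    using xor[OF that] RQ by (meson rtrancl_trans subsetD)
  have "connected_graph V ?T"
    unfolding connected_graph_def
  proof (intro conjI ballI)
    fix u v assume "u \<in> V" "v \<in> V"
    thus "(u, v) \<in> ?Q" using reach_sym[OF x_all[of u]] x_all[of v] by (meson rtrancl_trans)
  qed (use xyV in auto)
  thus ?thesis using ab(1) nin by blast
qed

text \<open>The cut property of minimal spanning trees. An edge outside \<open>Gd\<close> has the
  largest possible cost \<open>l\<close>; it is dropped if redundant and otherwise exchanged for an
  edge of \<open>Gd\<close> across the cut that it closes. Either way the number of edges outside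
  \<open>Gd\<close> decreases.\<close>

lemma connector_exchange:
  fixes c :: "nat \<times> nat \<Rightarrow> real"
  assumes T: "T \<in> connectors n" and Gd: "Gd \<in> connectors n"
    and le: "\<And>h. h \<in> Gd \<Longrightarrow> c h \<le> l" and eq: "\<And>h. h \<in> complete_edges n - Gd \<Longrightarrow> c h = l"
    and l: "0 \<le> l"
  shows "\<exists>T'\<in>connectors n. T' \<subseteq> Gd \<and> sum c T' \<le> sum c T"
  using T
proof (induction "card (T - Gd)" arbitrary: T rule: less_induct)
  case less
  have TK: "T \<subseteq> complete_edges n" "connected_graph {1..n} T"
    and GK: "Gd \<subseteq> complete_edges n" "connected_graph {1..n} Gd"
    using less.prems Gd by (auto simp: connectors_def)
  have finT: "finite T" using TK finite_subset finite_complete_edges by blast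
  show ?case
  proof (cases "T \<subseteq> Gd")
    case True
    thus ?thesis by (intro bexI[OF _ less.prems]) auto
  next
    case False
    then obtain e where e: "e \<in> T" "e \<notin> Gd" by blast
    have ce: "c e = l" using eq[of e] e TK by blast
    have rest: "sum c T = c e + sum c (T - {e})" using finT e by (simp add: sum.remove)
    have card: "card (T - {e} - Gd) < card (T - Gd)"
      using finT e by (intro psubset_card_mono) auto
    show ?thesis
    proof (cases "connected_graph {1..n} (T - {e})")
      case True
      hence "T - {e} \<in> connectors n" using TK by (auto simp: connectors_def)
      from less.hyps[OF card this] obtain T' where
        "T' \<in> connectors n" "T' \<subseteq> Gd" "sum c T' \<le> sum c (T - {e})" by blast
      thus ?thesis using rest ce l by (intro bexI[of _ T']) auto
    next
      case False
      obtain e' where e': "e' \<in> Gd" "e' \<notin> T - {e}" "connected_graph {1..n} (insert e' (T - {e}))"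
        using connected_swap[OF TK(2) e(1) False GK(2)] TK(1) GK(1) complete_edges_subset by blast
      let ?T = "insert e' (T - {e})"
      have "?T \<in> connectors n" using TK GK e' by (auto simp: connectors_def)
      moreover have "?T - Gd = T - {e} - Gd" using e' by auto
      ultimately obtain T' where T': "T' \<in> connectors n" "T' \<subseteq> Gd" "sum c T' \<le> sum c ?T"
        using less.hyps[of ?T] card by auto
      have "sum c ?T = c e' + sum c (T - {e})" using e'(2) finT by (intro sum.insert) auto
      hence "sum c ?T \<le> sum c T" using le[OF e'(1)] rest ce by linarith
      thus ?thesis using T' by (intro bexI[of _ T']) auto
    qed
  qed
qed

text \<open>Every vertex is an end point of some edge, and an edge has two end points. Compared with
  the n - 1 edges of a tree only a constant factor is lost.\<close>

lemma connector_card: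
  assumes T: "T \<in> connectors n" and n: "2 \<le> n"
  shows "n \<le> 2 * card T"
proof -
  have TK: "T \<subseteq> complete_edges n" and con: "connected_graph {1..n} T"
    using T by (auto simp: connectors_def)
  have finT: "finite T" using TK finite_subset finite_complete_edges by blast
  have "{1..n} \<subseteq> fst ` T \<union> snd ` T"
  proof
    fix u assume u: "u \<in> {1..n}"
    obtain v where v: "v \<in> {1..n}" "v \<noteq> u"
      using n u by (metis atLeastAtMost_iff le_antisym nle_le not_less_eq_eq numeral_2_eq_2 One_nat_def)
    have "(u, v) \<in> (T \<union> T\<inverse>)\<^sup>*" using con u v by (auto simp: connected_graph_def)
    then obtain w where "(u, w) \<in> T \<union> T\<inverse>" using v(2) by (metis converse_rtranclE)
    thus "u \<in> fst ` T \<union> snd ` T" by force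
  qed
  hence "n \<le> card (fst ` T \<union> snd ` T)"
    using card_mono[of "fst ` T \<union> snd ` T" "{1..n}"] finT by simp
  also have "\<dots> \<le> card (fst ` T) + card (snd ` T)" by (rule card_Un_le)
  also have "\<dots> \<le> card T + card T" using finT by (intro add_mono card_image_le)
  finally show ?thesis by simp
qed

text \<open>Of a union of components and its complement the smaller one is taken. Then at least
  \<open>card S * card A / 2\<close> pairs are missing, which makes the later union bound over
  \<open>S\<close> summable.\<close>

lemma disconnected_cut:
  assumes fin: "finite A" and ne: "A \<noteq> {}" and dis: "\<not> connected_graph A E"
  shows "\<exists>S\<subseteq>A. S \<noteq> {} \<and> 2 * card S \<le> card A \<and> (\<forall>u\<in>S. \<forall>v\<in>A - S. (u, v) \<notin> E \<and> (v, u) \<notin> E)"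
proof -
  let ?R = "(E \<union> E\<inverse>)\<^sup>*"
  obtain x y where xy: "x \<in> A" "y \<in> A" "(x, y) \<notin> ?R"
    using dis ne unfolding connected_graph_def by blast
  define S where "S = {z\<in>A. (x, z) \<in> ?R}"
  have no: "(u, v) \<notin> E \<and> (v, u) \<notin> E" if "u \<in> S" "v \<in> A - S" for u v
    using that unfolding S_def by (auto dest: rtrancl_into_rtrancl)
  have S: "S \<subseteq> A" "x \<in> S" "y \<notin> S" using xy by (auto simp: S_def)
  have cd: "card (A - S) = card A - card S" "card S \<le> card A"
    using S fin by (auto intro: card_Diff_subset finite_subset card_mono)
  show ?thesis
  proof (cases "2 * card S \<le> card A")
    case True
    thus ?thesis using S no by blast
  next
    case False
    hence "2 * card (A - S) \<le> card A" using cd by linarith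
    moreover have "A - S \<noteq> {}" using S xy by blast
    moreover have "\<forall>u\<in>A - S. \<forall>v\<in>A - (A - S). (u, v) \<notin> E \<and> (v, u) \<notin> E" using no by blast
    ultimately show ?thesis by blast
  qed
qed

section \<open>Spanning trees of the largest component\<close>

lemma edge_less: "(u, v) \<in> complete_edges n \<Longrightarrow> u < v"
  by (simp add: complete_edges_def)

lemma largest_component_facts:
  assumes rule: "largest_component_rule L" and E: "E \<subseteq> complete_edges n" and n: "1 \<le> n"
  shows "L n E \<in> components_graph {1..n} E"
    and "C \<in> components_graph {1..n} E \<Longrightarrow> card C \<le> card (L n E)"
proof -
  have *: "is_arg_max card (\<lambda>C. C \<in> components_graph {1..n} E) (L n E)"
    using rule E n unfolding largest_component_rule_def by blast
  show "L n E \<in> components_graph {1..n} E" using * by (simp add: is_arg_max_def)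
  show "C \<in> components_graph {1..n} E \<Longrightarrow> card C \<le> card (L n E)"
    using * by (auto simp: is_arg_max_def not_less)
qed

lemma component_closed:
  assumes "C \<in> components_graph {1..n} E" "E \<subseteq> complete_edges n"
  shows "C \<subseteq> {1..n}" "connected_graph C (E \<inter> C \<times> C)"
proof -
  let ?R = "(E \<union> E\<inverse>)\<^sup>*"
  obtain x where x: "x \<in> {1..n}" "C = ?R `` {x}"
    using assms(1) unfolding components_graph_def by (rule quotientE)
  have EV: "E \<union> E\<inverse> \<subseteq> {1..n} \<times> {1..n}" using assms(2) complete_edges_subset by blast
  show "C \<subseteq> {1..n}"
  proof
    fix y assume "y \<in> C"
    hence "(x, y) \<in> ?R" using x by auto
    thus "y \<in> {1..n}" using x EV by (induction rule: rtrancl_induct) auto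
  qed
  let ?F = "E \<inter> C \<times> C"
  have reach: "(x, y) \<in> (?F \<union> ?F\<inverse>)\<^sup>*" if "(x, y) \<in> ?R" for y
    using that
  proof (induction rule: rtrancl_induct)
    case (step y z)
    have "y \<in> C" "z \<in> C" using step.hyps x by (auto intro: rtrancl_into_rtrancl)
    hence "(y, z) \<in> ?F \<union> ?F\<inverse>" using step.hyps by auto
    thus ?case using step.IH by (rule rtrancl_into_rtrancl[rotated])
  qed simp
  show "connected_graph C ?F"
    unfolding connected_graph_def
  proof (intro conjI ballI)
    show "C \<noteq> {}" using x by auto
    fix u v assume "u \<in> C" "v \<in> C"
    hence "(x, u) \<in> (?F \<union> ?F\<inverse>)\<^sup>*" "(x, v) \<in> (?F \<union> ?F\<inverse>)\<^sup>*" using reach x by auto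
    thus "(u, v) \<in> (?F \<union> ?F\<inverse>)\<^sup>*" using reach_sym by (meson rtrancl_trans)
  qed
qed

lemma spanning_trees_largest:
  assumes rule: "largest_component_rule L" and E: "E \<subseteq> complete_edges n" and n: "1 \<le> n"
  shows "finite (spanning_trees (L n E) E)" "spanning_trees (L n E) E \<noteq> {}"
proof -
  have finE: "finite E" using E finite_subset finite_complete_edges by blast
  show "finite (spanning_trees (L n E) E)"
    by (rule finite_subset[of _ "Pow E"]) (use finE in \<open>auto simp: spanning_trees_def\<close>)
  have "connected_graph (L n E) (E \<inter> L n E \<times> L n E)"
    using component_closed[OF largest_component_facts(1)[OF rule E n] E] by blast
  then obtain T where "T \<subseteq> E \<inter> L n E \<times> L n E" "is_tree (L n E) T"
    using spanning_tree_exists[of "L n E" "E \<inter> L n E \<times> L n E"] finE E edge_less by blast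
  thus "spanning_trees (L n E) E \<noteq> {}" by (auto simp: spanning_trees_def)
qed

lemma largest_component_connected:
  assumes rule: "largest_component_rule L" and E: "E \<subseteq> complete_edges n" and n: "1 \<le> n"
    and con: "connected_graph {1..n} E"
  shows "L n E = {1..n}"
proof -
  let ?R = "(E \<union> E\<inverse>)\<^sup>*"
  have LC: "L n E \<in> components_graph {1..n} E" by (rule largest_component_facts(1)[OF rule E n])
  then obtain x where x: "x \<in> {1..n}" "L n E = ?R `` {x}"
    unfolding components_graph_def by (rule quotientE)
  have "{1..n} \<subseteq> L n E" using x con unfolding connected_graph_def by blast
  thus ?thesis using component_closed(1)[OF LC E] by blast
qed

text \<open>The component of an edge has two vertices, hence so does the largest one. This serves
  the strict positivity of the mean, by which the tree cost is divided in the end.\<close>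

lemma spanning_tree_largest_nonempty:
  assumes rule: "largest_component_rule L" and E: "E \<subseteq> complete_edges n" and e: "(u, v) \<in> E"
    and T: "T \<in> spanning_trees (L n E) E"
  shows "T \<noteq> {}"
proof
  assume T0: "T = {}"
  have uv: "u \<in> {1..n}" "u < v" using E e by (auto simp: complete_edges_def)
  have n: "1 \<le> n" using uv by auto
  let ?R = "(E \<union> E\<inverse>)\<^sup>*"
  have C: "?R `` {u} \<in> components_graph {1..n} E"
    unfolding components_graph_def using uv by (intro quotientI) auto
  have "{u, v} \<subseteq> ?R `` {u}" using e by auto
  hence "card {u, v} \<le> card (?R `` {u})"
    using component_closed(1)[OF C E] finite_subset by (intro card_mono) blast+
  also have "\<dots> \<le> card (L n E)" by (rule largest_component_facts(2)[OF rule E n C])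
  finally have "2 \<le> card (L n E)" using uv by simp
  moreover have "L n E \<subseteq> {a}" if "a \<in> L n E" for a
    using T T0 that by (auto simp: spanning_trees_def is_tree_def connected_graph_def)
  moreover have "L n E \<noteq> {}" using calculation by auto
  ultimately obtain a where "L n E \<subseteq> {a}" by blast
  hence "card (L n E) \<le> 1" using card_mono[of "{a}" "L n E"] by simp
  thus False using \<open>2 \<le> card (L n E)\<close> by simp
qed

text \<open>An optimal connector for \<open>c'\<close> can be exchanged into \<open>Gd\<close>,
  where both costs agree, and then pruned to a spanning tree. Conversely a spanning tree of
  \<open>E\<close> is a connector, and \<open>c'\<close> is below \<open>c\<close> on
  \<open>E\<close> because the edges of \<open>E\<close> outside \<open>Gd\<close> cost at least
  \<open>l\<close>.\<close>

lemma min_tree_eq_connection_cost: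
  assumes rule: "largest_component_rule L" and E: "E \<subseteq> complete_edges n" and n: "1 \<le> n"
    and Gd: "Gd \<in> connectors n" "Gd \<subseteq> E" and l: "0 \<le> l"
    and good: "\<And>h. h \<in> Gd \<Longrightarrow> c' h = c h \<and> 0 \<le> c h \<and> c h \<le> l"
    and bad: "\<And>h. h \<in> complete_edges n - Gd \<Longrightarrow> c' h = l"
    and bad': "\<And>h. h \<in> E - Gd \<Longrightarrow> l \<le> c h"
  shows "Min (sum c ` spanning_trees (L n E) E) = connection_cost n c'"
proof -
  have con: "connected_graph {1..n} E" using connected_graph_mono Gd by (auto simp: connectors_def)
  have LE: "L n E = {1..n}" by (rule largest_component_connected[OF rule E n con])
  note st = spanning_trees_largest[OF rule E n, unfolded LE]
  have GK: "Gd \<subseteq> complete_edges n" using Gd by (auto simp: connectors_def)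
  show ?thesis
    unfolding LE
  proof (rule antisym)
    obtain T where T: "T \<in> connectors n" "connection_cost n c' = sum c' T"
      using connection_cost_attained[OF n] .
    obtain T' where T': "T' \<in> connectors n" "T' \<subseteq> Gd" "sum c' T' \<le> sum c' T"
      using connector_exchange[OF T(1) Gd(1), of c' l] good bad l by auto
    have T'K: "T' \<subseteq> complete_edges n" "connected_graph {1..n} T'" using T' by (auto simp: connectors_def)
    have fin: "finite T'" using T'K finite_subset finite_complete_edges by blast
    obtain T0 where T0: "T0 \<subseteq> T'" "is_tree {1..n} T0"
      using spanning_tree_exists[OF T'K(2) fin] T'K(1) complete_edges_subset edge_less by blast
    have "T0 \<in> spanning_trees {1..n} E" using T0 T' Gd by (auto simp: spanning_trees_def)
    hence "Min (sum c ` spanning_trees {1..n} E) \<le> sum c T0" using st by (intro Min_le) auto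
    also have "\<dots> = sum c' T0" using T0 T' good by (intro sum.cong) auto
    also have "\<dots> \<le> sum c' T'" using T0 T' good fin by (intro sum_mono2) force+
    also have "\<dots> \<le> connection_cost n c'" using T' T by simp
    finally show "Min (sum c ` spanning_trees {1..n} E) \<le> connection_cost n c'" .
  next
    have "Min (sum c ` spanning_trees {1..n} E) \<in> sum c ` spanning_trees {1..n} E"
      using st by (intro Min_in) auto
    then obtain T where T: "T \<in> spanning_trees {1..n} E"
      "Min (sum c ` spanning_trees {1..n} E) = sum c T" by blast
    have "T \<in> connectors n" using T E by (auto simp: connectors_def spanning_trees_def is_tree_def)
    hence "connection_cost n c' \<le> sum c' T" by (rule connection_cost_le)
    also have "\<dots> \<le> sum c T"
    proof (rule sum_mono)
      fix h assume "h \<in> T"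
      hence hE: "h \<in> E" using T by (auto simp: spanning_trees_def)
      show "c' h \<le> c h"
        using good[of h] bad[of h] bad'[of h] hE E by (cases "h \<in> Gd") auto
    qed
    finally show "connection_cost n c' \<le> Min (sum c ` spanning_trees {1..n} E)" using T by simp
  qed
qed

section \<open>The Efron-Stein inequality\<close>

lemma (in prob_space) integrable_bounded:
  fixes f :: "'a \<Rightarrow> real"
  assumes "f \<in> borel_measurable M" "\<And>x. \<bar>f x\<bar> \<le> B"
  shows "integrable M f"
  by (rule integrable_const_bound[of _ B]) (use assms in auto)

text \<open>The mean is the best constant approximation in the mean square, and the variance is
  nonnegative.\<close>

lemma (in prob_space) variance_le_deviation:
  fixes f :: "'a \<Rightarrow> real"
  assumes [measurable]: "f \<in> borel_measurable M" and b: "\<And>x. \<bar>f x\<bar> \<le> B"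
  shows "(\<integral>x. (f x)\<^sup>2 \<partial>M) - (\<integral>x. f x \<partial>M)\<^sup>2 \<le> (\<integral>x. (f x - c)\<^sup>2 \<partial>M)"
    and "(\<integral>x. f x \<partial>M)\<^sup>2 \<le> (\<integral>x. (f x)\<^sup>2 \<partial>M)"
proof -
  have i1: "integrable M f" using assms by (rule integrable_bounded)
  have i2: "integrable M (\<lambda>x. (f x)\<^sup>2)"
  proof (rule integrable_bounded)
    show "\<bar>(f x)\<^sup>2\<bar> \<le> B\<^sup>2" for x using power_mono[OF b[of x], of 2] by simp
  qed measurable
  have "(\<integral>x. (f x - c)\<^sup>2 \<partial>M) = (\<integral>x. (f x)\<^sup>2 - 2 * c * f x + c\<^sup>2 \<partial>M)"
    by (simp add: power2_diff algebra_simps)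
  also have "\<dots> = (\<integral>x. (f x)\<^sup>2 \<partial>M) - 2 * c * (\<integral>x. f x \<partial>M) + c\<^sup>2"
    using i1 i2 by (simp add: prob_space)
  finally have eq: "(\<integral>x. (f x - c)\<^sup>2 \<partial>M) = (\<integral>x. (f x)\<^sup>2 \<partial>M) - 2 * c * (\<integral>x. f x \<partial>M) + c\<^sup>2" .
  have "0 \<le> ((\<integral>x. f x \<partial>M) - c)\<^sup>2" by simp
  thus "(\<integral>x. (f x)\<^sup>2 \<partial>M) - (\<integral>x. f x \<partial>M)\<^sup>2 \<le> (\<integral>x. (f x - c)\<^sup>2 \<partial>M)"
    unfolding eq by (simp add: power2_diff algebra_simps)
  have "0 \<le> variance f" by simp
  thus "(\<integral>x. f x \<partial>M)\<^sup>2 \<le> (\<integral>x. (f x)\<^sup>2 \<partial>M)" using variance_eq[OF i1 i2] by simp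
qed

text \<open>The comparison functions \<open>g i\<close> are arbitrary except that they ignore
  coordinate \<open>i\<close>; this form avoids independent copies of the coordinates. In the
  induction the variance splits into the variance of the conditional expectation, which the
  hypothesis bounds with averaged \<open>g\<close>, and the mean conditional variance, for which
  \<open>g i\<close> serves as the centre.\<close>

theorem efron_stein:
  fixes M :: "'i \<Rightarrow> 'b measure" and f :: "('i \<Rightarrow> 'b) \<Rightarrow> real"
  assumes M: "\<And>i. prob_space (M i)" and I: "finite I"
    and "f \<in> borel_measurable (PiM I M)" "\<And>x. \<bar>f x\<bar> \<le> B"
    and "\<And>i. i \<in> I \<Longrightarrow> g i \<in> borel_measurable (PiM I M)" "\<And>i x. i \<in> I \<Longrightarrow> \<bar>g i x\<bar> \<le> B"
    and "\<And>i x y. i \<in> I \<Longrightarrow> x \<in> space (PiM I M) \<Longrightarrow> y \<in> space (M i) \<Longrightarrow> g i (x(i := y)) = g i x"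
  shows "(\<integral>x. (f x)\<^sup>2 \<partial>PiM I M) - (\<integral>x. f x \<partial>PiM I M)\<^sup>2 \<le> (\<Sum>i\<in>I. \<integral>x. (f x - g i x)\<^sup>2 \<partial>PiM I M)"
  using I assms(3-)
proof (induction I arbitrary: f g)
  case empty
  interpret P: prob_space "PiM {} M" by (rule prob_space_PiM) (rule M)
  interpret product_sigma_finite M
    using M by (intro product_sigma_finite.intro prob_space_imp_sigma_finite)
  show ?case by (simp add: PiM_empty lebesgue_integral_count_space_finite)
next
  case (insert i I f g)
  note [measurable] = insert.prems(1)
  have gm[measurable]: "j \<in> insert i I \<Longrightarrow> g j \<in> borel_measurable (PiM (insert i I) M)" for j
    by (rule insert.prems(3))
  note fB = insert.prems(2) and gB = insert.prems(4) and ginv = insert.prems(5)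
  interpret product_sigma_finite M
    using M by (intro product_sigma_finite.intro prob_space_imp_sigma_finite)
  let ?P = "PiM I M" and ?Q = "PiM (insert i I) M"
  interpret P: prob_space ?P by (rule prob_space_PiM) (rule M)
  interpret Q: prob_space ?Q by (rule prob_space_PiM) (rule M)
  interpret Mi: prob_space "M i" by (rule M)
  have upd: "(\<lambda>y. x(i := y)) \<in> measurable (M i) ?Q" if "x \<in> space ?P" for x
    using measurable_compose[OF measurable_Pair1'[OF that] measurable_add_dim[of i I M]] by simp
  \<comment> \<open>Integrating out the new coordinate gives the conditional expectation given the
    coordinates in \<open>I\<close>.\<close>
  define avg where "avg u x = (\<integral>y. u (x(i := y)) \<partial>M i)" for u :: "('i \<Rightarrow> 'b) \<Rightarrow> real" and x
  have avg_m[measurable]: "avg u \<in> borel_measurable ?P" if [measurable]: "u \<in> borel_measurable ?Q" for u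
  proof -
    have "(\<lambda>(x, y). u (x(i := y))) \<in> borel_measurable (?P \<Otimes>\<^sub>M M i)"
      using measurable_compose[OF measurable_add_dim[of i I M] that] by (simp add: case_prod_beta)
    thus ?thesis unfolding avg_def by (rule sigma_finite_measure.borel_measurable_lebesgue_integral[OF prob_space_imp_sigma_finite[OF M]])
  qed
  have um: "(\<lambda>y. u (x(i := y))) \<in> borel_measurable (M i)"
    if "u \<in> borel_measurable ?Q" "x \<in> space ?P" for u :: "('i \<Rightarrow> 'b) \<Rightarrow> real" and x
    using measurable_compose[OF upd[OF that(2)] that(1)] .
  have avg_int: "(\<integral>x. u x \<partial>?Q) = (\<integral>x. avg u x \<partial>?P)"
    if "u \<in> borel_measurable ?Q" "\<And>x. \<bar>u x\<bar> \<le> C" for u C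
    unfolding avg_def
    by (rule product_integral_insert[OF insert.hyps(1,2)]) (rule Q.integrable_bounded[OF that])
  have avg_B: "\<bar>avg u x\<bar> \<le> \<bar>C\<bar>" if uC: "\<forall>x. \<bar>u x\<bar> \<le> C" for u C x
  proof -
    have "0 \<le> C" using uC abs_ge_zero order.trans by blast
    have "\<bar>avg u x\<bar> \<le> (\<integral>y. \<bar>u (x(i := y))\<bar> \<partial>M i)" unfolding avg_def by (rule integral_abs_bound)
    also have "\<dots> \<le> (\<integral>y. C \<partial>M i)"
      by (rule integral_mono') (use uC \<open>0 \<le> C\<close> in auto)
    finally show ?thesis by (simp add: Mi.prob_space)
  qed
  have B0: "\<bar>B\<bar> = B" using fB[of undefined] by linarith
  have afB: "\<bar>avg f x\<bar> \<le> B" for x using avg_B[of f B x] fB B0 by simp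
  have agB: "\<bar>avg (g j) x\<bar> \<le> B" if "j \<in> I" for j x using avg_B[of "g j" B x] gB B0 that by simp
  have fg_B: "\<bar>(f x - g j x)\<^sup>2\<bar> \<le> (2 * B)\<^sup>2" if "j \<in> insert i I" for x j
  proof -
    have "\<bar>f x - g j x\<bar> \<le> 2 * B" using fB[of x] gB[OF that, of x] by linarith
    thus ?thesis using power_mono[of "\<bar>f x - g j x\<bar>" "2 * B" 2] by simp
  qed
  have f2_B: "\<bar>(f x)\<^sup>2\<bar> \<le> B\<^sup>2" for x
    using power_mono[OF fB[of x], of 2] by simp
  have IH: "(\<integral>x. (avg f x)\<^sup>2 \<partial>?P) - (\<integral>x. avg f x \<partial>?P)\<^sup>2 \<le> (\<Sum>j\<in>I. \<integral>x. (avg f x - avg (g j) x)\<^sup>2 \<partial>?P)"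
  proof (rule insert.IH)
    show "\<bar>avg f x\<bar> \<le> B" for x by (rule afB)
    show "\<bar>avg (g j) x\<bar> \<le> B" if "j \<in> I" for j x using agB that .
    fix j x y assume j: "j \<in> I" and x: "x \<in> space ?P" and y: "y \<in> space (M j)"
    have ij: "i \<noteq> j" using j insert.hyps by auto
    show "avg (g j) (x(j := y)) = avg (g j) x"
      unfolding avg_def
    proof (rule Bochner_Integration.integral_cong[OF refl])
      fix z assume "z \<in> space (M i)"
      hence "x(i := z) \<in> space ?Q" using measurable_space[OF upd[OF x]] by blast
      thus "g j (x(j := y, i := z)) = g j (x(i := z))"
        using ginv[of j "x(i := z)" y] j y fun_upd_twist[OF ij, of x z y] by (metis insertI2)
    qed
  qed (use gm in auto)
  \<comment> \<open>Averaging over coordinate \<open>i\<close> is a contraction in the mean square,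
    so the terms of the induction hypothesis only grow when the average is undone.\<close>
  have jensen: "(\<integral>x. (avg f x - avg (g j) x)\<^sup>2 \<partial>?P) \<le> (\<integral>x. (f x - g j x)\<^sup>2 \<partial>?Q)" if j: "j \<in> I" for j
  proof -
    have [measurable]: "g j \<in> borel_measurable ?Q" using j gm by simp
    have gBj: "\<bar>g j x\<bar> \<le> B" for x using gB j by simp
    have m: "(\<lambda>x. (f x - g j x)\<^sup>2) \<in> borel_measurable ?Q" by measurable
    have "(\<integral>x. (avg f x - avg (g j) x)\<^sup>2 \<partial>?P) \<le> (\<integral>x. avg (\<lambda>x. (f x - g j x)\<^sup>2) x \<partial>?P)"
    proof (rule integral_mono)
      show "integrable ?P (avg (\<lambda>x. (f x - g j x)\<^sup>2))"
        using avg_m[OF m] avg_B[of "\<lambda>x. (f x - g j x)\<^sup>2" "(2 * B)\<^sup>2"] fg_B j by (intro P.integrable_bounded) auto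
      show "integrable ?P (\<lambda>x. (avg f x - avg (g j) x)\<^sup>2)"
      proof (rule P.integrable_bounded)
        fix x
        have "\<bar>avg f x - avg (g j) x\<bar> \<le> 2 * B"
          using afB[of x] agB[OF j, of x] by linarith
        thus "\<bar>(avg f x - avg (g j) x)\<^sup>2\<bar> \<le> (2 * B)\<^sup>2"
          using power_mono[of "\<bar>avg f x - avg (g j) x\<bar>" "2 * B" 2] by simp
      qed measurable
      fix x assume x: "x \<in> space ?P"
      have "avg f x - avg (g j) x = (\<integral>y. f (x(i := y)) - g j (x(i := y)) \<partial>M i)"
        unfolding avg_def
        by (rule Bochner_Integration.integral_diff[symmetric]; rule Mi.integrable_bounded[where B = B])
          (use um x fB gBj in auto)
      also have "\<dots>\<^sup>2 \<le> (\<integral>y. (f (x(i := y)) - g j (x(i := y)))\<^sup>2 \<partial>M i)"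
      proof (rule Mi.variance_le_deviation(2))
        show "\<bar>f (x(i := y)) - g j (x(i := y))\<bar> \<le> 2 * B" for y
          using fB[of "x(i := y)"] gBj[of "x(i := y)"] by linarith
      qed (use um x in auto)
      finally show "(avg f x - avg (g j) x)\<^sup>2 \<le> avg (\<lambda>x. (f x - g j x)\<^sup>2) x"
        unfolding avg_def by (simp del: fun_upd_apply)
    qed
    also have "\<dots> = (\<integral>x. (f x - g j x)\<^sup>2 \<partial>?Q)"
      using avg_int[OF m fg_B] j by auto
    finally show ?thesis .
  qed
  have last: "(\<integral>x. (f x)\<^sup>2 \<partial>?Q) - (\<integral>x. (avg f x)\<^sup>2 \<partial>?P) \<le> (\<integral>x. (f x - g i x)\<^sup>2 \<partial>?Q)"
  proof -
    have [measurable]: "g i \<in> borel_measurable ?Q" using gm by simp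
    have m: "(\<lambda>x. (f x - g i x)\<^sup>2) \<in> borel_measurable ?Q" by measurable
    have m2: "(\<lambda>x. (f x)\<^sup>2) \<in> borel_measurable ?Q" by measurable
    have i2: "integrable ?P (avg (\<lambda>x. (f x)\<^sup>2))"
      using avg_m[OF m2] avg_B[of "\<lambda>x. (f x)\<^sup>2" "B\<^sup>2"] f2_B by (intro P.integrable_bounded) auto
    have i1: "integrable ?P (\<lambda>x. (avg f x)\<^sup>2)"
    proof (rule P.integrable_bounded)
      fix x
      show "\<bar>(avg f x)\<^sup>2\<bar> \<le> B\<^sup>2" using power_mono[OF afB[of x], of 2] by simp
    qed measurable
    have "(\<integral>x. (f x)\<^sup>2 \<partial>?Q) - (\<integral>x. (avg f x)\<^sup>2 \<partial>?P) = (\<integral>x. avg (\<lambda>x. (f x)\<^sup>2) x - (avg f x)\<^sup>2 \<partial>?P)"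
      using avg_int[OF m2 f2_B] i1 i2 by simp
    also have "\<dots> \<le> (\<integral>x. avg (\<lambda>x. (f x - g i x)\<^sup>2) x \<partial>?P)"
    proof (rule integral_mono)
      show "integrable ?P (avg (\<lambda>x. (f x - g i x)\<^sup>2))"
        using avg_m[OF m] avg_B[of "\<lambda>x. (f x - g i x)\<^sup>2" "(2 * B)\<^sup>2"] fg_B by (intro P.integrable_bounded) auto
      show "integrable ?P (\<lambda>x. avg (\<lambda>x. (f x)\<^sup>2) x - (avg f x)\<^sup>2)" using i1 i2 by simp
      fix x assume x: "x \<in> space ?P"
      obtain y0 where y0: "y0 \<in> space (M i)" using Mi.not_empty by blast
      \<comment> \<open>For fixed \<open>x\<close> the function \<open>g i\<close> has a single
        value along coordinate \<open>i\<close>; any point \<open>y0\<close> reveals it.\<close>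
      let ?c = "g i (x(i := y0))"
      have xQ: "x(i := y0) \<in> space ?Q" using measurable_space[OF upd[OF x] y0] .
      have "avg (\<lambda>x. (f x)\<^sup>2) x - (avg f x)\<^sup>2 \<le> (\<integral>y. (f (x(i := y)) - ?c)\<^sup>2 \<partial>M i)"
        unfolding avg_def by (rule Mi.variance_le_deviation(1)[where B = B]) (use um x fB in auto)
      also have "\<dots> = avg (\<lambda>x. (f x - g i x)\<^sup>2) x"
        unfolding avg_def
      proof (rule Bochner_Integration.integral_cong[OF refl])
        fix y assume "y \<in> space (M i)"
        hence "g i (x(i := y)) = ?c" using ginv[of i, OF _ xQ, of y] by (simp del: fun_upd_apply)
        thus "(f (x(i := y)) - ?c)\<^sup>2 = (f (x(i := y)) - g i (x(i := y)))\<^sup>2" by (simp del: fun_upd_apply)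
      qed
      finally show "avg (\<lambda>x. (f x)\<^sup>2) x - (avg f x)\<^sup>2 \<le> avg (\<lambda>x. (f x - g i x)\<^sup>2) x" .
    qed
    also have "\<dots> = (\<integral>x. (f x - g i x)\<^sup>2 \<partial>?Q)"
      using avg_int[OF m fg_B] by auto
    finally show ?thesis .
  qed
  have "(\<Sum>j\<in>I. \<integral>x. (avg f x - avg (g j) x)\<^sup>2 \<partial>?P) \<le> (\<Sum>j\<in>I. \<integral>x. (f x - g j x)\<^sup>2 \<partial>?Q)"
    by (intro sum_mono jensen)
  moreover have "(\<integral>x. f x \<partial>?Q) = (\<integral>x. avg f x \<partial>?P)"
    by (rule avg_int[OF _ fB]) measurable
  ultimately show ?case using IH last insert.hyps by simp
qed

section \<open>The marked random graph\<close>

text \<open>A coordinate equal to 1 has index \<open>m\<close>, so the closed square meets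
  \<open>m + 1\<close> rows and columns of cells, the last ones in null sets only.\<close>

definition cell :: "nat \<Rightarrow> real ^ 2 \<Rightarrow> int \<times> int" where
  "cell m x = (\<lfloor>real m * x $ 1\<rfloor>, \<lfloor>real m * x $ 2\<rfloor>)"

lemma cell_measurable [measurable]: "{x. cell m x \<in> A} \<in> sets borel"
proof -
  have [measurable]: "(\<lambda>x :: real ^ 2. x $ i) \<in> borel_measurable borel" for i
    by (intro borel_measurable_continuous_onI continuous_intros)
  have "(\<lambda>x :: real ^ 2. (\<lfloor>real m * x $ 1\<rfloor>, \<lfloor>real m * x $ 2\<rfloor>)) \<in> measurable borel (count_space UNIV \<Otimes>\<^sub>M count_space UNIV)"
    by measurable
  hence "cell m \<in> measurable borel (count_space UNIV)"
    by (simp add: cell_def[abs_def] pair_measure_countable)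
  from measurable_sets[OF this, of A] show ?thesis by (simp add: vimage_def)
qed

lemma emeasure_box_2:
  fixes l u :: "real ^ 2"
  assumes "l $ 1 \<le> u $ 1" "l $ 2 \<le> u $ 2"
  shows "emeasure lborel (box l u) = ennreal ((u $ 1 - l $ 1) * (u $ 2 - l $ 2))"
    and "emeasure lborel (cbox l u) = ennreal ((u $ 1 - l $ 1) * (u $ 2 - l $ 2))"
proof -
  have le: "\<forall>i. l $ i \<le> u $ i" using assms by (simp add: forall_2)
  have *: "\<forall>b\<in>Basis. l \<bullet> b \<le> u \<bullet> b"
    using le by (auto simp: Basis_vec_def inner_axis)
  have "cbox l u \<noteq> {}" using le by (simp add: interval_ne_empty_cart)
  hence c: "measure lborel (cbox l u) = (u $ 1 - l $ 1) * (u $ 2 - l $ 2)"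
    by (simp add: content_cbox_cart UNIV_2)
  show "emeasure lborel (cbox l u) = ennreal ((u $ 1 - l $ 1) * (u $ 2 - l $ 2))"
    using c emeasure_lborel_cbox_finite[of l u] by (simp add: emeasure_eq_ennreal_measure)
  have "emeasure lborel (box l u) = emeasure lborel (cbox l u)"
    using * by (simp add: emeasure_lborel_box_eq emeasure_lborel_cbox_eq)
  thus "emeasure lborel (box l u) = ennreal ((u $ 1 - l $ 1) * (u $ 2 - l $ 2))"
    using c emeasure_lborel_cbox_finite[of l u] by (simp add: emeasure_eq_ennreal_measure)
qed

lemma cell_subset_cbox:
  assumes m: "0 < m"
  shows "{x. cell m x = (a, b)} \<subseteq> cbox (vector [a / m, b / m]) (vector [(a + 1) / m, (b + 1) / m])"
    and "box (vector [a / m, b / m]) (vector [(a + 1) / m, (b + 1) / m]) \<subseteq> {x. cell m x = (a, b)}"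
  using m by (auto simp: cell_def mem_box_cart forall_2 floor_eq_iff field_simps)

definition neighbours :: "int \<times> int \<Rightarrow> (int \<times> int) set" where
  "neighbours a = {fst a - 1..fst a + 1} \<times> {snd a - 1..snd a + 1}"

lemma card_neighbours: "card (neighbours a) = 9" "finite (neighbours a)"
  by (simp_all add: neighbours_def card_cartesian_product)

lemma floor_close:
  fixes x y :: real
  assumes "\<bar>x - y\<bar> \<le> 1"
  shows "\<lfloor>y\<rfloor> \<in> {\<lfloor>x\<rfloor> - 1..\<lfloor>x\<rfloor> + 1}"
  using assms by auto linarith+

text \<open>The cells are at least \<open>e\<close> wide, so a move by at most \<open>e\<close>
  changes each index by at most one. If \<open>e > 1\<close>, the maximum yields a single cell per
  side, and the claim persists because the square has side 1.\<close>

lemma cell_close: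
  assumes xy: "x \<in> unit_square" "y \<in> unit_square" and d: "dist x y \<le> e" and e: "0 < e"
  shows "cell (max 1 (nat \<lfloor>1 / e\<rfloor>)) y \<in> neighbours (cell (max 1 (nat \<lfloor>1 / e\<rfloor>)) x)"
proof -
  let ?m = "max 1 (nat \<lfloor>1 / e\<rfloor>)"
  have "\<bar>real ?m * x $ i - real ?m * y $ i\<bar> \<le> 1" for i
  proof -
    have "0 \<le> x $ i" "x $ i \<le> 1" "0 \<le> y $ i" "y $ i \<le> 1" using xy by (auto simp: unit_square_def)
    hence "\<bar>x $ i - y $ i\<bar> \<le> 1" by linarith
    moreover have "\<bar>x $ i - y $ i\<bar> \<le> e"
      using component_le_norm_cart[of "x - y" i] d by (simp add: dist_norm)
    moreover have "real (nat \<lfloor>1 / e\<rfloor>) * e \<le> 1"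
    proof -
      define k where "k = \<lfloor>1 / e\<rfloor>"
      have "0 \<le> k" "real_of_int k \<le> 1 / e" using e by (simp_all add: k_def)
      hence "real (nat k) \<le> 1 / e" by simp
      thus ?thesis using e unfolding k_def[symmetric] by (simp add: pos_le_divide_eq)
    qed
    ultimately have "real ?m * \<bar>x $ i - y $ i\<bar> \<le> 1"
    proof (cases "1 \<le> nat \<lfloor>1 / e\<rfloor>")
      case True
      have "real (nat \<lfloor>1 / e\<rfloor>) * \<bar>x $ i - y $ i\<bar> \<le> real (nat \<lfloor>1 / e\<rfloor>) * e"
        using \<open>\<bar>x $ i - y $ i\<bar> \<le> e\<close> by (intro mult_left_mono) auto
      thus ?thesis using True \<open>real (nat \<lfloor>1 / e\<rfloor>) * e \<le> 1\<close> by (simp add: max_def)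
    next
      case False
      thus ?thesis using \<open>\<bar>x $ i - y $ i\<bar> \<le> 1\<close> by (simp add: max_def)
    qed
    thus ?thesis by (simp add: abs_mult flip: right_diff_distrib)
  qed
  thus ?thesis unfolding cell_def neighbours_def using floor_close by simp
qed

text \<open>Rounding \<open>1 / e\<close> down, or up to 1, changes it by a factor of at most two in
  the harmful direction, so the area of a cell stays of the order of the square of
  \<open>e\<close>.\<close>

lemma mesh_bound:
  assumes e: "0 < e"
  shows "1 / (real (max 1 (nat \<lfloor>1 / e\<rfloor>)))\<^sup>2 \<le> 4 * e\<^sup>2"
proof -
  let ?m = "real (max 1 (nat \<lfloor>1 / e\<rfloor>))"
  have "1 / e < 2 * ?m"
  proof (cases "1 \<le> 1 / e")
    case True
    define k where "k = \<lfloor>1 / e\<rfloor>"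
    have "1 / e < real_of_int k + 1" unfolding k_def by linarith
    moreover have "1 \<le> k" using True by (simp add: k_def)
    ultimately show ?thesis unfolding k_def[symmetric] by (simp add: max_def nat_le_iff le_nat_iff)
  qed auto
  hence "1 \<le> 2 * ?m * e" using e by (simp add: field_simps)
  hence "1\<^sup>2 \<le> (2 * ?m * e)\<^sup>2" by (intro power_mono) auto
  thus ?thesis by (simp add: field_simps power_mult_distrib)
qed

lemma dist_unit_square:
  assumes "x \<in> unit_square" "y \<in> unit_square"
  shows "dist x y \<le> sqrt 2"
proof -
  have "(x $ i - y $ i)\<^sup>2 \<le> 1" for i
  proof -
    have "0 \<le> x $ i" "x $ i \<le> 1" "0 \<le> y $ i" "y $ i \<le> 1" using assms by (auto simp: unit_square_def)
    hence "\<bar>x $ i - y $ i\<bar> \<le> 1" by linarith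
    thus ?thesis by (simp add: abs_square_le_1)
  qed
  from this[of 1] this[of 2] show ?thesis
    by (simp add: dist_norm norm_vec_def L2_set_def UNIV_2)
qed

text \<open>One graph of fixed size. All estimates in this locale have explicit constants, so that
  their independence of \<open>n\<close> is visible when the locale is interpreted for every
  \<open>n\<close>.\<close>

locale euclidean_mst = marked_random_graph M n "\<lambda>_. p" F f Z W X
  for M :: "'a measure" and n :: nat and p :: real and F :: "real \<Rightarrow> real"
    and f :: "real ^ 2 \<Rightarrow> real" and Z :: "nat \<times> nat \<Rightarrow> 'a \<Rightarrow> bool"
    and W :: "nat \<times> nat \<Rightarrow> 'a \<Rightarrow> real" and X :: "nat \<Rightarrow> 'a \<Rightarrow> real ^ 2" +
  fixes \<alpha> \<delta> \<epsilon>1 \<epsilon>2 :: real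
  assumes n2: "2 \<le> n" and eps: "0 < \<epsilon>1" "0 < \<epsilon>2" and alpha: "0 < \<alpha>" and delta: "0 < \<delta>" "\<delta> < 1"
    and f_bounds: "\<And>x. x \<in> unit_square \<Longrightarrow> \<epsilon>1 \<le> f x \<and> f x \<le> \<epsilon>2"
    and F: "\<And>x. 0 < x \<Longrightarrow> x < 1 \<Longrightarrow> F x = x powr (1 / \<delta>)"
begin

section \<open>Events determined by groups of independent variables\<close>

abbreviation "zi h \<equiv> (Inl h :: (nat \<times> nat) + (nat \<times> nat) + nat)"
abbreviation "wi h \<equiv> (Inr (Inl h) :: (nat \<times> nat) + (nat \<times> nat) + nat)"
abbreviation "xi u \<equiv> (Inr (Inr u) :: (nat \<times> nat) + (nat \<times> nat) + nat)"

abbreviation "K\<^sub>n \<equiv> complete_edges n"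

definition all_ix :: "((nat \<times> nat) + (nat \<times> nat) + nat) set" where
  "all_ix = K\<^sub>n <+> (K\<^sub>n <+> {1..n})"

definition var_events :: "(nat \<times> nat) + (nat \<times> nat) + nat \<Rightarrow> 'a set set" where
  "var_events i = (case i of
             Inl h \<Rightarrow> events_of M (count_space UNIV) (Z h)
           | Inr (Inl h) \<Rightarrow> events_of M borel (W h)
           | Inr (Inr u) \<Rightarrow> events_of M borel (X u))"

text \<open>Membership in the sigma-algebra generated by the listed variables. It reduces
  independence to bookkeeping: events with disjoint index sets are independent.\<close>

definition depends_on :: "((nat \<times> nat) + (nat \<times> nat) + nat) set \<Rightarrow> ('a \<Rightarrow> bool) \<Rightarrow> bool" where
  "depends_on I P \<longleftrightarrow> {\<omega> \<in> space M. P \<omega>} \<in> sigma_sets (space M) (\<Union>i\<in>I. var_events i)"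

lemma p01: "0 < p" "p < 1"
proof -
  have "(1, 2) \<in> K\<^sub>n" using n2 by (auto simp: complete_edges_def)
  thus "0 < p" "p < 1" using p_range by auto
qed

lemma X_measurable: "u \<in> {1..n} \<Longrightarrow> X u \<in> borel_measurable M"
  using X_density[of u] unfolding distributed_def by simp

lemma independent': "indep_sets var_events all_ix"
  using independent unfolding var_events_def[abs_def] all_ix_def .

lemma var_events_sets: "i \<in> all_ix \<Longrightarrow> var_events i \<subseteq> events"
  using independent' unfolding indep_sets_def by blast

lemma Int_stable_var_events: "Int_stable (var_events i)"
proof -
  have *: "Int_stable (events_of M N Y)" for N :: "'b measure" and Y
  proof (rule Int_stableI)
    fix a b assume "a \<in> events_of M N Y" "b \<in> events_of M N Y"
    then obtain A B where AB: "A \<in> sets N" "B \<in> sets N" "a = Y -` A \<inter> space M" "b = Y -` B \<inter> space M"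
      by (auto simp: events_of_def)
    hence "a \<inter> b = Y -` (A \<inter> B) \<inter> space M" by auto
    thus "a \<inter> b \<in> events_of M N Y" using AB(1,2) unfolding events_of_def by blast
  qed
  show ?thesis unfolding var_events_def by (auto split: sum.split intro: *)
qed

lemma sigma_algebra_var: "sigma_algebra (space M) (sigma_sets (space M) (\<Union>i\<in>I. var_events i))"
  by (rule sigma_algebra_sigma_sets) (auto simp: var_events_def events_of_def split: sum.splits)

lemma depends_on_sets:
  assumes "depends_on I P" "I \<subseteq> all_ix"
  shows "{\<omega> \<in> space M. P \<omega>} \<in> events"
proof -
  have "(\<Union>i\<in>I. var_events i) \<subseteq> events" using var_events_sets assms(2) by blast
  hence "sigma_sets (space M) (\<Union>i\<in>I. var_events i) \<subseteq> events"
    by (rule sets.sigma_sets_subset)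
  thus ?thesis using assms(1) unfolding depends_on_def by blast
qed

lemma depends_on_mono:
  assumes "depends_on I P" "I \<subseteq> I'"
  shows "depends_on I' P"
proof -
  have "sigma_sets (space M) (\<Union>i\<in>I. var_events i) \<subseteq> sigma_sets (space M) (\<Union>i\<in>I'. var_events i)"
    by (rule sigma_sets_mono') (use assms(2) in blast)
  thus ?thesis using assms(1) unfolding depends_on_def by blast
qed

lemma depends_on_const: "depends_on I (\<lambda>_. c)"
proof (cases c)
  case True
  thus ?thesis using sigma_sets_top unfolding depends_on_def by simp
qed (simp add: depends_on_def sigma_sets.Empty)

lemma depends_on_not: "depends_on I P \<Longrightarrow> depends_on I (\<lambda>\<omega>. \<not> P \<omega>)"
proof -
  assume "depends_on I P"
  hence "space M - {\<omega> \<in> space M. P \<omega>} \<in> sigma_sets (space M) (\<Union>i\<in>I. var_events i)"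
    unfolding depends_on_def by (rule sigma_sets.Compl)
  moreover have "space M - {\<omega> \<in> space M. P \<omega>} = {\<omega> \<in> space M. \<not> P \<omega>}" by auto
  ultimately show ?thesis unfolding depends_on_def by simp
qed

lemma depends_on_conj:
  assumes "depends_on I P" "depends_on I Q"
  shows "depends_on I (\<lambda>\<omega>. P \<omega> \<and> Q \<omega>)"
proof -
  have eq: "{\<omega> \<in> space M. P \<omega> \<and> Q \<omega>} = {\<omega> \<in> space M. P \<omega>} \<inter> {\<omega> \<in> space M. Q \<omega>}" by blast
  interpret S: sigma_algebra "space M" "sigma_sets (space M) (\<Union>i\<in>I. var_events i)"
    by (rule sigma_algebra_var)
  show ?thesis using assms unfolding depends_on_def eq by (rule S.Int)
qed

lemma depends_on_disj:
  assumes "depends_on I P" "depends_on I Q"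
  shows "depends_on I (\<lambda>\<omega>. P \<omega> \<or> Q \<omega>)"
  using depends_on_not[OF depends_on_conj[OF depends_on_not[OF assms(1)] depends_on_not[OF assms(2)]]]
  by simp

lemma depends_on_ball:
  assumes "finite A" "\<And>a. a \<in> A \<Longrightarrow> depends_on I (P a)"
  shows "depends_on I (\<lambda>\<omega>. \<forall>a\<in>A. P a \<omega>)"
  using assms
proof (induction A rule: finite_induct)
  case empty
  show ?case using depends_on_const[of I True] by simp
next
  case (insert a A)
  thus ?case using depends_on_conj[of I "P a" "\<lambda>\<omega>. \<forall>a\<in>A. P a \<omega>"] by simp
qed

lemma depends_on_Z: "depends_on {zi h} (Z h)"
proof -
  have "Z h -` {True} \<inter> space M \<in> var_events (zi h)"
    by (force simp: var_events_def events_of_def)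
  moreover have "Z h -` {True} \<inter> space M = {\<omega> \<in> space M. Z h \<omega>}" by auto
  ultimately show ?thesis unfolding depends_on_def by auto
qed

lemma depends_on_W:
  assumes "A \<in> sets borel"
  shows "depends_on {wi h} (\<lambda>\<omega>. W h \<omega> \<in> A)"
proof -
  have "W h -` A \<inter> space M \<in> var_events (wi h)"
    using assms by (force simp: var_events_def events_of_def)
  moreover have "W h -` A \<inter> space M = {\<omega> \<in> space M. W h \<omega> \<in> A}" by auto
  ultimately show ?thesis unfolding depends_on_def by auto
qed

lemma depends_on_X:
  assumes "A \<in> sets borel"
  shows "depends_on {xi u} (\<lambda>\<omega>. X u \<omega> \<in> A)"
proof -
  have "X u -` A \<inter> space M \<in> var_events (xi u)"
    using assms by (force simp: var_events_def events_of_def)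
  moreover have "X u -` A \<inter> space M = {\<omega> \<in> space M. X u \<omega> \<in> A}" by auto
  ultimately show ?thesis unfolding depends_on_def by auto
qed

lemma depends_on_W_le: "depends_on {wi h} (\<lambda>\<omega>. W h \<omega> \<le> x)"
  using depends_on_W[of "{..x}" h] by simp

lemma depends_on_cell: "depends_on {xi u} (\<lambda>\<omega>. cell m (X u \<omega>) \<in> A)"
  using depends_on_X[OF cell_measurable[of m A], of u] by simp

text \<open>Grouping independent intersection-stable generators along disjoint index sets leaves
  independent sigma-algebras. All product formulas for probabilities below go back to this.\<close>

lemma prob_ball_depends_on:
  assumes fin: "finite L" and disj: "disjoint_family_on I L"
    and dep: "\<And>l. l \<in> L \<Longrightarrow> depends_on (I l) (P l)" and sub: "\<And>l. l \<in> L \<Longrightarrow> I l \<subseteq> all_ix"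
  shows "prob {\<omega> \<in> space M. \<forall>l\<in>L. P l \<omega>} = (\<Prod>l\<in>L. prob {\<omega> \<in> space M. P l \<omega>})"
proof (cases "L = {}")
  case True
  thus ?thesis by (simp add: prob_space)
next
  case False
  have "indep_sets (\<lambda>l. sigma_sets (space M) (\<Union>i\<in>I l. var_events i)) L"
  proof (rule indep_sets_collect_sigma)
    show "indep_sets var_events (\<Union>l\<in>L. I l)"
      using independent' sub by (intro indep_sets_mono_index[OF _ independent']) auto
  qed (use disj Int_stable_var_events in auto)
  hence "prob (\<Inter>l\<in>L. {\<omega> \<in> space M. P l \<omega>}) = (\<Prod>l\<in>L. prob {\<omega> \<in> space M. P l \<omega>})"
    by (rule indep_setsD) (use fin False dep in \<open>auto simp: depends_on_def\<close>)
  moreover have "(\<Inter>l\<in>L. {\<omega> \<in> space M. P l \<omega>}) = {\<omega> \<in> space M. \<forall>l\<in>L. P l \<omega>}" using False by auto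
  ultimately show ?thesis by simp
qed

lemma prob_conj_depends_on:
  assumes "depends_on I P" "depends_on I' Q" "I \<inter> I' = {}" "I \<subseteq> all_ix" "I' \<subseteq> all_ix"
  shows "prob {\<omega> \<in> space M. P \<omega> \<and> Q \<omega>} = prob {\<omega> \<in> space M. P \<omega>} * prob {\<omega> \<in> space M. Q \<omega>}"
proof -
  have "prob {\<omega> \<in> space M. \<forall>l\<in>(UNIV :: bool set). case_bool P Q l \<omega>}
      = (\<Prod>l\<in>(UNIV :: bool set). prob {\<omega> \<in> space M. case_bool P Q l \<omega>})"
  proof (rule prob_ball_depends_on[where I = "case_bool I I'"])
    show "disjoint_family_on (case_bool I I') UNIV"
      using assms(3) by (auto simp: disjoint_family_on_def split: bool.splits)
  qed (use assms in \<open>auto split: bool.splits\<close>)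
  moreover have "{\<omega> \<in> space M. \<forall>l\<in>(UNIV :: bool set). case_bool P Q l \<omega>} = {\<omega> \<in> space M. P \<omega> \<and> Q \<omega>}"
    by (auto simp: all_bool_eq)
  ultimately show ?thesis by (simp add: UNIV_bool mult.commute)
qed

lemma all_ix_iff [simp]:
  "zi h \<in> all_ix \<longleftrightarrow> h \<in> K\<^sub>n" "wi h \<in> all_ix \<longleftrightarrow> h \<in> K\<^sub>n" "xi u \<in> all_ix \<longleftrightarrow> u \<in> {1..n}"
  by (auto simp: all_ix_def)

section \<open>Laws of single presence variables, weights and locations\<close>

lemma prob_Z: "h \<in> K\<^sub>n \<Longrightarrow> prob {\<omega> \<in> space M. Z h \<omega>} = p"
proof -
  assume h: "h \<in> K\<^sub>n"
  have "measure (distr M (count_space UNIV) (Z h)) {True} = p"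
    unfolding Z_bernoulli[OF h] using p01 by (simp add: measure_pmf_single)
  hence "prob (Z h -` {True} \<inter> space M) = p"
    using Z_measurable[OF h] by (simp add: measure_distr)
  moreover have "Z h -` {True} \<inter> space M = {\<omega> \<in> space M. Z h \<omega>}" by auto
  ultimately show ?thesis by simp
qed

lemma prob_W_eq_F: "h \<in> K\<^sub>n \<Longrightarrow> prob {\<omega> \<in> space M. W h \<omega> \<le> x} = F x"
proof -
  assume h: "h \<in> K\<^sub>n"
  have "prob (W h -` {..x} \<inter> space M) = F x"
    using W_cdf[OF h, of x] W_measurable[OF h] by (simp add: cdf_def measure_distr)
  moreover have "W h -` {..x} \<inter> space M = {\<omega> \<in> space M. W h \<omega> \<le> x}" by auto
  ultimately show ?thesis by simp
qed

text \<open>The cdf is prescribed on the open unit interval only; monotonicity and the limit at 1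
  from the left fix it from 1 on. Consequently weights are at most 1 almost surely.\<close>

lemma F_ge_1: "1 \<le> x \<Longrightarrow> F x = 1"
proof -
  assume x: "1 \<le> x"
  have h: "(1, 2) \<in> K\<^sub>n" using n2 by (auto simp: complete_edges_def)
  have [measurable]: "W (1, 2) \<in> borel_measurable M" by (rule W_measurable[OF h])
  have mono: "F y \<le> F x" if "y \<le> x" for y
    unfolding prob_W_eq_F[OF h, symmetric] using that depends_on_sets[OF depends_on_W_le[of "(1, 2)" x]] h by (intro finite_measure_mono) auto
  have "((\<lambda>y. y powr (1 / \<delta>)) \<longlongrightarrow> 1 powr (1 / \<delta>)) (at_left 1)"
    by (intro tendsto_intros) auto
  moreover have "eventually (\<lambda>y. y powr (1 / \<delta>) \<le> F x) (at_left (1 :: real))"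
  proof (rule eventually_at_leftI[of 0])
    fix y :: real assume "y \<in> {0<..<1}"
    thus "y powr (1 / \<delta>) \<le> F x" using mono[of y] F[of y] x by auto
  qed simp
  ultimately have "1 \<le> F x" using tendsto_upperbound[of _ "1 powr (1 / \<delta>)" "at_left (1 :: real)" "F x"] by simp
  moreover have "F x \<le> 1" unfolding prob_W_eq_F[OF h, symmetric] by simp
  ultimately show ?thesis by simp
qed

lemma prob_W_le: "h \<in> K\<^sub>n \<Longrightarrow> 0 < x \<Longrightarrow> prob {\<omega> \<in> space M. W h \<omega> \<le> x} \<le> x powr (1 / \<delta>)"
  using prob_W_eq_F[of h x] F[of x] F_ge_1[of x] delta
  by (cases "x < 1") (auto intro: ge_one_powr_ge_zero)

lemma prob_W_eq: "h \<in> K\<^sub>n \<Longrightarrow> 0 < x \<Longrightarrow> x \<le> 1 \<Longrightarrow> prob {\<omega> \<in> space M. W h \<omega> \<le> x} = x powr (1 / \<delta>)"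
  using prob_W_eq_F[of h x] F[of x] F_ge_1[of x] by (cases "x < 1") auto

lemma AE_W_le_1: "h \<in> K\<^sub>n \<Longrightarrow> AE \<omega> in M. W h \<omega> \<le> 1"
  by (subst prob_Collect_eq_1[symmetric])
    (use prob_W_eq[of h 1] W_measurable[of h] in \<open>auto\<close>)

lemma prob_X_upper:
  assumes u: "u \<in> {1..n}" and A: "A \<in> sets borel" "emeasure lborel A \<le> ennreal c" "0 \<le> c"
  shows "prob {\<omega> \<in> space M. X u \<omega> \<in> A} \<le> \<epsilon>2 * c"
proof -
  have "emeasure M (X u -` A \<inter> space M) = (\<integral>\<^sup>+x. ennreal (f x * indicator unit_square x) * indicator A x \<partial>lborel)"
    using A by (intro distributed_emeasure[OF X_density[OF u]]) auto
  also have "\<dots> \<le> (\<integral>\<^sup>+x. ennreal \<epsilon>2 * indicator A x \<partial>lborel)"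
  proof (rule nn_integral_mono)
    fix x
    have "f x * indicator unit_square x \<le> \<epsilon>2" using f_bounds[of x] eps by (auto simp: indicator_def)
    thus "ennreal (f x * indicator unit_square x) * indicator A x \<le> ennreal \<epsilon>2 * indicator A x"
      by (intro mult_right_mono ennreal_leI) auto
  qed
  also have "\<dots> = ennreal \<epsilon>2 * emeasure lborel A" using A by (simp add: nn_integral_cmult_indicator)
  also have "\<dots> \<le> ennreal \<epsilon>2 * ennreal c" using A by (intro mult_left_mono) auto
  finally have "ennreal (prob (X u -` A \<inter> space M)) \<le> ennreal (\<epsilon>2 * c)"
    using eps A by (simp add: emeasure_eq_measure ennreal_mult)
  moreover have "X u -` A \<inter> space M = {\<omega> \<in> space M. X u \<omega> \<in> A}" by auto
  ultimately show ?thesis using eps A by simp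
qed

lemma prob_X_lower:
  assumes u: "u \<in> {1..n}" and A: "A \<in> sets borel" "A \<subseteq> unit_square" "ennreal c \<le> emeasure lborel A" "0 \<le> c"
  shows "\<epsilon>1 * c \<le> prob {\<omega> \<in> space M. X u \<omega> \<in> A}"
proof -
  have "ennreal \<epsilon>1 * ennreal c \<le> ennreal \<epsilon>1 * emeasure lborel A" using A by (intro mult_left_mono) auto
  also have "\<dots> = (\<integral>\<^sup>+x. ennreal \<epsilon>1 * indicator A x \<partial>lborel)" using A by (simp add: nn_integral_cmult_indicator)
  also have "\<dots> \<le> (\<integral>\<^sup>+x. ennreal (f x * indicator unit_square x) * indicator A x \<partial>lborel)"
  proof (rule nn_integral_mono)
    fix x
    show "ennreal \<epsilon>1 * indicator A x \<le> ennreal (f x * indicator unit_square x) * indicator A x"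
      using f_bounds[of x] A(2) by (auto simp: indicator_def intro: ennreal_leI)
  qed
  also have "\<dots> = emeasure M (X u -` A \<inter> space M)"
    using A by (intro distributed_emeasure[OF X_density[OF u], symmetric]) auto
  finally have "ennreal (\<epsilon>1 * c) \<le> ennreal (prob (X u -` A \<inter> space M))"
    using eps A by (simp add: emeasure_eq_measure ennreal_mult)
  moreover have "X u -` A \<inter> space M = {\<omega> \<in> space M. X u \<omega> \<in> A}" by auto
  ultimately show ?thesis by simp
qed

lemma AE_X_unit_square: "u \<in> {1..n} \<Longrightarrow> AE \<omega> in M. X u \<omega> \<in> unit_square"
proof -
  assume u: "u \<in> {1..n}"
  have m: "X u \<in> borel_measurable M" by (rule X_measurable[OF u])
  have cl: "closed unit_square"
    unfolding unit_square_def by (intro closed_Collect_all closed_Collect_conj closed_Collect_le continuous_intros)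
  let ?A = "- unit_square"
  have A: "?A \<in> sets borel" using cl by (intro borel_comp borel_closed)
  have "emeasure M (X u -` ?A \<inter> space M) = (\<integral>\<^sup>+x. ennreal (f x * indicator unit_square x) * indicator ?A x \<partial>lborel)"
    using A by (intro distributed_emeasure[OF X_density[OF u]]) auto
  also have "\<dots> = (\<integral>\<^sup>+(x :: real ^ 2). 0 \<partial>lborel)" by (intro nn_integral_cong) (auto simp: indicator_def)
  finally have "X u -` ?A \<inter> space M \<in> null_sets M" using A m by (auto intro: measurable_sets)
  from AE_not_in[OF this] show ?thesis by (rule AE_mp) (auto intro!: AE_I2)
qed

lemma prob_cell_le:
  assumes u: "u \<in> {1..n}" and m: "0 < m"
  shows "prob {\<omega> \<in> space M. cell m (X u \<omega>) = a} \<le> \<epsilon>2 / (real m)\<^sup>2"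
proof -
  let ?A = "{x. cell m x \<in> {a}}"
  let ?l = "vector [fst a / m, snd a / m] :: real ^ 2" and ?u = "vector [(fst a + 1) / m, (snd a + 1) / m] :: real ^ 2"
  have "emeasure lborel ?A \<le> emeasure lborel (cbox ?l ?u)"
    using cell_subset_cbox(1)[OF m, of "fst a" "snd a"] by (intro emeasure_mono) auto
  also have "\<dots> = ennreal (1 / (real m)\<^sup>2)"
    using m by (subst emeasure_box_2(2)) (auto simp: vector_2 divide_simps power2_eq_square)
  finally show ?thesis
    using prob_X_upper[OF u cell_measurable, of m "{a}" "1 / (real m)\<^sup>2"] by simp
qed

text \<open>The degenerate cells with an index \<open>m\<close> are excluded. The open box lies in
  both the cell and the square and already has the full area of the cell.\<close>

lemma prob_cell_ge:
  assumes u: "u \<in> {1..n}" and m: "0 < m" and a: "a \<in> {0..<int m} \<times> {0..<int m}"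
  shows "\<epsilon>1 / (real m)\<^sup>2 \<le> prob {\<omega> \<in> space M. cell m (X u \<omega>) = a}"
proof -
  let ?l = "vector [fst a / m, snd a / m] :: real ^ 2" and ?u = "vector [(fst a + 1) / m, (snd a + 1) / m] :: real ^ 2"
  have "fst a + 1 \<le> int m" "snd a + 1 \<le> int m" using a by auto
  hence "real_of_int (fst a + 1) \<le> real m" "real_of_int (snd a + 1) \<le> real m" by linarith+
  hence top: "(fst a + 1) / real m \<le> 1" "(snd a + 1) / real m \<le> 1" using m by auto
  have bot: "0 \<le> fst a / real m" "0 \<le> snd a / real m" using a by auto
  have sub: "box ?l ?u \<subseteq> unit_square"
  proof
    fix x assume "x \<in> box ?l ?u"
    hence "fst a / real m < x $ 1" "x $ 1 < (fst a + 1) / real m" "snd a / real m < x $ 2" "x $ 2 < (snd a + 1) / real m"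
      by (auto simp: mem_box_cart forall_2)
    hence "0 \<le> x $ 1" "x $ 1 \<le> 1" "0 \<le> x $ 2" "x $ 2 \<le> 1" using top bot by linarith+
    thus "x \<in> unit_square" by (simp add: unit_square_def forall_2)
  qed
  have "\<epsilon>1 * (1 / (real m)\<^sup>2) \<le> prob {\<omega> \<in> space M. X u \<omega> \<in> box ?l ?u}"
  proof (rule prob_X_lower[OF u _ sub])
    show "ennreal (1 / (real m)\<^sup>2) \<le> emeasure lborel (box ?l ?u)"
      using m by (subst emeasure_box_2(1)) (auto simp: vector_2 divide_simps power2_eq_square)
  qed auto
  also have "\<dots> \<le> prob {\<omega> \<in> space M. cell m (X u \<omega>) = a}"
  proof (rule finite_measure_mono)
    show "{\<omega> \<in> space M. X u \<omega> \<in> box ?l ?u} \<subseteq> {\<omega> \<in> space M. cell m (X u \<omega>) = a}"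
      using cell_subset_cbox(2)[OF m, of "fst a" "snd a"] by auto
    show "{\<omega> \<in> space M. cell m (X u \<omega>) = a} \<in> events"
      using depends_on_sets[OF depends_on_cell[of u m "{a}"]] u by simp
  qed
  finally show ?thesis by simp
qed

end

section \<open>Connectivity of cheap edges\<close>

text \<open>With this the edges at a vertex \<open>u\<close> can be indexed by the other end point,
  whichever of the two labels is smaller.\<close>

definition edge :: "nat \<Rightarrow> nat \<Rightarrow> nat \<times> nat" where
  "edge u v = (min u v, max u v)"

lemma edge_in_complete: "u \<in> {1..n} \<Longrightarrow> v \<in> {1..n} \<Longrightarrow> u \<noteq> v \<Longrightarrow> edge u v \<in> complete_edges n"
  by (auto simp: edge_def complete_edges_def min_def max_def)

lemma edge_eq_iff: "edge u v = edge u' v' \<longleftrightarrow> (u = u' \<and> v = v') \<or> (u = v' \<and> v = u')"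
  by (auto simp: edge_def min_def max_def)

lemma edge_cases: "edge u v = (u, v) \<or> edge u v = (v, u)"
  by (auto simp: edge_def min_def max_def)

text \<open>Steps that decrease \<open>key\<close> must end in the connected root set
  \<open>K\<close>. In the application \<open>K\<close> consists of the vertices in the corner cell
  and \<open>key\<close> is the sum of the two cell indices.\<close>

lemma connected_graph_descent:
  fixes key :: "nat \<Rightarrow> nat"
  assumes root: "connected_graph K (E \<inter> K \<times> K)" and "K \<subseteq> V"
    and desc: "\<And>u. u \<in> V - K \<Longrightarrow> \<exists>v\<in>V. key v < key u \<and> ((u, v) \<in> E \<or> (v, u) \<in> E)"
  shows "connected_graph V E"
proof -
  let ?R = "(E \<union> E\<inverse>)\<^sup>*"
  obtain r where r: "r \<in> K" using root by (auto simp: connected_graph_def)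
  have K: "connected_graph K E" by (rule connected_graph_mono[OF root]) auto
  have reach: "(u, r) \<in> ?R" if "u \<in> V" for u
    using that
  proof (induction "key u" arbitrary: u rule: less_induct)
    case less
    show ?case
    proof (cases "u \<in> K")
      case True
      thus ?thesis using K r unfolding connected_graph_def by blast
    next
      case False
      then obtain v where v: "v \<in> V" "key v < key u" "(u, v) \<in> E \<union> E\<inverse>" using desc less.prems by blast
      show ?thesis using converse_rtrancl_into_rtrancl[OF v(3) less.hyps[OF v(2,1)]] .
    qed
  qed
  show ?thesis
    unfolding connected_graph_def
  proof (intro conjI ballI)
    show "V \<noteq> {}" using r assms(2) by auto
    fix u v assume "u \<in> V" "v \<in> V"
    from rtrancl_trans[OF reach[OF this(1)] reach_sym[OF reach[OF this(2)]]] show "(u, v) \<in> ?R" .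
  qed
qed

lemma prod_le_exp:
  fixes x :: "'i \<Rightarrow> real"
  assumes "\<And>i. i \<in> I \<Longrightarrow> x i \<le> 1 - s" "\<And>i. i \<in> I \<Longrightarrow> 0 \<le> x i"
  shows "prod x I \<le> exp (- s * card I)"
proof -
  have "x i \<le> exp (- s)" if "i \<in> I" for i
    using assms(1)[OF that] exp_ge_add_one_self[of "- s"] by linarith
  hence "prod x I \<le> (\<Prod>i\<in>I. exp (- s))" using assms(2) by (intro prod_mono) auto
  thus ?thesis by (simp add: exp_of_nat_mult[symmetric] mult.commute)
qed

lemma (in prob_space) prob_le_cover_AE:
  assumes "finite I" "\<And>i. i \<in> I \<Longrightarrow> {\<omega> \<in> space M. Q i \<omega>} \<in> events"
    and "AE \<omega> in M. P \<omega> \<longrightarrow> (\<exists>i\<in>I. Q i \<omega>)"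
  shows "prob {\<omega> \<in> space M. P \<omega>} \<le> (\<Sum>i\<in>I. prob {\<omega> \<in> space M. Q i \<omega>})"
proof -
  have "prob {\<omega> \<in> space M. P \<omega>} \<le> prob (\<Union>i\<in>I. {\<omega> \<in> space M. Q i \<omega>})"
    using assms by (intro finite_measure_mono_AE sets.finite_UN) auto
  also have "\<dots> \<le> (\<Sum>i\<in>I. prob {\<omega> \<in> space M. Q i \<omega>})"
    using assms by (intro measure_UNION_le) auto
  finally show ?thesis .
qed

lemma (in prob_space) prob_le_cover:
  assumes "finite I" "\<And>i. i \<in> I \<Longrightarrow> {\<omega> \<in> space M. Q i \<omega>} \<in> events"
    and "\<And>\<omega>. \<omega> \<in> space M \<Longrightarrow> P \<omega> \<Longrightarrow> \<exists>i\<in>I. Q i \<omega>"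
  shows "prob {\<omega> \<in> space M. P \<omega>} \<le> (\<Sum>i\<in>I. prob {\<omega> \<in> space M. Q i \<omega>})"
  using assms by (intro prob_le_cover_AE AE_I2) auto

lemma (in prob_space) prob_not:
  assumes "{\<omega> \<in> space M. P \<omega>} \<in> events"
  shows "prob {\<omega> \<in> space M. \<not> P \<omega>} = 1 - prob {\<omega> \<in> space M. P \<omega>}"
proof -
  have "{\<omega> \<in> space M. \<not> P \<omega>} = space M - {\<omega> \<in> space M. P \<omega>}" by auto
  thus ?thesis using prob_compl[OF assms] by simp
qed

section \<open>Erdos-Renyi graphs and the grid graph\<close>

context euclidean_mst
begin

lemma depends_on_bex:
  assumes "finite A" "\<And>a. a \<in> A \<Longrightarrow> depends_on I (P a)"
  shows "depends_on I (\<lambda>\<omega>. \<exists>a\<in>A. P a \<omega>)"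
  using depends_on_not[OF depends_on_ball[OF assms(1) depends_on_not[OF assms(2)]]] by simp

text \<open>The random set has finitely many values, and each value is attained on a Boolean
  combination of the single events. This covers every graph property, connectivity in
  particular.\<close>

lemma depends_on_filter:
  assumes "finite H" "\<And>h. h \<in> H \<Longrightarrow> depends_on I (E h)"
  shows "depends_on I (\<lambda>\<omega>. Q {h \<in> H. E h \<omega>})"
proof -
  have "depends_on I (\<lambda>\<omega>. \<exists>S\<in>{S \<in> Pow H. Q S}. \<forall>h\<in>H. h \<in> S \<and> E h \<omega> \<or> h \<notin> S \<and> \<not> E h \<omega>)"
    using assms by (intro depends_on_bex depends_on_ball depends_on_disj depends_on_conj
        depends_on_const depends_on_not) auto
  moreover have "(\<exists>S\<in>{S \<in> Pow H. Q S}. \<forall>h\<in>H. h \<in> S \<and> E h \<omega> \<or> h \<notin> S \<and> \<not> E h \<omega>) \<longleftrightarrow> Q {h \<in> H. E h \<omega>}" for \<omega>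
  proof
    assume "\<exists>S\<in>{S \<in> Pow H. Q S}. \<forall>h\<in>H. h \<in> S \<and> E h \<omega> \<or> h \<notin> S \<and> \<not> E h \<omega>"
    then obtain S where S: "S \<subseteq> H" "Q S" "\<forall>h\<in>H. h \<in> S \<and> E h \<omega> \<or> h \<notin> S \<and> \<not> E h \<omega>" by auto
    hence "S = {h \<in> H. E h \<omega>}" by blast
    thus "Q {h \<in> H. E h \<omega>}" using S by simp
  qed (intro bexI[of _ "{h \<in> H. E h \<omega>}"], auto)
  ultimately show ?thesis by simp
qed

text \<open>Union bound over the smaller side of a cut without edges.\<close>

lemma prob_disconnected_le:
  assumes A: "A \<subseteq> {1..n}" "A \<noteq> {}"
    and dep: "\<And>h. h \<in> K\<^sub>n \<Longrightarrow> depends_on {zi h, wi h} (E h)"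
    and q: "\<And>h. h \<in> K\<^sub>n \<Longrightarrow> q \<le> prob {\<omega> \<in> space M. E h \<omega>}" "0 \<le> q"
  shows "prob {\<omega> \<in> space M. \<not> connected_graph A {h \<in> K\<^sub>n \<inter> A \<times> A. E h \<omega>}}
      \<le> (1 + exp (- q * card A / 2)) ^ card A - 1"
proof -
  have finA: "finite A" using A finite_subset by blast
  let ?x = "exp (- q * card A / 2)"
  let ?\<S> = "{S \<in> Pow A. S \<noteq> {} \<and> 2 * card S \<le> card A}"
  let ?Q = "\<lambda>S \<omega>. \<forall>(u, v)\<in>S \<times> (A - S). \<not> E (edge u v) \<omega>"
  have eK: "edge u v \<in> K\<^sub>n" if "(u, v) \<in> S \<times> (A - S)" "S \<subseteq> A" for u v S
    using that A by (intro edge_in_complete) auto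
  have dQ: "depends_on (\<Union>(u, v)\<in>S \<times> (A - S). {zi (edge u v), wi (edge u v)}) (?Q S)"
    if "S \<subseteq> A" for S
  proof -
    have "finite (S \<times> (A - S))" using finA that finite_subset by blast
    hence "depends_on (\<Union>(u, v)\<in>S \<times> (A - S). {zi (edge u v), wi (edge u v)})
        (\<lambda>\<omega>. \<forall>uv\<in>S \<times> (A - S). \<not> E (edge (fst uv) (snd uv)) \<omega>)"
    proof (rule depends_on_ball)
      fix uv assume uv: "uv \<in> S \<times> (A - S)"
      hence "edge (fst uv) (snd uv) \<in> K\<^sub>n" using eK[OF _ that, of "fst uv" "snd uv"] by simp
      from depends_on_not[OF dep[OF this]]
      show "depends_on (\<Union>(u, v)\<in>S \<times> (A - S). {zi (edge u v), wi (edge u v)}) (\<lambda>\<omega>. \<not> E (edge (fst uv) (snd uv)) \<omega>)"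
        by (rule depends_on_mono) (use uv in force)
    qed
    thus ?thesis by (simp add: case_prod_beta)
  qed
  have "prob {\<omega> \<in> space M. \<not> connected_graph A {h \<in> K\<^sub>n \<inter> A \<times> A. E h \<omega>}}
      \<le> (\<Sum>S\<in>?\<S>. prob {\<omega> \<in> space M. ?Q S \<omega>})"
  proof (rule prob_le_cover)
    fix S assume "S \<in> ?\<S>"
    hence S: "S \<subseteq> A" by auto
    show "{\<omega> \<in> space M. ?Q S \<omega>} \<in> events"
      by (rule depends_on_sets[OF dQ[OF S]]) (use eK[OF _ S] in auto)
  next
    fix \<omega> assume "\<not> connected_graph A {h \<in> K\<^sub>n \<inter> A \<times> A. E h \<omega>}"
    from disconnected_cut[OF finA A(2) this] obtain S where S: "S \<subseteq> A" "S \<noteq> {}" "2 * card S \<le> card A"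
      "\<forall>u\<in>S. \<forall>v\<in>A - S. (u, v) \<notin> {h \<in> K\<^sub>n \<inter> A \<times> A. E h \<omega>} \<and> (v, u) \<notin> {h \<in> K\<^sub>n \<inter> A \<times> A. E h \<omega>}" by blast
    have "\<not> E (edge u v) \<omega>" if "u \<in> S" "v \<in> A - S" for u v
      using S that eK[of u v S] edge_cases[of u v] by auto
    thus "\<exists>S\<in>?\<S>. ?Q S \<omega>" using S by (intro bexI[of _ S]) auto
  qed (use finA in auto)
  also have "\<dots> \<le> (\<Sum>S\<in>?\<S>. ?x ^ card S)"
  proof (rule sum_mono)
    fix S assume S: "S \<in> ?\<S>"
    hence SA: "S \<subseteq> A" by auto
    have finS: "finite S" using SA finA finite_subset by blast
    let ?L = "S \<times> (A - S)"
    have "prob {\<omega> \<in> space M. \<forall>l\<in>?L. \<not> E (edge (fst l) (snd l)) \<omega>}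
        = (\<Prod>l\<in>?L. prob {\<omega> \<in> space M. \<not> E (edge (fst l) (snd l)) \<omega>})"
    proof (rule prob_ball_depends_on[where I = "\<lambda>l. {zi (edge (fst l) (snd l)), wi (edge (fst l) (snd l))}"])
      show "disjoint_family_on (\<lambda>l. {zi (edge (fst l) (snd l)), wi (edge (fst l) (snd l))}) ?L"
        by (auto simp: disjoint_family_on_def edge_eq_iff)
    qed (use finS finA depends_on_not[OF dep[OF eK[OF _ SA]]] eK[OF _ SA] in auto)
    also have "\<dots> \<le> exp (- q * card ?L)"
    proof (rule prod_le_exp)
      fix l assume l: "l \<in> ?L"
      have e: "edge (fst l) (snd l) \<in> K\<^sub>n" using eK[OF _ SA, of "fst l" "snd l"] l by auto
      have "{\<omega> \<in> space M. E (edge (fst l) (snd l)) \<omega>} \<in> events"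
        by (rule depends_on_sets[OF dep[OF e]]) (use e in auto)
      thus "prob {\<omega> \<in> space M. \<not> E (edge (fst l) (snd l)) \<omega>} \<le> 1 - q"
        using prob_not q(1)[OF e] by simp
    qed simp
    \<comment> \<open>Since \<open>S\<close> is the smaller side, at least
      \<open>card S * card A / 2\<close> pairs cross the cut.\<close>
    also have "\<dots> \<le> exp (- q * card A / 2 * card S)"
    proof -
      have "card ?L = card S * (card A - card S)"
        using SA finS by (simp add: card_cartesian_product card_Diff_subset)
      moreover have "card S \<le> card A" using SA finA by (intro card_mono)
      moreover have "real (card A) / 2 \<le> real (card A) - real (card S)" using S by (simp add: field_simps)
      ultimately have "real (card S) * (real (card A) / 2) \<le> card ?L"
        using mult_left_mono[of "real (card A) / 2" "real (card A) - real (card S)" "real (card S)"]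
        by (simp add: of_nat_diff)
      from mult_left_mono[OF this q(2)] show ?thesis by (simp add: algebra_simps)
    qed
    also have "\<dots> = ?x ^ card S" by (simp add: exp_of_nat_mult[symmetric] mult.commute)
    finally show "prob {\<omega> \<in> space M. ?Q S \<omega>} \<le> ?x ^ card S" by (simp add: case_prod_beta)
  qed
  \<comment> \<open>Over all subsets the sum is a binomial expansion; the empty set accounts for the
    subtracted 1.\<close>
  also have "\<dots> \<le> (\<Sum>S\<in>Pow A - {{}}. ?x ^ card S)"
    using finA by (intro sum_mono2) auto
  also have "\<dots> = (\<Sum>S\<in>Pow A. ?x ^ card S) - 1"
    using finA by (subst sum_diff1) auto
  also have "(\<Sum>S\<in>Pow A. ?x ^ card S) = (1 + ?x) ^ card A"
    using prod_add[OF finA, of "\<lambda>_. ?x" "\<lambda>_. 1"] by (simp add: add.commute)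
  finally show ?thesis .
qed

lemma prob_weight_edge:
  assumes h: "h \<in> K\<^sub>n" and x: "0 < x" "x \<le> 1"
  shows "prob {\<omega> \<in> space M. Z h \<omega> \<and> W h \<omega> \<le> x} = p * x powr (1 / \<delta>)"
  using prob_conj_depends_on[OF depends_on_Z depends_on_W_le, of h h x] h prob_Z[OF h] prob_W_eq[OF h x]
  by simp

lemma depends_on_weight_edge: "depends_on {zi h, wi h} (\<lambda>\<omega>. Z h \<omega> \<and> W h \<omega> \<le> x)"
  by (intro depends_on_conj depends_on_mono[OF depends_on_Z] depends_on_mono[OF depends_on_W_le]) auto

lemma prob_weight_disconnected:
  assumes x: "0 < x" "x \<le> 1"
  shows "prob {\<omega> \<in> space M. \<not> connected_graph {1..n} {h \<in> K\<^sub>n. Z h \<omega> \<and> W h \<omega> \<le> x}}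
      \<le> (1 + exp (- (p * x powr (1 / \<delta>)) * n / 2)) ^ n - 1"
proof -
  have "K\<^sub>n \<inter> {1..n} \<times> {1..n} = K\<^sub>n" using complete_edges_subset by blast
  moreover have "{1..n} \<noteq> {}" using n2 by auto
  ultimately show ?thesis
    using prob_disconnected_le[OF _ _ depends_on_weight_edge[of _ x], of "{1..n}" "p * x powr (1 / \<delta>)"]
      prob_weight_edge[OF _ x] p01 by simp
qed

text \<open>The set of vertices in the corner cell has a product law because the locations are
  independent. It is a function of the locations alone, so splitting over its values separates them
  from the edge variables.\<close>

lemma prob_corner_set:
  fixes m :: nat
  assumes A: "A \<subseteq> {1..n}"
  defines "s \<equiv> (\<lambda>u. prob {\<omega> \<in> space M. cell m (X u \<omega>) = (0, 0)})"
  shows "prob {\<omega> \<in> space M. {u \<in> {1..n}. cell m (X u \<omega>) = (0, 0)} = A}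
      = (\<Prod>u\<in>A. s u) * (\<Prod>u\<in>{1..n} - A. 1 - s u)"
    and "depends_on (xi ` {1..n}) (\<lambda>\<omega>. {u \<in> {1..n}. cell m (X u \<omega>) = (0, 0)} = A)"
proof -
  have dc: "depends_on {xi u} (\<lambda>\<omega>. cell m (X u \<omega>) = (0, 0))" for u
    using depends_on_cell[of u m "{(0, 0)}"] by simp
  show "depends_on (xi ` {1..n}) (\<lambda>\<omega>. {u \<in> {1..n}. cell m (X u \<omega>) = (0, 0)} = A)"
    by (rule depends_on_filter) (use depends_on_mono[OF dc] in auto)
  have "{\<omega> \<in> space M. {u \<in> {1..n}. cell m (X u \<omega>) = (0, 0)} = A}
      = {\<omega> \<in> space M. \<forall>u\<in>{1..n}. (cell m (X u \<omega>) = (0, 0)) = (u \<in> A)}"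
    using A by auto
  also have "prob \<dots> = (\<Prod>u\<in>{1..n}. prob {\<omega> \<in> space M. (cell m (X u \<omega>) = (0, 0)) = (u \<in> A)})"
  proof (rule prob_ball_depends_on[where I = "\<lambda>u. {xi u}"])
    show "depends_on {xi u} (\<lambda>\<omega>. (cell m (X u \<omega>) = (0, 0)) = (u \<in> A))" for u
      using dc[of u] depends_on_not[OF dc[of u]] by (cases "u \<in> A") auto
  qed (auto simp: disjoint_family_on_def)
  also have "\<dots> = (\<Prod>u\<in>{1..n}. if u \<in> A then s u else 1 - s u)"
  proof (rule prod.cong[OF refl])
    fix u assume u: "u \<in> {1..n}"
    have "{\<omega> \<in> space M. cell m (X u \<omega>) = (0, 0)} \<in> events" using depends_on_sets[OF dc] u by simp
    thus "prob {\<omega> \<in> space M. (cell m (X u \<omega>) = (0, 0)) = (u \<in> A)} = (if u \<in> A then s u else 1 - s u)"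
      using prob_not by (simp add: s_def)
  qed
  also have "\<dots> = (\<Prod>u\<in>A. s u) * (\<Prod>u\<in>{1..n} - A. 1 - s u)"
    using A by (subst prod.If_cases) (auto simp: Int_absorb1 Diff_eq)
  finally show "prob {\<omega> \<in> space M. {u \<in> {1..n}. cell m (X u \<omega>) = (0, 0)} = A}
      = (\<Prod>u\<in>A. s u) * (\<Prod>u\<in>{1..n} - A. 1 - s u)" .
qed

text \<open>A Chernoff bound: the sum is compared with the expectation of \<open>exp (k - N)\<close>, where \<open>N\<close> is
  the number of vertices in the corner cell and \<open>k\<close> a quarter of the lower bound for its mean.\<close>

lemma prob_corner_small:
  fixes m :: nat and s0 :: real
  assumes m: "0 < m"
  defines "s0 \<equiv> \<epsilon>1 / (real m)\<^sup>2"
  shows "(\<Sum>A | A \<subseteq> {1..n} \<and> card A < n * s0 / 4.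
        prob {\<omega> \<in> space M. {u \<in> {1..n}. cell m (X u \<omega>) = (0, 0)} = A}) \<le> exp (- (n * s0 / 4))"
proof -
  define s where "s = (\<lambda>u. prob {\<omega> \<in> space M. cell m (X u \<omega>) = (0, 0)})"
  have s: "s0 \<le> s u" "s u \<le> 1" if "u \<in> {1..n}" for u
    using prob_cell_ge[OF that m, of "(0, 0)"] m unfolding s_def s0_def by auto
  have s00: "0 \<le> s0" using eps by (simp add: s0_def)
  have s1: "0 \<le> s u" for u by (simp add: s_def)
  let ?k = "n * s0 / 4"
  let ?e = "exp (- 1 :: real)"
  have e2: "?e \<le> 1 / 2" using exp_ge_add_one_self[of "1 :: real"] by (simp add: exp_minus field_simps)
  have "(\<Sum>A | A \<subseteq> {1..n} \<and> card A < ?k.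
        prob {\<omega> \<in> space M. {u \<in> {1..n}. cell m (X u \<omega>) = (0, 0)} = A})
      \<le> (\<Sum>A | A \<subseteq> {1..n} \<and> card A < ?k. exp ?k * ((\<Prod>u\<in>A. s u * ?e) * (\<Prod>u\<in>{1..n} - A. 1 - s u)))"
  proof (rule sum_mono)
    fix A assume "A \<in> {A. A \<subseteq> {1..n} \<and> card A < ?k}"
    hence A: "A \<subseteq> {1..n}" "card A < ?k" by auto
    \<comment> \<open>The exponential weight is at least 1 on the event that the cell has fewer than
      \<open>?k\<close> vertices.\<close>
    have "1 \<le> exp (?k - card A)" using A by simp
    also have "\<dots> = exp ?k * ?e ^ card A"
      using exp_of_nat_mult[of "card A" "- 1 :: real"] mult_exp_exp[of ?k "- real (card A)"] by simp
    finally have "1 \<le> exp ?k * ?e ^ card A" .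
    moreover have "0 \<le> (\<Prod>u\<in>A. s u) * (\<Prod>u\<in>{1..n} - A. 1 - s u)"
      using s1 s by (intro mult_nonneg_nonneg prod_nonneg) auto
    ultimately have "(\<Prod>u\<in>A. s u) * (\<Prod>u\<in>{1..n} - A. 1 - s u)
        \<le> (exp ?k * ?e ^ card A) * ((\<Prod>u\<in>A. s u) * (\<Prod>u\<in>{1..n} - A. 1 - s u))"
      using mult_right_mono by fastforce
    thus "prob {\<omega> \<in> space M. {u \<in> {1..n}. cell m (X u \<omega>) = (0, 0)} = A}
        \<le> exp ?k * ((\<Prod>u\<in>A. s u * ?e) * (\<Prod>u\<in>{1..n} - A. 1 - s u))"
      unfolding prob_corner_set(1)[OF A(1), of m, folded fun_cong[OF s_def]]
      by (simp add: prod.distrib mult_ac)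
  qed
  also have "\<dots> \<le> (\<Sum>A\<in>Pow {1..n}. exp ?k * ((\<Prod>u\<in>A. s u * ?e) * (\<Prod>u\<in>{1..n} - A. 1 - s u)))"
    using s1 s by (intro sum_mono2 mult_nonneg_nonneg prod_nonneg) auto
  also have "\<dots> = exp ?k * (\<Prod>u\<in>{1..n}. s u * ?e + (1 - s u))"
    by (simp add: prod_add sum_distrib_left)
  \<comment> \<open>By \<open>e2\<close> each vertex contributes a factor of at most
    \<open>1 - s0 / 2\<close>. The exponent \<open>- n * s0 / 2\<close> outweighs \<open>?k\<close>
    twice and leaves \<open>- ?k\<close>.\<close>
  also have "(\<Prod>u\<in>{1..n}. s u * ?e + (1 - s u)) \<le> exp (- (s0 / 2) * card {1..n})"
  proof (rule prod_le_exp)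
    fix u assume u: "u \<in> {1..n}"
    have "s u * ?e \<le> s u * (1 / 2)" using e2 s1 by (intro mult_left_mono) auto
    thus "s u * ?e + (1 - s u) \<le> 1 - s0 / 2" using s[OF u] by (simp add: field_simps)
    show "0 \<le> s u * ?e + (1 - s u)" using s[OF u] s1[of u] by auto
  qed
  also have "exp ?k * exp (- (s0 / 2) * card {1..n}) = exp (- ?k)"
    by (simp add: exp_add[symmetric] field_simps)
  finally show ?thesis by simp
qed

text \<open>The three summands match three kinds of failure: \<open>stuck\<close> for a vertex
  without an edge into the next cell towards the corner, \<open>few\<close> for a thinly populated
  corner cell and \<open>split\<close> for a corner cell whose vertices are not connected among
  themselves. Weights do not appear: they are at most 1, so a short edge is cheap whatever its
  weight.\<close>

lemma prob_grid_disconnected: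
  fixes m :: nat and s0 :: real
  assumes m: "0 < m"
  defines "s0 \<equiv> \<epsilon>1 / (real m)\<^sup>2"
  shows "prob {\<omega> \<in> space M. \<not> connected_graph {1..n}
          {h \<in> K\<^sub>n. Z h \<omega> \<and> cell m (X (snd h) \<omega>) \<in> neighbours (cell m (X (fst h) \<omega>))}}
      \<le> n * exp (- (p * s0) * (n - 1)) + exp (- (n * s0 / 4)) + ((1 + exp (- p * (n * s0 / 4) / 2)) ^ n - 1)"
proof -
  \<comment> \<open>The next cell on the way to the corner: the first index goes down to 0, then the
    second. The minimum with \<open>m - 1\<close> leads out of the degenerate cells with second
    index \<open>m\<close>, so the target always has probability at least \<open>s0\<close>.\<close>
  let ?pred = "\<lambda>a :: int \<times> int. if 0 < fst a then (fst a - 1, min (snd a) (int m - 1)) else (0, snd a - 1)"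
  let ?C = "{0..int m} \<times> {0..int m} - {(0, 0)}"
  let ?K = "\<lambda>\<omega>. {u \<in> {1..n}. cell m (X u \<omega>) = (0, 0)}"
  let ?k = "n * s0 / 4"
  let ?y = "(1 + exp (- p * ?k / 2)) ^ n - 1"
  have s0: "0 < s0" using eps m by (simp add: s0_def)
  define stuck where "stuck = (\<lambda>u a \<omega>. cell m (X u \<omega>) = a \<and>
      (\<forall>v\<in>{1..n} - {u}. \<not> (Z (edge u v) \<omega> \<and> cell m (X v \<omega>) = ?pred a)))"
  define split where "split = (\<lambda>A \<omega>. ?K \<omega> = A \<and> \<not> connected_graph A {h \<in> K\<^sub>n \<inter> A \<times> A. Z h \<omega>})"
  define few where "few = (\<lambda>A \<omega>. ?K \<omega> = A)"
  have dc: "depends_on {xi u} (\<lambda>\<omega>. cell m (X u \<omega>) = a)" for u a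
    using depends_on_cell[of u m "{a}"] by simp
  have dlink: "depends_on {zi (edge u v), xi v} (\<lambda>\<omega>. Z (edge u v) \<omega> \<and> cell m (X v \<omega>) = a)" for u v a
    by (intro depends_on_conj depends_on_mono[OF depends_on_Z] depends_on_mono[OF dc]) auto
  have dlinks: "depends_on (\<Union>v\<in>{1..n} - {u}. {zi (edge u v), xi v})
      (\<lambda>\<omega>. \<forall>v\<in>{1..n} - {u}. \<not> (Z (edge u v) \<omega> \<and> cell m (X v \<omega>) = a))" for u a
    by (intro depends_on_ball depends_on_not depends_on_mono[OF dlink]) auto
  have subl: "(\<Union>v\<in>{1..n} - {u}. {zi (edge u v), xi v}) \<subseteq> all_ix" if "u \<in> {1..n}" for u
    using edge_in_complete[OF that] by (auto; metis)
  have stuck_events: "{\<omega> \<in> space M. stuck u a \<omega>} \<in> events" if u: "u \<in> {1..n}" for u a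
    unfolding stuck_def
    by (rule depends_on_sets[where I = "insert (xi u) (\<Union>v\<in>{1..n} - {u}. {zi (edge u v), xi v})"],
        intro depends_on_conj depends_on_mono[OF dc] depends_on_mono[OF dlinks]) (use subl[OF u] u in auto)
  \<comment> \<open>Once the cell of \<open>u\<close> is fixed, so is the target cell, and the
    attempts with different \<open>v\<close> use disjoint sets of variables.\<close>
  have stuck_prob: "prob {\<omega> \<in> space M. stuck u a \<omega>}
      \<le> prob {\<omega> \<in> space M. cell m (X u \<omega>) = a} * exp (- (p * s0) * (n - 1))"
    if u: "u \<in> {1..n}" and a: "a \<in> ?C" for u a
  proof -
    have "prob {\<omega> \<in> space M. stuck u a \<omega>} = prob {\<omega> \<in> space M. cell m (X u \<omega>) = a} *
        prob {\<omega> \<in> space M. \<forall>v\<in>{1..n} - {u}. \<not> (Z (edge u v) \<omega> \<and> cell m (X v \<omega>) = ?pred a)}"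
      unfolding stuck_def by (rule prob_conj_depends_on[OF dc dlinks]) (use subl[OF u] u in auto)
    also have "prob {\<omega> \<in> space M. \<forall>v\<in>{1..n} - {u}. \<not> (Z (edge u v) \<omega> \<and> cell m (X v \<omega>) = ?pred a)}
        = (\<Prod>v\<in>{1..n} - {u}. prob {\<omega> \<in> space M. \<not> (Z (edge u v) \<omega> \<and> cell m (X v \<omega>) = ?pred a)})"
      by (rule prob_ball_depends_on[where I = "\<lambda>v. {zi (edge u v), xi v}"])
        (use depends_on_not[OF dlink] edge_in_complete u in \<open>auto simp: disjoint_family_on_def edge_eq_iff\<close>)
    also have "\<dots> \<le> exp (- (p * s0) * card ({1..n} - {u}))"
    proof (rule prod_le_exp)
      fix v assume v: "v \<in> {1..n} - {u}"
      have e: "edge u v \<in> K\<^sub>n" using u v by (intro edge_in_complete) auto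
      have "?pred a \<in> {0..<int m} \<times> {0..<int m}" using a m by auto
      hence "p * s0 \<le> p * prob {\<omega> \<in> space M. cell m (X v \<omega>) = ?pred a}"
        using prob_cell_ge[OF _ m] v p01 unfolding s0_def by (intro mult_left_mono) auto
      also have "\<dots> = prob {\<omega> \<in> space M. Z (edge u v) \<omega> \<and> cell m (X v \<omega>) = ?pred a}"
        unfolding prob_Z[OF e, symmetric]
        by (rule prob_conj_depends_on[OF depends_on_Z dc, symmetric]) (use e v in auto)
      finally show "prob {\<omega> \<in> space M. \<not> (Z (edge u v) \<omega> \<and> cell m (X v \<omega>) = ?pred a)} \<le> 1 - p * s0"
        using prob_not[OF depends_on_sets[OF dlink]] e v by simp
    qed simp
    finally show ?thesis using u by (simp add: mult_left_mono card_Diff_singleton)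
  qed
  \<comment> \<open>The cells of \<open>u\<close> are disjoint alternatives, so the sum over them
    does not cost a factor equal to their number.\<close>
  have sum_stuck: "(\<Sum>a\<in>?C. prob {\<omega> \<in> space M. stuck u a \<omega>}) \<le> exp (- (p * s0) * (n - 1))"
    if u: "u \<in> {1..n}" for u
  proof -
    have ev: "{\<omega> \<in> space M. cell m (X u \<omega>) = a} \<in> events" for a
      using depends_on_sets[OF dc] u by simp
    have "(\<Sum>a\<in>?C. prob {\<omega> \<in> space M. cell m (X u \<omega>) = a}) = prob (\<Union>a\<in>?C. {\<omega> \<in> space M. cell m (X u \<omega>) = a})"
      by (rule finite_measure_finite_Union[symmetric]) (use ev in \<open>auto simp: disjoint_family_on_def\<close>)
    also have "\<dots> \<le> 1" by simp
    finally have "(\<Sum>a\<in>?C. prob {\<omega> \<in> space M. cell m (X u \<omega>) = a}) \<le> 1" .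
    from mult_right_mono[OF this, of "exp (- (p * s0) * (n - 1))"]
    have "(\<Sum>a\<in>?C. prob {\<omega> \<in> space M. cell m (X u \<omega>) = a} * exp (- (p * s0) * (n - 1))) \<le> exp (- (p * s0) * (n - 1))"
      by (simp only: sum_distrib_right mult_1 exp_ge_zero)
    thus ?thesis using sum_mono[of ?C, OF stuck_prob[OF u]] by (rule order.trans[rotated])
  qed
  \<comment> \<open>The vertex set \<open>A\<close> is determined by the locations and the
    connectivity of \<open>A\<close> by the presence variables, so the two conditions are
    independent.\<close>
  have split_events: "{\<omega> \<in> space M. split A \<omega>} \<in> events"
    and split_prob: "prob {\<omega> \<in> space M. split A \<omega>} \<le> prob {\<omega> \<in> space M. ?K \<omega> = A} * ?y"
    if A: "A \<subseteq> {1..n}" "?k \<le> card A" for A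
  proof -
    have dZ: "depends_on (zi ` K\<^sub>n) (\<lambda>\<omega>. \<not> connected_graph A {h \<in> K\<^sub>n \<inter> A \<times> A. Z h \<omega>})"
      by (intro depends_on_not depends_on_filter depends_on_mono[OF depends_on_Z]) auto
    show "{\<omega> \<in> space M. split A \<omega>} \<in> events"
      unfolding split_def
      by (rule depends_on_sets[where I = "xi ` {1..n} \<union> zi ` K\<^sub>n"],
          intro depends_on_conj depends_on_mono[OF prob_corner_set(2)[OF A(1)]] depends_on_mono[OF dZ]) auto
    have "0 < ?k" using s0 n2 by auto
    hence Ane: "A \<noteq> {}" using A by auto
    have cA: "card A \<le> n" using card_mono[of "{1..n}" A] A by simp
    have "prob {\<omega> \<in> space M. split A \<omega>} = prob {\<omega> \<in> space M. ?K \<omega> = A} *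
        prob {\<omega> \<in> space M. \<not> connected_graph A {h \<in> K\<^sub>n \<inter> A \<times> A. Z h \<omega>}}"
      unfolding split_def by (rule prob_conj_depends_on[OF prob_corner_set(2)[OF A(1)] dZ]) auto
    also have "\<dots> \<le> prob {\<omega> \<in> space M. ?K \<omega> = A} * ?y"
    proof (rule mult_left_mono)
      have "prob {\<omega> \<in> space M. \<not> connected_graph A {h \<in> K\<^sub>n \<inter> A \<times> A. Z h \<omega>}}
          \<le> (1 + exp (- p * card A / 2)) ^ card A - 1"
        by (rule prob_disconnected_le[OF A(1) Ane depends_on_mono[OF depends_on_Z]])
          (use prob_Z p01 in auto)
      also have "(1 + exp (- p * card A / 2)) ^ card A \<le> (1 + exp (- p * card A / 2)) ^ n"
        using cA by (intro power_increasing) auto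
      also have "\<dots> \<le> (1 + exp (- p * ?k / 2)) ^ n"
      proof (rule power_mono)
        have "p * ?k \<le> p * card A" using A p01 by (intro mult_left_mono) auto
        thus "1 + exp (- p * card A / 2) \<le> 1 + exp (- p * ?k / 2)" by (simp add: mult.commute)
      qed (simp add: add_nonneg_nonneg)
      finally show "prob {\<omega> \<in> space M. \<not> connected_graph A {h \<in> K\<^sub>n \<inter> A \<times> A. Z h \<omega>}} \<le> ?y" by simp
    qed simp
    finally show "prob {\<omega> \<in> space M. split A \<omega>} \<le> prob {\<omega> \<in> space M. ?K \<omega> = A} * ?y" .
  qed
  have y0: "0 \<le> ?y" using one_le_power[of "1 + exp (- p * ?k / 2)" n] by simp
  \<comment> \<open>Again the sets \<open>A\<close> are disjoint alternatives, so even exponentially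
    many of them cost nothing.\<close>
  have sum_split: "(\<Sum>A | A \<subseteq> {1..n} \<and> ?k \<le> card A. prob {\<omega> \<in> space M. split A \<omega>}) \<le> ?y"
  proof -
    have ev: "{\<omega> \<in> space M. ?K \<omega> = A} \<in> events" if "A \<subseteq> {1..n}" for A
      by (rule depends_on_sets[OF prob_corner_set(2)[OF that]]) auto
    have "(\<Sum>A | A \<subseteq> {1..n} \<and> ?k \<le> card A. prob {\<omega> \<in> space M. ?K \<omega> = A})
        = prob (\<Union>A\<in>{A. A \<subseteq> {1..n} \<and> ?k \<le> card A}. {\<omega> \<in> space M. ?K \<omega> = A})"
      by (rule finite_measure_finite_Union[symmetric]) (use ev in \<open>auto simp: disjoint_family_on_def\<close>)
    also have "\<dots> \<le> 1" by simp
    finally have "(\<Sum>A | A \<subseteq> {1..n} \<and> ?k \<le> card A. prob {\<omega> \<in> space M. ?K \<omega> = A}) \<le> 1" .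
    from mult_right_mono[OF this y0]
    have "(\<Sum>A | A \<subseteq> {1..n} \<and> ?k \<le> card A. prob {\<omega> \<in> space M. ?K \<omega> = A} * ?y) \<le> ?y"
      by (simp add: sum_distrib_right)
    moreover have "(\<Sum>A | A \<subseteq> {1..n} \<and> ?k \<le> card A. prob {\<omega> \<in> space M. split A \<omega>})
        \<le> (\<Sum>A | A \<subseteq> {1..n} \<and> ?k \<le> card A. prob {\<omega> \<in> space M. ?K \<omega> = A} * ?y)"
      by (rule sum_mono) (use split_prob in auto)
    ultimately show ?thesis by linarith
  qed
  define G where "G = (\<lambda>\<omega>. {h \<in> K\<^sub>n. Z h \<omega> \<and> cell m (X (snd h) \<omega>) \<in> neighbours (cell m (X (fst h) \<omega>))})"
  define Ix where "Ix = ({1..n} \<times> ?C) <+> ({A. A \<subseteq> {1..n} \<and> ?k \<le> card A} <+> {A. A \<subseteq> {1..n} \<and> card A < ?k})"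
  define ev where "ev = (\<lambda>i. case i of Inl (u, a) \<Rightarrow> stuck u a | Inr (Inl A) \<Rightarrow> split A | Inr (Inr A) \<Rightarrow> few A)"
  have Ix: "Inl i \<in> Ix \<longleftrightarrow> i \<in> {1..n} \<times> ?C" "Inr (Inl A) \<in> Ix \<longleftrightarrow> A \<in> {A. A \<subseteq> {1..n} \<and> ?k \<le> card A}"
    "Inr (Inr A) \<in> Ix \<longleftrightarrow> A \<in> {A. A \<subseteq> {1..n} \<and> card A < ?k}" for i A
    unfolding Ix_def by blast+
  have few_events: "{\<omega> \<in> space M. few A \<omega>} \<in> events" if "A \<subseteq> {1..n}" for A
    unfolding few_def by (rule depends_on_sets[OF prob_corner_set(2)[OF that]]) auto
  have ev_events: "{\<omega> \<in> space M. ev i \<omega>} \<in> events" if i: "i \<in> Ix" for i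
  proof (cases i)
    case (Inl ua)
    obtain u a where "ua = (u, a)" by (cases ua)
    thus ?thesis using i Inl stuck_events[of u a] unfolding Inl Ix by (simp add: ev_def)
  next
    case (Inr AA)
    show ?thesis
    proof (cases AA)
      case (Inl A)
      thus ?thesis using i Inr split_events[of A] unfolding Inr Inl Ix by (simp add: ev_def)
    next
      case (Inr A)
      thus ?thesis using i \<open>i = Inr AA\<close> few_events[of A] unfolding \<open>i = Inr AA\<close> Inr Ix by (simp add: ev_def)
    qed
  qed
  have fin: "finite {A. A \<subseteq> {1..n} \<and> ?k \<le> card A}" "finite {A. A \<subseteq> {1..n} \<and> card A < ?k}" by auto
  have "(\<Union>i\<in>Ix. {\<omega> \<in> space M. ev i \<omega>}) \<in> events" using fin ev_events by (intro sets.finite_UN) (auto simp: Ix_def)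
  moreover have "(\<Union>i\<in>Ix. {\<omega> \<in> space M. ev i \<omega>}) = {\<omega> \<in> space M. \<exists>i\<in>Ix. ev i \<omega>}" by blast
  ultimately have evs: "{\<omega> \<in> space M. \<exists>i\<in>Ix. ev i \<omega>} \<in> events" by simp
  have "AE \<omega> in M. \<forall>u\<in>{1..n}. X u \<omega> \<in> unit_square"
    using AE_X_unit_square by (subst AE_ball_countable) auto
  then obtain N where N': "{\<omega> \<in> space M. \<not> (\<forall>u\<in>{1..n}. X u \<omega> \<in> unit_square)} \<subseteq> N"
    "emeasure M N = 0" "N \<in> events" by (rule AE_E)
  have N: "N \<in> null_sets M" "{\<omega> \<in> space M. \<not> (\<forall>u\<in>{1..n}. X u \<omega> \<in> unit_square)} \<subseteq> N"
    using N' by (auto intro: null_setsI)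
  have "prob {\<omega> \<in> space M. \<not> connected_graph {1..n} (G \<omega>)} \<le> prob (N \<union> {\<omega> \<in> space M. \<exists>i\<in>Ix. ev i \<omega>})"
  proof (rule finite_measure_mono)
    show "{\<omega> \<in> space M. \<not> connected_graph {1..n} (G \<omega>)} \<subseteq> N \<union> {\<omega> \<in> space M. \<exists>i\<in>Ix. ev i \<omega>}"
    proof (intro subsetI, rule ccontr)
      fix \<omega> assume w: "\<omega> \<in> {\<omega> \<in> space M. \<not> connected_graph {1..n} (G \<omega>)}"
        "\<omega> \<notin> N \<union> {\<omega> \<in> space M. \<exists>i\<in>Ix. ev i \<omega>}"
      hence sq: "X u \<omega> \<in> unit_square" if "u \<in> {1..n}" for u using N(2) that by blast
      have noev: "\<not> ev i \<omega>" if "i \<in> Ix" for i using w that by auto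
      have nostuck: "\<not> stuck u a \<omega>" if "u \<in> {1..n}" "a \<in> ?C" for u a
        using noev[of "Inl (u, a)"] that unfolding Ix ev_def by simp
      have Ksub: "?K \<omega> \<subseteq> {1..n}" by blast
      have nofew: "\<not> card (?K \<omega>) < ?k" using noev[of "Inr (Inr (?K \<omega>))"] Ksub unfolding Ix ev_def few_def by auto
      have nosplit: "\<not> split (?K \<omega>) \<omega>"
        using noev[of "Inr (Inl (?K \<omega>))"] nofew Ksub unfolding Ix ev_def by auto
      have "connected_graph {1..n} (G \<omega>)"
      proof (rule connected_graph_descent[where K = "?K \<omega>" and key = "\<lambda>u. nat (fst (cell m (X u \<omega>)) + snd (cell m (X u \<omega>)))"])
        have "connected_graph (?K \<omega>) {h \<in> K\<^sub>n \<inter> ?K \<omega> \<times> ?K \<omega>. Z h \<omega>}" using nosplit by (auto simp: split_def)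
        thus "connected_graph (?K \<omega>) (G \<omega> \<inter> ?K \<omega> \<times> ?K \<omega>)"
          by (rule connected_graph_mono) (auto simp: G_def neighbours_def)
        fix u assume u: "u \<in> {1..n} - ?K \<omega>"
        let ?a = "cell m (X u \<omega>)"
        have "0 \<le> X u \<omega> $ 1" "X u \<omega> $ 1 \<le> 1" "0 \<le> X u \<omega> $ 2" "X u \<omega> $ 2 \<le> 1"
          using sq[of u] u by (auto simp: unit_square_def)
        hence "real m * X u \<omega> $ 1 \<le> real m" "real m * X u \<omega> $ 2 \<le> real m"
          "0 \<le> real m * X u \<omega> $ 1" "0 \<le> real m * X u \<omega> $ 2"
          by (auto intro: mult_left_le)
        hence aC: "?a \<in> ?C" using u by (auto simp: cell_def le_floor_iff floor_le_iff)
        obtain v where v: "v \<in> {1..n}" "v \<noteq> u" "Z (edge u v) \<omega>" "cell m (X v \<omega>) = ?pred ?a"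
          using nostuck[OF _ aC, of u] u unfolding stuck_def by blast
        have "edge u v \<in> K\<^sub>n" using u v by (intro edge_in_complete) auto
        moreover have "?pred ?a \<in> neighbours ?a" "?a \<in> neighbours (?pred ?a)"
          using aC by (auto simp: neighbours_def mem_Times_iff)
        ultimately have "edge u v \<in> G \<omega>" using v edge_cases[of u v] by (auto simp: G_def)
        hence "(u, v) \<in> G \<omega> \<or> (v, u) \<in> G \<omega>" using edge_cases[of u v] by auto
        moreover have "fst (?pred ?a) + snd (?pred ?a) < fst ?a + snd ?a" "0 < fst ?a + snd ?a"
          using aC by (auto simp: mem_Times_iff prod_eq_iff)
        ultimately show "\<exists>v\<in>{1..n}. nat (fst (cell m (X v \<omega>)) + snd (cell m (X v \<omega>))) < nat (fst ?a + snd ?a) \<and>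
            ((u, v) \<in> G \<omega> \<or> (v, u) \<in> G \<omega>)"
          using v by (intro bexI[of _ v]) auto
      qed auto
      thus False using w by simp
    qed
    show "N \<union> {\<omega> \<in> space M. \<exists>i\<in>Ix. ev i \<omega>} \<in> events" using N' evs by (intro sets.Un)
  qed
  also have "\<dots> \<le> prob N + prob {\<omega> \<in> space M. \<exists>i\<in>Ix. ev i \<omega>}"
    by (rule measure_Un_le[OF N'(3) evs])
  also have "prob N = 0" using N by (simp add: measure_def null_setsD1)
  also have "prob {\<omega> \<in> space M. \<exists>i\<in>Ix. ev i \<omega>} \<le> (\<Sum>i\<in>Ix. prob {\<omega> \<in> space M. ev i \<omega>})"
  proof (rule prob_le_cover)
    show "{\<omega> \<in> space M. ev i \<omega>} \<in> events" if "i \<in> Ix" for i by (rule ev_events[OF that])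
  qed (use fin in \<open>auto simp: Ix_def\<close>)
  also have "\<dots> = (\<Sum>u\<in>{1..n}. \<Sum>a\<in>?C. prob {\<omega> \<in> space M. stuck u a \<omega>})
      + ((\<Sum>A | A \<subseteq> {1..n} \<and> ?k \<le> card A. prob {\<omega> \<in> space M. split A \<omega>})
      + (\<Sum>A | A \<subseteq> {1..n} \<and> card A < ?k. prob {\<omega> \<in> space M. few A \<omega>}))"
    unfolding Ix_def using fin by (simp add: sum.Plus ev_def sum.cartesian_product case_prod_beta)
  also have "(\<Sum>u\<in>{1..n}. \<Sum>a\<in>?C. prob {\<omega> \<in> space M. stuck u a \<omega>}) \<le> (\<Sum>u\<in>{1..n}. exp (- (p * s0) * (n - 1)))"
    by (rule sum_mono) (rule sum_stuck)
  finally show ?thesis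
    using sum_split prob_corner_small[OF m, folded s0_def] n2 unfolding G_def few_def by (simp add: of_nat_diff)
qed

end

section \<open>Costs of single edges\<close>

lemma dyadic_scale:
  fixes y :: real
  assumes "0 < y" "y \<le> 1"
  obtains k :: nat where "(1 / 2) ^ Suc k < y" "y \<le> (1 / 2) ^ k"
proof -
  have "\<exists>k. (1 / 2 :: real) ^ k < y" using assms by (intro real_arch_pow_inv) auto
  then obtain k where k: "(1 / 2 :: real) ^ k < y" "\<And>j. j < k \<Longrightarrow> \<not> (1 / 2 :: real) ^ j < y"
    using exists_least_iff[of "\<lambda>k. (1 / 2 :: real) ^ k < y"] by blast
  have "k \<noteq> 0" using k(1) assms by (cases k) auto
  then obtain j where "k = Suc j" by (cases k) auto
  thus ?thesis using k(1) k(2)[of j] that[of j] by auto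
qed

text \<open>A countable union bound for dyadic scales. With geometric decay it loses only a constant
  factor, which keeps logarithms out of the cost law of an edge.\<close>

lemma (in prob_space) prob_le_geometric_cover:
  assumes Q: "\<And>k :: nat. {\<omega> \<in> space M. Q k \<omega>} \<in> events"
    and AE: "AE \<omega> in M. P \<omega> \<longrightarrow> (\<exists>k. Q k \<omega>)"
    and le: "\<And>k. prob {\<omega> \<in> space M. Q k \<omega>} \<le> c * \<rho> ^ k" and rho: "0 \<le> \<rho>" "\<rho> < 1"
  shows "prob {\<omega> \<in> space M. P \<omega>} \<le> c / (1 - \<rho>)"
proof -
  have g: "(\<lambda>k. c * \<rho> ^ k) sums (c / (1 - \<rho>))"
    using sums_mult[OF geometric_sums[of \<rho>], of c] rho by simp
  have s: "summable (\<lambda>k. prob {\<omega> \<in> space M. Q k \<omega>})"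
    by (rule summable_comparison_test[OF _ sums_summable[OF g]]) (use le in auto)
  have "prob {\<omega> \<in> space M. P \<omega>} \<le> prob (\<Union>k. {\<omega> \<in> space M. Q k \<omega>})"
    using AE Q by (intro finite_measure_mono_AE sets.countable_UN) auto
  also have "\<dots> \<le> (\<Sum>k. prob {\<omega> \<in> space M. Q k \<omega>})"
    using Q s by (intro finite_measure_subadditive_countably) auto
  also have "\<dots> \<le> (\<Sum>k. c * \<rho> ^ k)" by (rule suminf_le[OF le s sums_summable[OF g]])
  finally show ?thesis using sums_unique[OF g] by simp
qed

section \<open>Cheap edges with a common end point\<close>

context euclidean_mst
begin

definition cost :: "nat \<times> nat \<Rightarrow> 'a \<Rightarrow> real" where
  "cost h \<omega> = edge_cost (\<lambda>x y. (dist x y / sqrt 2) powr \<alpha>) W X \<omega> h"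

lemma cost_edge: "cost (edge u v) \<omega> = (dist (X u \<omega>) (X v \<omega>) / sqrt 2) powr \<alpha> * W (edge u v) \<omega>"
  using edge_cases[of u v] by (auto simp: cost_def edge_cost_def dist_commute)

lemma Z_pred [measurable]: "h \<in> K\<^sub>n \<Longrightarrow> Measurable.pred M (Z h)"
  using Z_measurable[of h] by simp

lemma cost_measurable [measurable]: "h \<in> K\<^sub>n \<Longrightarrow> cost h \<in> borel_measurable M"
proof -
  assume h: "h \<in> K\<^sub>n"
  obtain u v where uv: "h = (u, v)" by (cases h)
  have [measurable]: "X u \<in> borel_measurable M" "X v \<in> borel_measurable M" "W (u, v) \<in> borel_measurable M"
    using h uv X_measurable W_measurable by (auto simp: complete_edges_def)
  show ?thesis unfolding uv cost_def[abs_def] edge_cost_def by simp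
qed

text \<open>The events for different \<open>v\<close> share the location of \<open>u\<close>. Once
  the cell of \<open>u\<close> is fixed they become independent, and closeness confines
  \<open>v\<close> to nine cells of area at most \<open>4 * (e v)\<^sup>2\<close> each, whence the
  factor 36, whatever the cell of \<open>u\<close> is. The product on the right is therefore the
  same as for independent events.\<close>

lemma prob_close_star:
  assumes V: "V \<subseteq> {1..n} - {u}" and u: "u \<in> {1..n}"
    and t: "\<And>v. v \<in> V \<Longrightarrow> 0 < t v" and e: "\<And>v. v \<in> V \<Longrightarrow> 0 < e v"
  shows "prob {\<omega> \<in> space M. \<forall>v\<in>V. Z (edge u v) \<omega> \<and> W (edge u v) \<omega> \<le> t v \<and> dist (X u \<omega>) (X v \<omega>) \<le> e v}
    \<le> (\<Prod>v\<in>V. p * (t v powr (1 / \<delta>) * (36 * \<epsilon>2 * (e v)\<^sup>2)))"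
proof -
  define m where "m v = max 1 (nat \<lfloor>1 / e v\<rfloor>)" for v
  have finV: "finite V" using V finite_subset by blast
  \<comment> \<open>Tuples of cells: the location of \<open>u\<close> is recorded on one grid for
    each \<open>v\<close>, because the distances \<open>e v\<close> may differ.\<close>
  define C where "C = (\<Pi>\<^sub>E v\<in>V. {0..int (m v)} \<times> {0..int (m v)})"
  have finC: "finite C" unfolding C_def using finV by (intro finite_PiE) auto
  have eK: "edge u v \<in> K\<^sub>n" if "v \<in> V" for v using V u that by (intro edge_in_complete) auto
  define Q1 where "Q1 = (\<lambda>a \<omega>. \<forall>v\<in>V. cell (m v) (X u \<omega>) = a v)"
  define Q2 where "Q2 = (\<lambda>a \<omega>. \<forall>v\<in>V. Z (edge u v) \<omega> \<and> W (edge u v) \<omega> \<le> t v \<and> cell (m v) (X v \<omega>) \<in> neighbours (a v))"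
  have d1: "depends_on {xi u} (Q1 a)" for a
    unfolding Q1_def using depends_on_cell[of u _ "{_}"] finV by (intro depends_on_ball) auto
  have d2': "depends_on {zi (edge u v), wi (edge u v), xi v}
      (\<lambda>\<omega>. Z (edge u v) \<omega> \<and> W (edge u v) \<omega> \<le> t v \<and> cell (m v) (X v \<omega>) \<in> A)" for v A
    by (intro depends_on_conj depends_on_mono[OF depends_on_Z] depends_on_mono[OF depends_on_W_le]
        depends_on_mono[OF depends_on_cell]) auto
  have d2: "depends_on (\<Union>v\<in>V. {zi (edge u v), wi (edge u v), xi v}) (Q2 a)" for a
    unfolding Q2_def using finV by (intro depends_on_ball depends_on_mono[OF d2']) auto
  have sub2: "(\<Union>v\<in>V. {zi (edge u v), wi (edge u v), xi v}) \<subseteq> all_ix" using eK V by auto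
  have ev1: "{\<omega> \<in> space M. Q1 a \<omega>} \<in> events" for a by (rule depends_on_sets[OF d1]) (use u in simp)
  have p2: "prob {\<omega> \<in> space M. Q2 a \<omega>} \<le> (\<Prod>v\<in>V. p * (t v powr (1 / \<delta>) * (36 * \<epsilon>2 * (e v)\<^sup>2)))" for a
  proof -
    have "prob {\<omega> \<in> space M. Q2 a \<omega>} = (\<Prod>v\<in>V. prob {\<omega> \<in> space M. Z (edge u v) \<omega> \<and> W (edge u v) \<omega> \<le> t v \<and>
        cell (m v) (X v \<omega>) \<in> neighbours (a v)})"
      unfolding Q2_def
      by (rule prob_ball_depends_on[where I = "\<lambda>v. {zi (edge u v), wi (edge u v), xi v}"])
        (use finV d2' sub2 in \<open>auto simp: disjoint_family_on_def edge_eq_iff\<close>)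
    also have "\<dots> \<le> (\<Prod>v\<in>V. p * (t v powr (1 / \<delta>) * (36 * \<epsilon>2 * (e v)\<^sup>2)))"
    proof (rule prod_mono, intro conjI)
      fix v assume v: "v \<in> V"
      have h: "edge u v \<in> K\<^sub>n" by (rule eK[OF v])
      have vn: "v \<in> {1..n}" using v V by auto
      have m: "0 < m v" by (simp add: m_def)
      have "prob {\<omega> \<in> space M. Z (edge u v) \<omega> \<and> W (edge u v) \<omega> \<le> t v \<and> cell (m v) (X v \<omega>) \<in> neighbours (a v)}
          = prob {\<omega> \<in> space M. Z (edge u v) \<omega>} * (prob {\<omega> \<in> space M. W (edge u v) \<omega> \<le> t v} *
             prob {\<omega> \<in> space M. cell (m v) (X v \<omega>) \<in> neighbours (a v)})"
      proof -
        have "depends_on {wi (edge u v), xi v} (\<lambda>\<omega>. W (edge u v) \<omega> \<le> t v \<and> cell (m v) (X v \<omega>) \<in> neighbours (a v))"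
          by (intro depends_on_conj depends_on_mono[OF depends_on_W_le] depends_on_mono[OF depends_on_cell]) auto
        from prob_conj_depends_on[OF depends_on_Z this] show ?thesis
          using h vn prob_conj_depends_on[OF depends_on_W_le depends_on_cell, of "edge u v" v] by simp
      qed
      also have "\<dots> \<le> p * (t v powr (1 / \<delta>) * (36 * \<epsilon>2 * (e v)\<^sup>2))"
        unfolding prob_Z[OF h]
      proof (intro mult_left_mono mult_mono)
        show "prob {\<omega> \<in> space M. W (edge u v) \<omega> \<le> t v} \<le> t v powr (1 / \<delta>)"
          by (rule prob_W_le[OF h t[OF v]])
        have "prob {\<omega> \<in> space M. cell (m v) (X v \<omega>) \<in> neighbours (a v)}
            \<le> (\<Sum>b\<in>neighbours (a v). prob {\<omega> \<in> space M. cell (m v) (X v \<omega>) = b})"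
          by (rule prob_le_cover) (use card_neighbours(2) depends_on_sets[OF depends_on_cell[of v "m v" "{_}"]] vn in auto)
        also have "\<dots> \<le> (\<Sum>b\<in>neighbours (a v). \<epsilon>2 / (real (m v))\<^sup>2)"
          by (rule sum_mono) (rule prob_cell_le[OF vn m])
        also have "\<dots> = 9 * \<epsilon>2 * (1 / (real (m v))\<^sup>2)" by (simp add: card_neighbours)
        also have "\<dots> \<le> 9 * \<epsilon>2 * (4 * (e v)\<^sup>2)"
          using mesh_bound[OF e[OF v]] eps unfolding m_def by (intro mult_left_mono) auto
        finally show "prob {\<omega> \<in> space M. cell (m v) (X v \<omega>) \<in> neighbours (a v)} \<le> 36 * \<epsilon>2 * (e v)\<^sup>2" by simp
      qed (use p01 in auto)
      finally show "prob {\<omega> \<in> space M. Z (edge u v) \<omega> \<and> W (edge u v) \<omega> \<le> t v \<and> cell (m v) (X v \<omega>) \<in> neighbours (a v)}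
          \<le> p * (t v powr (1 / \<delta>) * (36 * \<epsilon>2 * (e v)\<^sup>2))" .
    qed simp
    finally show ?thesis .
  qed
  let ?R = "\<Prod>v\<in>V. p * (t v powr (1 / \<delta>) * (36 * \<epsilon>2 * (e v)\<^sup>2))"
  have R0: "0 \<le> ?R" using p01 eps by (intro prod_nonneg) auto
  have sq: "AE \<omega> in M. \<forall>w\<in>{1..n}. X w \<omega> \<in> unit_square"
    using AE_X_unit_square by (subst AE_ball_countable) auto
  have "prob {\<omega> \<in> space M. \<forall>v\<in>V. Z (edge u v) \<omega> \<and> W (edge u v) \<omega> \<le> t v \<and> dist (X u \<omega>) (X v \<omega>) \<le> e v}
      \<le> (\<Sum>a\<in>C. prob {\<omega> \<in> space M. Q1 a \<omega> \<and> Q2 a \<omega>})"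
  proof (rule prob_le_cover_AE[OF finC])
    show "{\<omega> \<in> space M. Q1 a \<omega> \<and> Q2 a \<omega>} \<in> events" for a
      by (rule depends_on_sets[OF depends_on_conj[OF depends_on_mono[OF d1] depends_on_mono[OF d2]],
            where I = "insert (xi u) (\<Union>v\<in>V. {zi (edge u v), wi (edge u v), xi v})"]) (use sub2 u in auto)
    show "AE \<omega> in M. (\<forall>v\<in>V. Z (edge u v) \<omega> \<and> W (edge u v) \<omega> \<le> t v \<and> dist (X u \<omega>) (X v \<omega>) \<le> e v) \<longrightarrow>
        (\<exists>a\<in>C. Q1 a \<omega> \<and> Q2 a \<omega>)"
      using sq
    proof eventually_elim
      case (elim \<omega>)
      show ?case
      proof
        assume star: "\<forall>v\<in>V. Z (edge u v) \<omega> \<and> W (edge u v) \<omega> \<le> t v \<and> dist (X u \<omega>) (X v \<omega>) \<le> e v"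
        let ?a = "\<lambda>v\<in>V. cell (m v) (X u \<omega>)"
        have xu: "0 \<le> X u \<omega> $ i" "X u \<omega> $ i \<le> 1" for i
          using elim u by (auto simp: unit_square_def)
        have "cell k (X u \<omega>) \<in> {0..int k} \<times> {0..int k}" for k
          using xu[of 1] xu[of 2] by (auto simp: cell_def le_floor_iff floor_le_iff intro!: order.strict_trans1[OF mult_left_le])
        hence "?a \<in> C" by (auto simp: C_def)
        moreover have "Q1 ?a \<omega>" by (simp add: Q1_def)
        moreover have "Q2 ?a \<omega>"
          unfolding Q2_def
        proof (intro ballI conjI)
          fix v assume v: "v \<in> V"
          show "cell (m v) (X v \<omega>) \<in> neighbours (?a v)"
            using cell_close[of "X u \<omega>" "X v \<omega>" "e v"] elim star v V u e[OF v] unfolding m_def by auto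
        qed (use star in auto)
        ultimately show "\<exists>a\<in>C. Q1 a \<omega> \<and> Q2 a \<omega>" by blast
      qed
    qed
  qed
  also have "\<dots> = (\<Sum>a\<in>C. prob {\<omega> \<in> space M. Q1 a \<omega>} * prob {\<omega> \<in> space M. Q2 a \<omega>})"
    by (intro sum.cong refl prob_conj_depends_on[OF d1 d2]) (use sub2 u V in auto)
  also have "\<dots> \<le> (\<Sum>a\<in>C. prob {\<omega> \<in> space M. Q1 a \<omega>} * ?R)"
    by (intro sum_mono mult_left_mono p2) auto
  also have "\<dots> = (\<Sum>a\<in>C. prob {\<omega> \<in> space M. Q1 a \<omega>}) * ?R" by (simp add: sum_distrib_right)
  \<comment> \<open>Different tuples exclude each other, so their probabilities sum to at most
    1.\<close>
  also have "(\<Sum>a\<in>C. prob {\<omega> \<in> space M. Q1 a \<omega>}) = prob (\<Union>a\<in>C. {\<omega> \<in> space M. Q1 a \<omega>})"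
  proof (rule finite_measure_finite_Union[symmetric, OF finC])
    show "disjoint_family_on (\<lambda>a. {\<omega> \<in> space M. Q1 a \<omega>}) C"
      unfolding disjoint_family_on_def
    proof (intro ballI impI equals0I)
      fix a b \<omega> assume ab: "a \<in> C" "b \<in> C" "a \<noteq> b"
        and "\<omega> \<in> {\<omega> \<in> space M. Q1 a \<omega>} \<inter> {\<omega> \<in> space M. Q1 b \<omega>}"
      hence "\<And>v. v \<in> V \<Longrightarrow> a v = b v" by (auto simp: Q1_def)
      thus False using ab PiE_ext[of a V _ b] unfolding C_def by blast
    qed
  qed (use ev1 in auto)
  also have "\<dots> * ?R \<le> 1 * ?R" by (rule mult_right_mono[OF prob_le_1 R0])
  finally show ?thesis by simp
qed

text \<open>The distance bound in the star estimate is sent to 0. Restricting to present edges fits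
  the form of that estimate and is enough to make their costs positive.\<close>

lemma AE_dist_pos:
  assumes "u \<in> {1..n}" "v \<in> {1..n}" "u \<noteq> v"
  shows "AE \<omega> in M. Z (edge u v) \<omega> \<longrightarrow> 0 < dist (X u \<omega>) (X v \<omega>)"
proof -
  have h: "edge u v \<in> K\<^sub>n" using assms by (intro edge_in_complete)
  have [measurable]: "X u \<in> borel_measurable M" "X v \<in> borel_measurable M" "W (edge u v) \<in> borel_measurable M"
    "Measurable.pred M (Z (edge u v))"
    using X_measurable W_measurable assms h Z_pred by auto
  let ?P = "\<lambda>\<omega>. Z (edge u v) \<omega> \<and> W (edge u v) \<omega> \<le> 1 \<and> dist (X u \<omega>) (X v \<omega>) = 0"
  have bnd: "prob {\<omega> \<in> space M. ?P \<omega>} \<le> p * (36 * \<epsilon>2 * e)" if e: "0 < e" for e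
  proof -
    have "prob {\<omega> \<in> space M. ?P \<omega>} \<le> prob {\<omega> \<in> space M. \<forall>v\<in>{v}. Z (edge u v) \<omega> \<and> W (edge u v) \<omega> \<le> 1 \<and> dist (X u \<omega>) (X v \<omega>) \<le> sqrt e}"
      using e by (intro finite_measure_mono) auto
    also have "\<dots> \<le> (\<Prod>v\<in>{v}. p * (1 powr (1 / \<delta>) * (36 * \<epsilon>2 * (sqrt e)\<^sup>2)))"
      by (rule prob_close_star) (use assms e in auto)
    finally show ?thesis using e by simp
  qed
  have "prob {\<omega> \<in> space M. ?P \<omega>} \<le> 0 + e" if "0 < e" for e
  proof -
    have "0 < e / (p * (36 * \<epsilon>2))" using that p01 eps by simp
    from bnd[OF this] show ?thesis using p01 eps by simp
  qed
  hence "prob {\<omega> \<in> space M. ?P \<omega>} \<le> 0" by (rule field_le_epsilon)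
  hence "prob {\<omega> \<in> space M. ?P \<omega>} = 0" by (simp only: measure_le_0_iff)
  hence "AE \<omega> in M. \<not> ?P \<omega>" by (subst (asm) prob_eq_0) auto
  thus ?thesis using AE_W_le_1[OF h] by eventually_elim auto
qed

text \<open>The second clause concerns two edges with a common end point, which are dependent
  through its location; \<open>q\<^sup>2\<close> is the bound that independence would give. It is
  what the second moment of the number of cheap edges at a vertex relies on.\<close>

definition cheap_bound :: "real \<Rightarrow> real \<Rightarrow> bool" where
  "cheap_bound q x \<longleftrightarrow>
    (\<forall>u\<in>{1..n}. \<forall>v\<in>{1..n}. u \<noteq> v \<longrightarrow> prob {\<omega> \<in> space M. Z (edge u v) \<omega> \<and> cost (edge u v) \<omega> \<le> x} \<le> q) \<and>
    (\<forall>u\<in>{1..n}. \<forall>v\<in>{1..n}. \<forall>w\<in>{1..n}. u \<noteq> v \<longrightarrow> u \<noteq> w \<longrightarrow> v \<noteq> w \<longrightarrow>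
      prob {\<omega> \<in> space M. (Z (edge u v) \<omega> \<and> cost (edge u v) \<omega> \<le> x) \<and> (Z (edge u w) \<omega> \<and> cost (edge u w) \<omega> \<le> x)} \<le> q\<^sup>2)"

text \<open>By \<open>scale\<close> a cheap edge obeys, for some \<open>k\<close>, both the weight
  bound \<open>t k\<close> and the length bound \<open>e k\<close>. Larger weights are traded for
  shorter lengths or conversely, and the probabilities on the scales form a geometric
  series.\<close>

lemma cheap_boundI:
  assumes t: "\<And>k. 0 < t k" and e: "\<And>k. 0 < e k"
    and ck: "\<And>k. t k powr (1 / \<delta>) * (36 * \<epsilon>2 * (e k)\<^sup>2) = c * \<rho> ^ k" and rho: "0 \<le> \<rho>" "\<rho> < 1"
    and scale: "\<And>d w. 0 < d \<Longrightarrow> d \<le> sqrt 2 \<Longrightarrow> 0 < w \<Longrightarrow> w \<le> 1 \<Longrightarrow> (d / sqrt 2) powr \<alpha> * w \<le> x \<Longrightarrow>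
      \<exists>k :: nat. w \<le> t k \<and> d \<le> e k"
  shows "cheap_bound (p * (c / (1 - \<rho>))) x"
proof -
  let ?E = "\<lambda>u v k \<omega>. Z (edge u v) \<omega> \<and> W (edge u v) \<omega> \<le> t k \<and> dist (X u \<omega>) (X v \<omega>) \<le> e k"
  let ?P = "\<lambda>u v \<omega>. Z (edge u v) \<omega> \<and> cost (edge u v) \<omega> \<le> x"
  have meas: "{\<omega> \<in> space M. ?E u v k \<omega>} \<in> events" "{\<omega> \<in> space M. ?P u v \<omega>} \<in> events"
    if "u \<in> {1..n}" "v \<in> {1..n}" "u \<noteq> v" for u v k
  proof -
    have h: "edge u v \<in> K\<^sub>n" using that by (intro edge_in_complete)
    have [measurable]: "X u \<in> borel_measurable M" "X v \<in> borel_measurable M" "W (edge u v) \<in> borel_measurable M"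
      "Measurable.pred M (Z (edge u v))" "cost (edge u v) \<in> borel_measurable M"
      using X_measurable W_measurable that h Z_pred cost_measurable by auto
    show "{\<omega> \<in> space M. ?E u v k \<omega>} \<in> events" "{\<omega> \<in> space M. ?P u v \<omega>} \<in> events" by measurable
  qed
  have cover: "AE \<omega> in M. ?P u v \<omega> \<longrightarrow> (\<exists>k. ?E u v k \<omega>)"
    if uv: "u \<in> {1..n}" "v \<in> {1..n}" "u \<noteq> v" for u v
  proof -
    have h: "edge u v \<in> K\<^sub>n" using uv by (intro edge_in_complete)
    show ?thesis
      using AE_dist_pos[OF uv] AE_W_le_1[OF h] W_pos[OF h] AE_X_unit_square[OF uv(1)] AE_X_unit_square[OF uv(2)]
    proof eventually_elim
      case (elim \<omega>)
      thus ?case using scale[of "dist (X u \<omega>) (X v \<omega>)" "W (edge u v) \<omega>"] dist_unit_square[of "X u \<omega>" "X v \<omega>"]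
        by (auto simp: cost_edge)
    qed
  qed
  have single: "prob {\<omega> \<in> space M. ?P u v \<omega>} \<le> p * (c / (1 - \<rho>))"
    if uv: "u \<in> {1..n}" "v \<in> {1..n}" "u \<noteq> v" for u v
  proof -
    have "prob {\<omega> \<in> space M. ?P u v \<omega>} \<le> (p * c) / (1 - \<rho>)"
    proof (rule prob_le_geometric_cover[OF meas(1)[OF uv] cover[OF uv] _ rho])
      fix k
      have "prob {\<omega> \<in> space M. \<forall>v\<in>{v}. ?E u v k \<omega>} \<le> (\<Prod>v\<in>{v}. p * (t k powr (1 / \<delta>) * (36 * \<epsilon>2 * (e k)\<^sup>2)))"
        by (rule prob_close_star) (use uv t e in auto)
      thus "prob {\<omega> \<in> space M. ?E u v k \<omega>} \<le> p * c * \<rho> ^ k" using ck[of k] by simp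
    qed
    thus ?thesis by simp
  qed
  have pair: "prob {\<omega> \<in> space M. ?P u v \<omega> \<and> ?P u w \<omega>} \<le> (p * (c / (1 - \<rho>)))\<^sup>2"
    if uv: "u \<in> {1..n}" "v \<in> {1..n}" "u \<noteq> v" and uw: "w \<in> {1..n}" "u \<noteq> w" and vw: "v \<noteq> w" for u v w
  proof -
    \<comment> \<open>Two nested covers: the scale \<open>k\<close> of the edge to \<open>v\<close>
      stays fixed while the scales of the edge to \<open>w\<close> are summed; the outer sum over
      \<open>k\<close> follows.\<close>
    have inner: "prob {\<omega> \<in> space M. ?E u v k \<omega> \<and> ?P u w \<omega>} \<le> (p * c * \<rho> ^ k * (p * c)) / (1 - \<rho>)" for k
    proof (rule prob_le_geometric_cover[OF _ _ _ rho])
      fix j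
      have "{\<omega> \<in> space M. ?E u v k \<omega> \<and> ?E u w j \<omega>} = {\<omega> \<in> space M. ?E u v k \<omega>} \<inter> {\<omega> \<in> space M. ?E u w j \<omega>}" by blast
      thus "{\<omega> \<in> space M. ?E u v k \<omega> \<and> ?E u w j \<omega>} \<in> events"
        using sets.Int[OF meas(1)[OF uv] meas(1)[OF uv(1) uw]] by simp
      let ?k = "(\<lambda>_. j)(v := k)"
      have "prob {\<omega> \<in> space M. \<forall>y\<in>{v, w}. ?E u y (?k y) \<omega>}
          \<le> (\<Prod>y\<in>{v, w}. p * (t (?k y) powr (1 / \<delta>) * (36 * \<epsilon>2 * (e (?k y))\<^sup>2)))"
        by (rule prob_close_star) (use uv uw t e in auto)
      also have "\<dots> = p * c * \<rho> ^ k * (p * c) * \<rho> ^ j" using vw ck by simp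
      finally show "prob {\<omega> \<in> space M. ?E u v k \<omega> \<and> ?E u w j \<omega>} \<le> p * c * \<rho> ^ k * (p * c) * \<rho> ^ j"
        using vw by simp
    next
      show "AE \<omega> in M. ?E u v k \<omega> \<and> ?P u w \<omega> \<longrightarrow> (\<exists>j. ?E u v k \<omega> \<and> ?E u w j \<omega>)"
        using cover[OF uv(1) uw] by eventually_elim blast
    qed
    have "prob {\<omega> \<in> space M. ?P u v \<omega> \<and> ?P u w \<omega>} \<le> (p * c * (p * c) / (1 - \<rho>)) / (1 - \<rho>)"
    proof (rule prob_le_geometric_cover[OF _ _ _ rho])
      fix k
      have "{\<omega> \<in> space M. ?E u v k \<omega> \<and> ?P u w \<omega>} = {\<omega> \<in> space M. ?E u v k \<omega>} \<inter> {\<omega> \<in> space M. ?P u w \<omega>}" by blast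
      thus "{\<omega> \<in> space M. ?E u v k \<omega> \<and> ?P u w \<omega>} \<in> events"
        using sets.Int[OF meas(1)[OF uv] meas(2)[OF uv(1) uw]] by simp
      show "prob {\<omega> \<in> space M. ?E u v k \<omega> \<and> ?P u w \<omega>} \<le> p * c * (p * c) / (1 - \<rho>) * \<rho> ^ k"
        using inner[of k] by (simp add: mult_ac)
    next
      show "AE \<omega> in M. ?P u v \<omega> \<and> ?P u w \<omega> \<longrightarrow> (\<exists>k. ?E u v k \<omega> \<and> ?P u w \<omega>)"
        using cover[OF uv] by eventually_elim blast
    qed
    thus ?thesis by (simp add: power2_eq_square)
  qed
  show ?thesis unfolding cheap_bound_def using single pair by blast
qed

text \<open>The scales are those of the length. A length near \<open>sqrt 2 * (1 / 2) ^ k\<close>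
  allows the weight to grow by \<open>2 powr (k * \<alpha>)\<close>, which raises the weight
  probability by \<open>2 powr (k * \<alpha> / \<delta>)\<close>, while the area shrinks by
  \<open>4 ^ k\<close>. The long edges dominate, so an edge is cheap mainly because of a small
  weight.\<close>

lemma cheap_bound_weights:
  assumes a: "\<alpha> < 2 * \<delta>" and x: "0 < x"
  shows "cheap_bound (p * (72 * \<epsilon>2 * 2 powr (\<alpha> / \<delta>) * x powr (1 / \<delta>) / (1 - 2 powr (\<alpha> / \<delta>) / 4))) x"
proof (rule cheap_boundI[where t = "\<lambda>k. x * (2 ^ Suc k) powr \<alpha>" and e = "\<lambda>k. sqrt 2 * (1 / 2) ^ k"])
  fix k :: nat
  have "((2 :: real) ^ Suc k) powr (\<alpha> / \<delta>) = 2 powr (\<alpha> / \<delta>) * (2 powr (\<alpha> / \<delta>)) ^ k"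
    by (simp add: powr_mult powr_power powr_powr mult.commute flip: powr_realpow)
  moreover have "(sqrt 2 * (1 / 2) ^ k)\<^sup>2 = 2 * (1 / 4 :: real) ^ k"
    by (simp add: power_mult_distrib power_divide power2_eq_square flip: power_mult_distrib)
  ultimately show "(x * (2 ^ Suc k) powr \<alpha>) powr (1 / \<delta>) * (36 * \<epsilon>2 * (sqrt 2 * (1 / 2) ^ k)\<^sup>2)
      = 72 * \<epsilon>2 * 2 powr (\<alpha> / \<delta>) * x powr (1 / \<delta>) * (2 powr (\<alpha> / \<delta>) / 4) ^ k"
    using x by (simp add: powr_mult powr_powr power_divide del: power_Suc)
next
  have "2 powr (\<alpha> / \<delta>) < (2 :: real) powr 2" using a delta by (intro powr_less_mono) (auto simp: field_simps)
  thus "2 powr (\<alpha> / \<delta>) / 4 < (1 :: real)" by simp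
next
  fix d w :: real
  assume d: "0 < d" "d \<le> sqrt 2" and w: "0 < w" "w \<le> 1" and le: "(d / sqrt 2) powr \<alpha> * w \<le> x"
  obtain k where k: "(1 / 2) ^ Suc k < d / sqrt 2" "d / sqrt 2 \<le> (1 / 2) ^ k"
    using dyadic_scale[of "d / sqrt 2"] d by auto
  have "((1 / 2) ^ Suc k) powr \<alpha> * w \<le> (d / sqrt 2) powr \<alpha> * w"
    using k(1) w alpha by (intro mult_right_mono powr_mono2) auto
  hence "((1 / 2) ^ Suc k) powr \<alpha> * w \<le> x" using le by simp
  moreover have "((1 / 2 :: real) ^ Suc k) powr \<alpha> = 1 / (2 ^ Suc k) powr \<alpha>"
    by (simp add: power_one_over powr_divide del: power_Suc)
  ultimately have "w / (2 ^ Suc k) powr \<alpha> \<le> x" by (simp del: power_Suc)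
  hence "w \<le> x * (2 ^ Suc k) powr \<alpha>" by (simp add: pos_divide_le_eq del: power_Suc)
  moreover have "d \<le> sqrt 2 * (1 / 2) ^ k" using k(2) by (simp add: field_simps)
  ultimately show "\<exists>k. w \<le> x * (2 ^ Suc k) powr \<alpha> \<and> d \<le> sqrt 2 * (1 / 2) ^ k" by blast
qed (use x in auto)

text \<open>The scales are those of the weight. A weight near \<open>(1 / 2) ^ k\<close> has
  probability of order \<open>2 powr (- k / \<delta>)\<close>, while the admissible area grows by
  \<open>2 powr (2 * k / \<alpha>)\<close>. The weights of order 1 dominate, so an edge is cheap
  mainly because it is short.\<close>

lemma cheap_bound_distances:
  assumes a: "2 * \<delta> < \<alpha>" and x: "0 < x"
  shows "cheap_bound (p * (72 * \<epsilon>2 * 2 powr (2 / \<alpha>) * x powr (2 / \<alpha>) / (1 - 2 powr (2 / \<alpha> - 1 / \<delta>)))) x"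
proof (rule cheap_boundI[where t = "\<lambda>k. (1 / 2) ^ k" and e = "\<lambda>k. sqrt 2 * (x * 2 ^ Suc k) powr (1 / \<alpha>)"])
  fix k :: nat
  have "(sqrt 2 * (x * 2 ^ Suc k) powr (1 / \<alpha>))\<^sup>2 = 2 * (x * 2 ^ Suc k) powr (2 / \<alpha>)"
    using x by (simp add: power_mult_distrib powr_power del: power_Suc)
  also have "\<dots> = 2 * (x powr (2 / \<alpha>) * (2 powr (2 / \<alpha>) * (2 powr (2 / \<alpha>)) ^ k))"
    using x by (simp add: powr_mult powr_power powr_powr mult.commute flip: powr_realpow)
  finally have e: "(sqrt 2 * (x * 2 ^ Suc k) powr (1 / \<alpha>))\<^sup>2 = 2 * (x powr (2 / \<alpha>) * (2 powr (2 / \<alpha>) * (2 powr (2 / \<alpha>)) ^ k))" .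
  have "((1 / 2 :: real) ^ k) powr (1 / \<delta>) = (2 powr (- (1 / \<delta>))) ^ k"
    by (simp add: power_one_over powr_divide powr_minus powr_power powr_powr divide_simps flip: powr_realpow)
  moreover have "(2 :: real) powr (2 / \<alpha> - 1 / \<delta>) = 2 powr (2 / \<alpha>) * 2 powr (- (1 / \<delta>))"
    by (simp add: powr_add[symmetric])
  ultimately show "((1 / 2) ^ k) powr (1 / \<delta>) * (36 * \<epsilon>2 * (sqrt 2 * (x * 2 ^ Suc k) powr (1 / \<alpha>))\<^sup>2)
      = 72 * \<epsilon>2 * 2 powr (2 / \<alpha>) * x powr (2 / \<alpha>) * (2 powr (2 / \<alpha> - 1 / \<delta>)) ^ k"
    unfolding e by (simp add: power_mult_distrib)
next
  have "2 powr (2 / \<alpha> - 1 / \<delta>) < (2 :: real) powr 0" using a alpha delta by (intro powr_less_mono) (auto simp: field_simps)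
  thus "2 powr (2 / \<alpha> - 1 / \<delta>) < (1 :: real)" by simp
next
  fix d w :: real
  assume d: "0 < d" "d \<le> sqrt 2" and w: "0 < w" "w \<le> 1" and le: "(d / sqrt 2) powr \<alpha> * w \<le> x"
  obtain k where k: "(1 / 2) ^ Suc k < w" "w \<le> (1 / 2) ^ k" using dyadic_scale[of w] w by auto
  have "(d / sqrt 2) powr \<alpha> * (1 / 2) ^ Suc k \<le> (d / sqrt 2) powr \<alpha> * w"
    using k(1) by (intro mult_left_mono) auto
  hence "(d / sqrt 2) powr \<alpha> * (1 / 2) ^ Suc k \<le> x" using le by linarith
  hence "(d / sqrt 2) powr \<alpha> \<le> x * 2 ^ Suc k"
    by (simp add: power_one_over pos_divide_le_eq del: power_Suc)
  hence "((d / sqrt 2) powr \<alpha>) powr (1 / \<alpha>) \<le> (x * 2 ^ Suc k) powr (1 / \<alpha>)"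
    using alpha by (intro powr_mono2) auto
  hence "d / sqrt 2 \<le> (x * 2 ^ Suc k) powr (1 / \<alpha>)" using d alpha by (simp add: powr_powr)
  hence "d \<le> sqrt 2 * (x * 2 ^ Suc k) powr (1 / \<alpha>)" by (simp add: field_simps)
  thus "\<exists>k. w \<le> (1 / 2) ^ k \<and> d \<le> sqrt 2 * (x * 2 ^ Suc k) powr (1 / \<alpha>)" using k(2) by blast
qed (use x in auto)

end

section \<open>The mean cost\<close>

lemma connection_cost_cong:
  assumes "\<And>h. h \<in> complete_edges n \<Longrightarrow> c h = c' h"
  shows "connection_cost n c = connection_cost n c'"
  unfolding connection_cost_def
  by (rule arg_cong[where f = Min], rule image_cong[OF refl], rule sum.cong) (use assms in \<open>auto simp: connectors_def\<close>)

lemma connection_cost_measurable: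
  assumes "\<And>h. h \<in> complete_edges n \<Longrightarrow> (\<lambda>x. c x h) \<in> borel_measurable N"
  shows "(\<lambda>x. connection_cost n (c x)) \<in> borel_measurable N"
  unfolding connection_cost_def
  by (intro borel_measurable_Min borel_measurable_sum) (use assms in \<open>auto simp: connectors_def\<close>)

lemma connection_cost_nonneg:
  assumes "1 \<le> n" "\<And>h. h \<in> complete_edges n \<Longrightarrow> 0 \<le> c h"
  shows "0 \<le> connection_cost n c"
proof -
  obtain T where "T \<in> connectors n" "connection_cost n c = sum c T"
    using connection_cost_attained[OF assms(1)] .
  thus ?thesis using assms(2) by (auto intro!: sum_nonneg simp: connectors_def)
qed

lemma connection_cost_le_star:
  assumes "1 \<le> n" "\<And>h. h \<in> complete_edges n \<Longrightarrow> c h \<le> l" "0 \<le> l"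
  shows "connection_cost n c \<le> n * l"
proof -
  have "connection_cost n c \<le> (\<Sum>i=2..n. c (1, i))"
    by (rule connection_cost_le_recursive[of n "\<lambda>_. 1"]) (use assms(1) in auto)
  also have "\<dots> \<le> (\<Sum>i=2..n. l)" using assms(2) by (intro sum_mono) (auto simp: complete_edges_def)
  also have "\<dots> \<le> n * l" using assms(3) by (auto intro: mult_right_mono)
  finally show ?thesis .
qed

text \<open>A discrete layer-cake formula: the levels below \<open>y\<close> add up to a geometric
  sum. It bounds an expectation by tail probabilities at dyadic levels.\<close>

lemma dyadic_layers:
  fixes y s :: real
  assumes "0 < s" "y \<le> 2 ^ K * s"
  shows "y \<le> s + (\<Sum>k<K. 2 ^ k * s * of_bool (2 ^ k * s < y))"
  using assms(2)
proof (induction K)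
  case (Suc K)
  show ?case
  proof (cases "2 ^ K * s < y")
    case True
    have "2 ^ k * s < y" if "k < K" for k
    proof -
      have "(2 :: real) ^ k \<le> 2 ^ K" using that by (intro power_increasing) auto
      hence "2 ^ k * s \<le> 2 ^ K * s" using assms(1) by (intro mult_right_mono) auto
      thus ?thesis using True by linarith
    qed
    hence "(\<Sum>k<K. 2 ^ k * s * of_bool (2 ^ k * s < y)) = (\<Sum>k<K. 2 ^ k * s)" by (intro sum.cong) auto
    also have "\<dots> = (2 ^ K - 1) * s" by (induction K) (simp_all add: algebra_simps)
    finally show ?thesis using Suc.prems True by (simp add: algebra_simps)
  next
    case False
    thus ?thesis using Suc.IH by simp
  qed
qed simp

text \<open>Comparison with an integral, by the mean value theorem on each unit interval.\<close>

lemma sum_powr_minus_le: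
  fixes \<delta> :: real
  assumes "0 < \<delta>" "\<delta> < 1"
  shows "(\<Sum>j=1..m. real j powr (- \<delta>)) \<le> real m powr (1 - \<delta>) / (1 - \<delta>)"
proof (induction m)
  case (Suc m)
  have "real (Suc m) powr (- \<delta>) * (1 - \<delta>) \<le> real (Suc m) powr (1 - \<delta>) - real m powr (1 - \<delta>)"
  proof (cases "m = 0")
    case False
    have "\<exists>z>real m. z < real (Suc m) \<and> real (Suc m) powr (1 - \<delta>) - real m powr (1 - \<delta>)
        = (real (Suc m) - real m) * ((1 - \<delta>) * z powr (1 - \<delta> - 1))"
      by (rule MVT2) (use False in \<open>auto intro!: derivative_eq_intros\<close>)
    then obtain z where z: "real m < z" "z < real (Suc m)"
      "real (Suc m) powr (1 - \<delta>) - real m powr (1 - \<delta>) = (1 - \<delta>) * z powr (- \<delta>)" by auto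
    have "real (Suc m) powr (- \<delta>) \<le> z powr (- \<delta>)"
      using z False assms by (intro powr_mono2') auto
    hence "(1 - \<delta>) * real (Suc m) powr (- \<delta>) \<le> (1 - \<delta>) * z powr (- \<delta>)"
      using assms by (intro mult_left_mono) auto
    thus ?thesis unfolding z(3) by (simp only: mult.commute)
  qed (use assms in auto)
  hence "real (Suc m) powr (- \<delta>) \<le> (real (Suc m) powr (1 - \<delta>) - real m powr (1 - \<delta>)) / (1 - \<delta>)"
    using assms by (simp add: pos_le_divide_eq)
  thus ?case using Suc.IH by (simp add: diff_divide_distrib)
qed simp

section \<open>The tree cost and its capped version\<close>

context euclidean_mst
begin

lemma filter_events:
  assumes "\<And>h. h \<in> K\<^sub>n \<Longrightarrow> {\<omega> \<in> space M. E h \<omega>} \<in> events"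
  shows "{\<omega> \<in> space M. Q {h \<in> K\<^sub>n. E h \<omega>}} \<in> events"
proof -
  have "{\<omega> \<in> space M. Q {h \<in> K\<^sub>n. E h \<omega>}}
      = (\<Union>S\<in>{S \<in> Pow K\<^sub>n. Q S}. {\<omega> \<in> space M. \<forall>h\<in>K\<^sub>n. (h \<in> S) = E h \<omega>})"
    (is "?A = ?B")
  proof
    show "?A \<subseteq> ?B"
    proof
      fix \<omega> assume "\<omega> \<in> ?A"
      thus "\<omega> \<in> ?B" by (intro UN_I[of "{h \<in> K\<^sub>n. E h \<omega>}"]) auto
    qed
    show "?B \<subseteq> ?A"
    proof
      fix \<omega> assume "\<omega> \<in> ?B"
      then obtain S where S: "S \<subseteq> K\<^sub>n" "Q S" "\<omega> \<in> space M" "\<forall>h\<in>K\<^sub>n. (h \<in> S) = E h \<omega>" by auto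
      hence "S = {h \<in> K\<^sub>n. E h \<omega>}" by auto
      thus "\<omega> \<in> ?A" using S by simp
    qed
  qed
  also have "\<dots> \<in> events"
  proof (rule sets.finite_UN)
    fix S assume "S \<in> {S \<in> Pow K\<^sub>n. Q S}"
    show "{\<omega> \<in> space M. \<forall>h\<in>K\<^sub>n. (h \<in> S) = E h \<omega>} \<in> events"
    proof (rule sets.sets_Collect_finite_All)
      fix h assume "h \<in> K\<^sub>n"
      hence [measurable]: "Measurable.pred M (E h)" using assms by (simp add: pred_def)
      show "{\<omega> \<in> space M. (h \<in> S) = E h \<omega>} \<in> events" by measurable
    qed simp
  qed auto
  finally show ?thesis .
qed

definition tree_cost :: "(nat \<Rightarrow> (nat \<times> nat) set \<Rightarrow> nat set) \<Rightarrow> 'a \<Rightarrow> real" where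
  "tree_cost L \<omega> = mst_cost L (\<lambda>x y. (dist x y / sqrt 2) powr \<alpha>) n Z W X \<omega>"

lemma tree_cost_eq:
  "tree_cost L \<omega> = Min (sum (\<lambda>h. cost h \<omega>) ` spanning_trees (L n (random_edges n Z \<omega>)) (random_edges n Z \<omega>))"
  unfolding tree_cost_def mst_cost_def cost_def ..

lemma random_edges_subset: "random_edges n Z \<omega> \<subseteq> K\<^sub>n"
  by (auto simp: random_edges_def)

lemma random_edges_pred: "{\<omega> \<in> space M. Q (random_edges n Z \<omega>)} \<in> events"
  unfolding random_edges_def
  by (rule depends_on_sets[where I = "zi ` K\<^sub>n"], rule depends_on_filter)
    (auto intro: depends_on_mono[OF depends_on_Z])

text \<open>For each of the finitely many graphs the cost is a minimum of finitely many measurable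
  sums, and the graph itself is a discrete random variable.\<close>

lemma tree_cost_measurable:
  assumes rule: "largest_component_rule L"
  shows "tree_cost L \<in> borel_measurable M"
proof -
  have n1: "1 \<le> n" using n2 by simp
  have g: "random_edges n Z \<in> measurable M (count_space (Pow K\<^sub>n))"
  proof (subst measurable_count_space_eq2)
    show "random_edges n Z \<in> space M \<rightarrow> Pow K\<^sub>n \<and>
        (\<forall>a\<in>Pow K\<^sub>n. random_edges n Z -` {a} \<inter> space M \<in> events)"
    proof (intro conjI ballI)
      fix a
      have "random_edges n Z -` {a} \<inter> space M = {\<omega> \<in> space M. random_edges n Z \<omega> = a}" by auto
      thus "random_edges n Z -` {a} \<inter> space M \<in> events" using random_edges_pred[of "\<lambda>x. x = a"] by simp
    qed (use random_edges_subset in auto)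
  qed simp
  have f: "(\<lambda>\<omega>. Min (sum (\<lambda>h. cost h \<omega>) ` spanning_trees (L n E) E)) \<in> borel_measurable M"
    if "E \<in> Pow K\<^sub>n" for E
    using that cost_measurable spanning_trees_largest(1)[OF rule, of E n] n1
    by (intro borel_measurable_Min borel_measurable_sum) (auto simp: spanning_trees_def)
  have "countable (Pow K\<^sub>n)" by (intro countable_finite) auto
  from measurable_compose_countable'[where f = "\<lambda>E \<omega>. Min (sum (\<lambda>h. cost h \<omega>) ` spanning_trees (L n E) E)", OF f g this]
  show ?thesis unfolding tree_cost_eq[symmetric] .
qed

text \<open>The almost sure properties in one place, so that the deterministic graph arguments can
  be applied pointwise.\<close>

definition regular :: "'a \<Rightarrow> bool" where
  "regular \<omega> \<longleftrightarrow> (\<forall>h\<in>K\<^sub>n. 0 < W h \<omega> \<and> W h \<omega> \<le> 1 \<and> 0 \<le> cost h \<omega> \<and> cost h \<omega> \<le> W h \<omega> \<and>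
      (Z h \<omega> \<longrightarrow> 0 < cost h \<omega>)) \<and> (\<forall>u\<in>{1..n}. X u \<omega> \<in> unit_square)"

lemma AE_regular: "AE \<omega> in M. regular \<omega>"
proof -
  have sq: "AE \<omega> in M. \<forall>u\<in>{1..n}. X u \<omega> \<in> unit_square"
    using AE_X_unit_square by (subst AE_ball_countable) auto
  have "AE \<omega> in M. \<forall>h\<in>K\<^sub>n. 0 < W h \<omega> \<and> W h \<omega> \<le> 1 \<and> 0 \<le> cost h \<omega> \<and> cost h \<omega> \<le> W h \<omega> \<and>
      (Z h \<omega> \<longrightarrow> 0 < cost h \<omega>)"
  proof (subst AE_ball_countable)
    show "\<forall>h\<in>K\<^sub>n. AE \<omega> in M. 0 < W h \<omega> \<and> W h \<omega> \<le> 1 \<and> 0 \<le> cost h \<omega> \<and> cost h \<omega> \<le> W h \<omega> \<and>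
        (Z h \<omega> \<longrightarrow> 0 < cost h \<omega>)"
    proof
      fix h assume h: "h \<in> K\<^sub>n"
      obtain u v where uv: "h = (u, v)" by (cases h)
      have uv': "u \<in> {1..n}" "v \<in> {1..n}" "u \<noteq> v" "edge u v = h"
        using h uv by (auto simp: complete_edges_def edge_def)
      show "AE \<omega> in M. 0 < W h \<omega> \<and> W h \<omega> \<le> 1 \<and> 0 \<le> cost h \<omega> \<and> cost h \<omega> \<le> W h \<omega> \<and>
          (Z h \<omega> \<longrightarrow> 0 < cost h \<omega>)"
        using W_pos[OF h] AE_W_le_1[OF h] AE_dist_pos[OF uv'(1-3), unfolded uv'(4)] sq
      proof eventually_elim
        case (elim \<omega>)
        have c: "cost h \<omega> = (dist (X u \<omega>) (X v \<omega>) / sqrt 2) powr \<alpha> * W h \<omega>"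
          using cost_edge[of u v \<omega>] uv'(4) by simp
        have "dist (X u \<omega>) (X v \<omega>) / sqrt 2 \<le> 1" using dist_unit_square elim(4) uv' by simp
        hence "(dist (X u \<omega>) (X v \<omega>) / sqrt 2) powr \<alpha> \<le> 1" using alpha by (intro powr_le1) auto
        hence "cost h \<omega> \<le> 1 * W h \<omega>" unfolding c using elim(1) by (intro mult_right_mono) auto
        thus ?case using elim unfolding c by auto
      qed
    qed
  qed auto
  thus ?thesis using sq unfolding regular_def by eventually_elim blast
qed

lemma regular_cost:
  assumes "regular \<omega>" "h \<in> K\<^sub>n"
  shows "0 \<le> cost h \<omega>" "cost h \<omega> \<le> 1" "cost h \<omega> \<le> W h \<omega>" "Z h \<omega> \<Longrightarrow> 0 < cost h \<omega>"
  using assms unfolding regular_def by fastforce+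

lemma tree_cost_attained:
  assumes rule: "largest_component_rule L"
  obtains T where "T \<in> spanning_trees (L n (random_edges n Z \<omega>)) (random_edges n Z \<omega>)"
    "T \<subseteq> K\<^sub>n" "tree_cost L \<omega> = (\<Sum>h\<in>T. cost h \<omega>)"
proof -
  let ?S = "spanning_trees (L n (random_edges n Z \<omega>)) (random_edges n Z \<omega>)"
  have n1: "1 \<le> n" using n2 by simp
  have "Min (sum (\<lambda>h. cost h \<omega>) ` ?S) \<in> sum (\<lambda>h. cost h \<omega>) ` ?S"
    using spanning_trees_largest[OF rule random_edges_subset n1] by (intro Min_in) auto
  then obtain T where "T \<in> ?S" "tree_cost L \<omega> = (\<Sum>h\<in>T. cost h \<omega>)" unfolding tree_cost_eq by blast
  moreover from this have "T \<subseteq> K\<^sub>n" using random_edges_subset[of \<omega>] by (auto simp: spanning_trees_def)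
  ultimately show ?thesis using that by blast
qed

lemma tree_cost_bounds:
  assumes rule: "largest_component_rule L" and reg: "regular \<omega>"
  shows "0 \<le> tree_cost L \<omega>" "tree_cost L \<omega> \<le> n * n" "Z (1, 2) \<omega> \<Longrightarrow> 0 < tree_cost L \<omega>"
proof -
  obtain T where T: "T \<in> spanning_trees (L n (random_edges n Z \<omega>)) (random_edges n Z \<omega>)"
    "T \<subseteq> K\<^sub>n" "tree_cost L \<omega> = (\<Sum>h\<in>T. cost h \<omega>)" using tree_cost_attained[OF rule] .
  have finT: "finite T" using T(2) finite_subset[of T K\<^sub>n] by simp
  show "0 \<le> tree_cost L \<omega>" unfolding T(3) using T(2) regular_cost[OF reg] by (intro sum_nonneg) auto
  have "(\<Sum>h\<in>T. cost h \<omega>) \<le> (\<Sum>h\<in>T. 1)" using T(2) regular_cost[OF reg] by (intro sum_mono) auto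
  also have "\<dots> \<le> card K\<^sub>n" using T(2) by (simp add: card_mono)
  also have "\<dots> \<le> n * n" using card_complete_edges_le[of n] by (metis of_nat_le_iff of_nat_mult)
  finally show "tree_cost L \<omega> \<le> n * n" unfolding T(3) .
  assume "Z (1, 2) \<omega>"
  hence "(1, 2) \<in> random_edges n Z \<omega>" using n2 by (auto simp: random_edges_def complete_edges_def)
  hence "T \<noteq> {}" using spanning_tree_largest_nonempty[OF rule random_edges_subset _ T(1)] by blast
  moreover have "0 < cost h \<omega>" if "h \<in> T" for h
    using that T(1,2) regular_cost(4)[OF reg, of h] by (auto simp: spanning_trees_def random_edges_def)
  ultimately show "0 < tree_cost L \<omega>" unfolding T(3) using finT by (intro sum_pos) auto
qed

lemma integrable_tree_cost:
  assumes rule: "largest_component_rule L"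
  shows "integrable M (tree_cost L)" "integrable M (\<lambda>\<omega>. (tree_cost L \<omega> - c)\<^sup>2)"
proof -
  have b: "AE \<omega> in M. \<bar>tree_cost L \<omega>\<bar> \<le> n * n"
    using AE_regular by eventually_elim (use tree_cost_bounds[OF rule] in auto)
  note [measurable] = tree_cost_measurable[OF rule]
  show "integrable M (tree_cost L)"
    by (rule integrable_const_bound[of _ "n * n"]) (use b in auto)
  show "integrable M (\<lambda>\<omega>. (tree_cost L \<omega> - c)\<^sup>2)"
  proof (rule integrable_const_bound[of _ "(n * n + \<bar>c\<bar>)\<^sup>2"])
    show "AE \<omega> in M. norm ((tree_cost L \<omega> - c)\<^sup>2) \<le> (n * n + \<bar>c\<bar>)\<^sup>2"
      using b
    proof eventually_elim
      case (elim \<omega>)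
      hence "\<bar>tree_cost L \<omega> - c\<bar> \<le> n * n + \<bar>c\<bar>" by linarith
      from power_mono[OF this, of 2] show ?case by simp
    qed
  qed measurable
qed

text \<open>With probability \<open>p > 0\<close> the edge between 1 and 2 is present, and then a
  spanning tree of the largest component has an edge, all of whose kind have positive cost.\<close>

lemma expectation_tree_cost_pos:
  assumes rule: "largest_component_rule L"
  shows "0 < expectation (tree_cost L)"
proof -
  have h: "(1, 2) \<in> K\<^sub>n" using n2 by (auto simp: complete_edges_def)
  have nn: "AE \<omega> in M. 0 \<le> tree_cost L \<omega>"
    using AE_regular by eventually_elim (use tree_cost_bounds[OF rule] in auto)
  have "expectation (tree_cost L) \<noteq> 0"
  proof
    assume "expectation (tree_cost L) = 0"
    hence "AE \<omega> in M. tree_cost L \<omega> = 0"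
      using integral_nonneg_eq_0_iff_AE[OF integrable_tree_cost(1)[OF rule] nn] by simp
    hence "AE \<omega> in M. \<not> Z (1, 2) \<omega>"
      using AE_regular by eventually_elim (use tree_cost_bounds(3)[OF rule] in force)
    hence "prob {\<omega> \<in> space M. Z (1, 2) \<omega>} = 0"
      using Z_pred[OF h] by (subst prob_eq_0) auto
    thus False using prob_Z[OF h] p01 by simp
  qed
  thus ?thesis using integral_nonneg_AE[OF nn] by simp
qed

definition cheap_edges :: "real \<Rightarrow> 'a \<Rightarrow> (nat \<times> nat) set" where
  "cheap_edges l \<omega> = {h \<in> K\<^sub>n. Z h \<omega> \<and> cost h \<omega> \<le> l}"

text \<open>Taking the maximum with 0 changes values on a null set only. It makes the bounds 0 and
  \<open>l\<close> hold everywhere, so the functional is bounded without an exceptional set.\<close>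

definition capped_cost :: "real \<Rightarrow> 'a \<Rightarrow> nat \<times> nat \<Rightarrow> real" where
  "capped_cost l \<omega> h = (if Z h \<omega> \<and> cost h \<omega> \<le> l then max 0 (cost h \<omega>) else l)"

definition capped_total :: "real \<Rightarrow> 'a \<Rightarrow> real" where
  "capped_total l \<omega> = connection_cost n (capped_cost l \<omega>)"

lemma cheap_edges_pred: "{\<omega> \<in> space M. Q (cheap_edges l \<omega>)} \<in> events"
  unfolding cheap_edges_def
proof (rule filter_events)
  fix h assume "h \<in> K\<^sub>n"
  hence [measurable]: "Measurable.pred M (Z h)" "cost h \<in> borel_measurable M"
    by (rule Z_pred, rule cost_measurable)
  show "{\<omega> \<in> space M. Z h \<omega> \<and> cost h \<omega> \<le> l} \<in> events" by measurable
qed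

lemma capped_cost_bounds: "0 \<le> l \<Longrightarrow> 0 \<le> capped_cost l \<omega> h" "0 \<le> l \<Longrightarrow> capped_cost l \<omega> h \<le> l"
  by (auto simp: capped_cost_def)

lemma capped_cost_measurable: "h \<in> K\<^sub>n \<Longrightarrow> (\<lambda>\<omega>. capped_cost l \<omega> h) \<in> borel_measurable M"
  unfolding capped_cost_def using Z_pred[of h] cost_measurable[of h] by measurable

lemma capped_total_measurable: "capped_total l \<in> borel_measurable M"
  unfolding capped_total_def[abs_def] by (rule connection_cost_measurable) (rule capped_cost_measurable)

lemma capped_total_bounds:
  fixes l :: real
  assumes "0 \<le> l"
  shows "0 \<le> capped_total l \<omega>" "capped_total l \<omega> \<le> n * l"
  unfolding capped_total_def using n2 capped_cost_bounds assms
  by (auto intro!: connection_cost_nonneg connection_cost_le_star)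

lemma tree_cost_eq_capped_total:
  assumes rule: "largest_component_rule L" and reg: "regular \<omega>" and l: "0 \<le> l"
    and con: "connected_graph {1..n} (cheap_edges l \<omega>)"
  shows "tree_cost L \<omega> = capped_total l \<omega>"
  unfolding tree_cost_eq capped_total_def
proof (rule min_tree_eq_connection_cost[OF rule random_edges_subset, where Gd = "cheap_edges l \<omega>" and l = l])
  show "cheap_edges l \<omega> \<in> connectors n" using con by (auto simp: connectors_def cheap_edges_def)
qed (use n2 l regular_cost[OF reg] in \<open>auto simp: cheap_edges_def random_edges_def capped_cost_def max_def\<close>)

text \<open>The two totals agree almost surely when the cheap edges connect everything, and
  otherwise both lie between 0 and \<open>n * n\<close> up to a null set.\<close>

lemma expectation_diff_le:
  assumes rule: "largest_component_rule L" and l: "0 \<le> l" "l \<le> 1"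
  defines "b \<equiv> prob {\<omega> \<in> space M. \<not> connected_graph {1..n} (cheap_edges l \<omega>)}"
  shows "\<bar>expectation (tree_cost L) - expectation (capped_total l)\<bar> \<le> real n * real n * b"
    and "expectation (\<lambda>\<omega>. (tree_cost L \<omega> - capped_total l \<omega>)\<^sup>2) \<le> (real n * real n)\<^sup>2 * b"
proof -
  let ?A = "{\<omega> \<in> space M. \<not> connected_graph {1..n} (cheap_edges l \<omega>)}"
  have A: "?A \<in> events" using cheap_edges_pred[of "\<lambda>E. \<not> connected_graph {1..n} E"] .
  note [measurable] = tree_cost_measurable[OF rule] capped_total_measurable[of l]
  have ct: "integrable M (capped_total l)"
    by (rule integrable_const_bound[of _ "n * l"]) (use capped_total_bounds[OF l(1)] in auto)
  have nl: "real n * l \<le> real n * real n" using l n2 by (intro mult_left_mono) auto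
  have diff: "AE \<omega> in M. \<bar>tree_cost L \<omega> - capped_total l \<omega>\<bar> \<le> real n * real n * indicator ?A \<omega>"
    using AE_regular AE_space
  proof eventually_elim
    case (elim \<omega>)
    show ?case
      using tree_cost_eq_capped_total[OF rule elim(1) l(1)] tree_cost_bounds(1,2)[OF rule elim(1)]
        capped_total_bounds[OF l(1), of \<omega>] nl elim(2) by (auto simp: indicator_def)
  qed
  have iA: "integrable M (indicator ?A :: 'a \<Rightarrow> real)"
    by (rule integrable_const_bound[of _ 1]) (use A in \<open>auto simp: indicator_def\<close>)
  have i: "integrable M (\<lambda>\<omega>. real n * real n * indicator ?A \<omega>)" using iA by simp
  have "\<bar>expectation (tree_cost L) - expectation (capped_total l)\<bar>
      = \<bar>expectation (\<lambda>\<omega>. tree_cost L \<omega> - capped_total l \<omega>)\<bar>"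
    using ct integrable_tree_cost(1)[OF rule] by simp
  also have "\<dots> \<le> expectation (\<lambda>\<omega>. \<bar>tree_cost L \<omega> - capped_total l \<omega>\<bar>)" by (rule integral_abs_bound)
  also have "\<dots> \<le> expectation (\<lambda>\<omega>. real n * real n * indicator ?A \<omega>)"
    using diff i ct integrable_tree_cost(1)[OF rule] by (intro integral_mono_AE) auto
  also have "\<dots> = real n * real n * b" using A by (simp add: b_def)
  finally show "\<bar>expectation (tree_cost L) - expectation (capped_total l)\<bar> \<le> real n * real n * b" .
  have sq: "AE \<omega> in M. (tree_cost L \<omega> - capped_total l \<omega>)\<^sup>2 \<le> (real n * real n)\<^sup>2 * indicator ?A \<omega>"
    using diff
  proof eventually_elim
    case (elim \<omega>)
    from power_mono[OF this, of 2] show ?case by (auto simp: indicator_def split: if_splits)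
  qed
  have "expectation (\<lambda>\<omega>. (tree_cost L \<omega> - capped_total l \<omega>)\<^sup>2) \<le> expectation (\<lambda>\<omega>. (real n * real n)\<^sup>2 * indicator ?A \<omega>)"
  proof (rule integral_mono_AE[OF _ _ sq])
    show "integrable M (\<lambda>\<omega>. (tree_cost L \<omega> - capped_total l \<omega>)\<^sup>2)"
    proof (rule integrable_const_bound[of _ "(real n * real n)\<^sup>2"])
      show "AE \<omega> in M. norm ((tree_cost L \<omega> - capped_total l \<omega>)\<^sup>2) \<le> (real n * real n)\<^sup>2"
        using sq by eventually_elim (auto simp: indicator_def split: if_splits intro: order.trans)
    qed measurable
  qed (use iA in simp)
  also have "\<dots> = (real n * real n)\<^sup>2 * b" using A by (simp add: b_def)
  finally show "expectation (\<lambda>\<omega>. (tree_cost L \<omega> - capped_total l \<omega>)\<^sup>2) \<le> (real n * real n)\<^sup>2 * b" .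
qed

text \<open>On \<open>Q\<close> the tree spans all vertices and has at least \<open>n / 2\<close>
  edges, of which all but the globally counted cheap ones cost more than \<open>x\<close>. Off
  \<open>Q\<close> the comparison variable is at most 0, so the inequality can be integrated without
  conditioning.\<close>

lemma expectation_tree_cost_ge:
  assumes rule: "largest_component_rule L" and x: "0 < x" and cb: "cheap_bound q x"
    and Q: "\<And>\<omega>. \<omega> \<in> space M \<Longrightarrow> Q \<omega> \<Longrightarrow> connected_graph {1..n} (random_edges n Z \<omega>)"
    and Qm: "{\<omega> \<in> space M. Q \<omega>} \<in> events"
  shows "x * (n / 2 * prob {\<omega> \<in> space M. Q \<omega>} - real n * real n * q) \<le> expectation (tree_cost L)"
proof -
  let ?A = "{\<omega> \<in> space M. Q \<omega>}"
  let ?C = "\<lambda>h. {\<omega> \<in> space M. Z h \<omega> \<and> cost h \<omega> \<le> x}"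
  let ?N = "\<lambda>\<omega>. \<Sum>h\<in>K\<^sub>n. indicator (?C h) \<omega> :: real"
  have C: "?C h \<in> events" if "h \<in> K\<^sub>n" for h
    using Z_pred[OF that] cost_measurable[OF that] by measurable
  have Cq: "prob (?C h) \<le> q" if "h \<in> K\<^sub>n" for h
  proof -
    obtain u v where uv: "h = (u, v)" by (cases h)
    have "edge u v = h" "u \<in> {1..n}" "v \<in> {1..n}" "u \<noteq> v" using that uv by (auto simp: complete_edges_def edge_def)
    thus ?thesis using cb unfolding cheap_bound_def by blast
  qed
  have iC: "integrable M (indicator (?C h) :: 'a \<Rightarrow> real)" if "h \<in> K\<^sub>n" for h
    by (rule integrable_const_bound[of _ 1]) (use C[OF that] in \<open>auto simp: indicator_def\<close>)
  have iQ: "integrable M (indicator ?A :: 'a \<Rightarrow> real)"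
    by (rule integrable_const_bound[of _ 1]) (use Qm in \<open>auto simp: indicator_def\<close>)
  have iN: "integrable M ?N" using iC by (intro Bochner_Integration.integrable_sum)
  have h12: "(1, 2) \<in> K\<^sub>n" using n2 by (auto simp: complete_edges_def)
  have q0: "0 \<le> q" using Cq[OF h12] measure_nonneg order.trans by blast
  have EN: "expectation ?N \<le> real n * real n * q"
  proof -
    have "expectation ?N = (\<Sum>h\<in>K\<^sub>n. prob (?C h))"
      by (subst Bochner_Integration.integral_sum[OF iC]) (auto intro!: sum.cong simp: Collect_conj_eq)
    also have "\<dots> \<le> card K\<^sub>n * q" using Cq sum_mono[of K\<^sub>n "\<lambda>h. prob (?C h)" "\<lambda>_. q"] by simp
    also have "\<dots> \<le> real n * real n * q"
    proof (rule mult_right_mono[OF _ q0])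
      show "real (card K\<^sub>n) \<le> real n * real n" using card_complete_edges_le[of n] by (metis of_nat_le_iff of_nat_mult)
    qed
    finally show ?thesis .
  qed
  have "expectation (\<lambda>\<omega>. x * (n / 2 * indicator ?A \<omega> - ?N \<omega>)) \<le> expectation (tree_cost L)"
  proof (rule integral_mono_AE)
    show "AE \<omega> in M. x * (n / 2 * indicator ?A \<omega> - ?N \<omega>) \<le> tree_cost L \<omega>"
      using AE_regular AE_space
    proof eventually_elim
      case (elim \<omega>)
      have N0: "0 \<le> ?N \<omega>" by (intro sum_nonneg) auto
      show ?case
      proof (cases "Q \<omega>")
        case False
        have "0 \<le> x * ?N \<omega>" using N0 x by simp
        thus ?thesis using False tree_cost_bounds(1)[OF rule elim(1)] by simp
      next
        case True
        have con: "connected_graph {1..n} (random_edges n Z \<omega>)" by (rule Q[OF elim(2) True])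
        have LE: "L n (random_edges n Z \<omega>) = {1..n}"
          by (rule largest_component_connected[OF rule random_edges_subset _ con]) (use n2 in simp)
        obtain T where T: "T \<in> spanning_trees (L n (random_edges n Z \<omega>)) (random_edges n Z \<omega>)"
          "T \<subseteq> K\<^sub>n" "tree_cost L \<omega> = (\<Sum>h\<in>T. cost h \<omega>)" using tree_cost_attained[OF rule] .
        have finT: "finite T" using T(2) finite_subset[of T K\<^sub>n] by simp
        have "T \<in> connectors n" using T(1,2) LE by (auto simp: connectors_def spanning_trees_def is_tree_def)
        from connector_card[OF this n2] have cT: "real n / 2 \<le> card T" by simp
        have "(\<Sum>h\<in>T. indicator (?C h) \<omega>) \<le> ?N \<omega>" using T(2) by (intro sum_mono2) auto
        hence "x * (n / 2 - ?N \<omega>) \<le> x * (real (card T) - (\<Sum>h\<in>T. indicator (?C h) \<omega>))"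
          using x cT by (intro mult_left_mono) auto
        also have "\<dots> = (\<Sum>h\<in>T. x * (1 - indicator (?C h) \<omega>))"
          by (simp add: sum_distrib_left[symmetric] sum_subtractf)
        also have "\<dots> \<le> (\<Sum>h\<in>T. cost h \<omega>)"
        proof (rule sum_mono)
          fix h assume h: "h \<in> T"
          have "Z h \<omega>" using h T(1) by (auto simp: spanning_trees_def random_edges_def)
          moreover have "0 \<le> cost h \<omega>" using regular_cost(1)[OF elim(1), of h] h T(2) by blast
          ultimately show "x * (1 - indicator (?C h) \<omega>) \<le> cost h \<omega>"
            using elim(2) by (auto simp: indicator_def)
        qed
        finally show ?thesis using True elim(2) T(3) by simp
      qed
    qed
  qed (use integrable_tree_cost(1)[OF rule] iN iQ in auto)
  moreover have "expectation (\<lambda>\<omega>. x * (n / 2 * indicator ?A \<omega> - ?N \<omega>)) = x * (n / 2 * prob ?A - expectation ?N)"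
    using iN iQ Qm by simp
  moreover have "x * (n / 2 * prob ?A - real n * real n * q) \<le> x * (n / 2 * prob ?A - expectation ?N)"
    using EN x by (intro mult_left_mono) auto
  ultimately show ?thesis by linarith
qed

text \<open>Costs are at most weights, and the number of present edges from a predecessor to
  \<open>i\<close> with weight at most \<open>y\<close> has mean
  \<open>\<mu> * y powr (1 / \<delta>)\<close>. The tail of the minimum is therefore exponentially
  small; the cruder bound by the reciprocal of that mean is already summable over dyadic levels
  because \<open>1 / \<delta> > 1\<close>.\<close>

lemma expectation_min_capped_le:
  assumes l: "0 \<le> l" "l \<le> 1" and i: "2 \<le> i" "i \<le> n"
  shows "expectation (\<lambda>\<omega>. Min ((\<lambda>j. capped_cost l \<omega> (j, i)) ` {1..<i}))
    \<le> (1 + 1 / (1 - 2 powr (1 - 1 / \<delta>))) * ((real i - 1) * p) powr (- \<delta>)"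
proof -
  define Y where "Y \<omega> = Min ((\<lambda>j. capped_cost l \<omega> (j, i)) ` {1..<i})" for \<omega>
  have K: "(j, i) \<in> K\<^sub>n" if "j \<in> {1..<i}" for j using that i by (auto simp: complete_edges_def)
  have Ym[measurable]: "Y \<in> borel_measurable M"
    unfolding Y_def by (intro borel_measurable_Min capped_cost_measurable K) auto
  have Yle: "Y \<omega> \<le> capped_cost l \<omega> (j, i)" if "j \<in> {1..<i}" for \<omega> j
    unfolding Y_def using that by (intro Min_le) auto
  have Yb: "0 \<le> Y \<omega>" "Y \<omega> \<le> 1" for \<omega>
  proof -
    show "0 \<le> Y \<omega>" unfolding Y_def using i capped_cost_bounds[OF l(1)] by (subst Min_ge_iff) auto
    show "Y \<omega> \<le> 1" using Yle[of 1 \<omega>] capped_cost_bounds(2)[OF l(1), of \<omega> "(1, i)"] l i by simp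
  qed
  define \<mu> where "\<mu> = (real i - 1) * p"
  have mu: "0 < \<mu>" using i p01 by (simp add: \<mu>_def)
  \<comment> \<open>The level at which the mean number of lighter present edges,
    \<open>\<mu> * s powr (1 / \<delta>)\<close>, equals 1.\<close>
  define s where "s = \<mu> powr (- \<delta>)"
  have s: "0 < s" using mu by (simp add: s_def)
  have tail: "prob {\<omega> \<in> space M. y < Y \<omega>} \<le> 1 / (\<mu> * y powr (1 / \<delta>))" if y: "0 < y" for y
  proof (cases "1 \<le> y")
    case True
    hence none: "{\<omega> \<in> space M. y < Y \<omega>} = {}" using Yb by (auto simp: not_less intro: order.trans)
    show ?thesis unfolding none using mu by simp
  next
    case False
    have "prob {\<omega> \<in> space M. y < Y \<omega>} \<le> prob {\<omega> \<in> space M. \<forall>j\<in>{1..<i}. \<not> (Z (j, i) \<omega> \<and> W (j, i) \<omega> \<le> y)}"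
    proof (rule finite_measure_mono_AE)
      show "AE \<omega> in M. \<omega> \<in> {\<omega> \<in> space M. y < Y \<omega>} \<longrightarrow>
          \<omega> \<in> {\<omega> \<in> space M. \<forall>j\<in>{1..<i}. \<not> (Z (j, i) \<omega> \<and> W (j, i) \<omega> \<le> y)}"
        using AE_regular
      proof eventually_elim
        case (elim \<omega>)
        show ?case
        proof (clarsimp)
          fix j assume a: "y < Y \<omega>" "Suc 0 \<le> j" "j < i" "Z (j, i) \<omega>" "W (j, i) \<omega> \<le> y"
          have "cost (j, i) \<omega> \<le> y" using regular_cost(3)[OF elim K[of j]] a by auto
          hence "capped_cost l \<omega> (j, i) \<le> y" using a(4) y by (auto simp: capped_cost_def)
          thus False using Yle[of j \<omega>] a by auto
        qed
      qed
      show "{\<omega> \<in> space M. \<forall>j\<in>{1..<i}. \<not> (Z (j, i) \<omega> \<and> W (j, i) \<omega> \<le> y)} \<in> events"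
        by (rule depends_on_sets[where I = "\<Union>j\<in>{1..<i}. {zi (j, i), wi (j, i)}"],
            intro depends_on_ball depends_on_not depends_on_mono[OF depends_on_weight_edge]) (use K in auto)
    qed
    also have "\<dots> = (\<Prod>j\<in>{1..<i}. prob {\<omega> \<in> space M. \<not> (Z (j, i) \<omega> \<and> W (j, i) \<omega> \<le> y)})"
      by (rule prob_ball_depends_on[where I = "\<lambda>j. {zi (j, i), wi (j, i)}"])
        (use K depends_on_not[OF depends_on_weight_edge] in \<open>auto simp: disjoint_family_on_def\<close>)
    also have "\<dots> \<le> exp (- (p * y powr (1 / \<delta>)) * card {1..<i})"
    proof (rule prod_le_exp)
      fix j assume j: "j \<in> {1..<i}"
      show "prob {\<omega> \<in> space M. \<not> (Z (j, i) \<omega> \<and> W (j, i) \<omega> \<le> y)} \<le> 1 - p * y powr (1 / \<delta>)"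
        using prob_not[OF depends_on_sets[OF depends_on_weight_edge[of "(j, i)" y]]] K[OF j]
          prob_weight_edge[OF K[OF j] y] False by simp
    qed simp
    also have "\<dots> = exp (- (\<mu> * y powr (1 / \<delta>)))" using i by (simp add: \<mu>_def of_nat_diff algebra_simps)
    also have "\<dots> \<le> 1 / (\<mu> * y powr (1 / \<delta>))"
    proof -
      have pos: "0 < \<mu> * y powr (1 / \<delta>)" using mu y by simp
      have "\<mu> * y powr (1 / \<delta>) \<le> exp (\<mu> * y powr (1 / \<delta>))"
        using exp_ge_add_one_self[of "\<mu> * y powr (1 / \<delta>)"] by linarith
      thus ?thesis using pos by (simp add: exp_minus inverse_eq_divide frac_le)
    qed
    finally show ?thesis .
  qed
  have tail_k: "2 ^ k * prob {\<omega> \<in> space M. 2 ^ k * s < Y \<omega>} \<le> (2 powr (1 - 1 / \<delta>)) ^ k" for k :: nat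
  proof -
    have "s powr (1 / \<delta>) = 1 / \<mu>" using delta mu by (simp add: s_def powr_powr powr_neg_one)
    hence "\<mu> * (2 ^ k * s) powr (1 / \<delta>) = (2 ^ k) powr (1 / \<delta>)" using s mu by (simp add: powr_mult)
    hence "2 ^ k * prob {\<omega> \<in> space M. 2 ^ k * s < Y \<omega>} \<le> 2 ^ k * (1 / (2 ^ k) powr (1 / \<delta>))"
      using tail[of "2 ^ k * s"] s by (intro mult_left_mono) auto
    also have "\<dots> = (2 powr (1 - 1 / \<delta>)) ^ k"
      by (simp add: powr_power powr_powr powr_diff[symmetric] algebra_simps flip: powr_realpow)
    finally show ?thesis .
  qed
  \<comment> \<open>Enough dyadic levels to exceed 1, the upper bound of \<open>Y\<close>. Their
    number disappears when the geometric series is summed.\<close>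
  obtain K' :: nat where K': "1 / s < 2 ^ K'" using real_arch_pow[of 2 "1 / s"] by auto
  have iY: "integrable M (indicator {\<omega> \<in> space M. 2 ^ k * s < Y \<omega>} :: 'a \<Rightarrow> real)" for k :: nat
    by (rule integrable_const_bound[of _ 1]) (auto simp: indicator_def)
  have "expectation Y \<le> expectation (\<lambda>\<omega>. s + (\<Sum>k<K'. 2 ^ k * s * indicator {\<omega> \<in> space M. 2 ^ k * s < Y \<omega>} \<omega>))"
  proof (rule integral_mono)
    show "integrable M Y" by (rule integrable_const_bound[of _ 1]) (use Yb in auto)
    show "integrable M (\<lambda>\<omega>. s + (\<Sum>k<K'. 2 ^ k * s * indicator {\<omega> \<in> space M. 2 ^ k * s < Y \<omega>} \<omega>))"
      by (intro Bochner_Integration.integrable_add Bochner_Integration.integrable_sum integrable_mult_right iY) auto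
    fix \<omega> assume w: "\<omega> \<in> space M"
    have "Y \<omega> \<le> 2 ^ K' * s" using K' s Yb(2)[of \<omega>] by (simp add: pos_divide_less_eq)
    from dyadic_layers[OF s this]
    show "Y \<omega> \<le> s + (\<Sum>k<K'. 2 ^ k * s * indicator {\<omega> \<in> space M. 2 ^ k * s < Y \<omega>} \<omega>)"
      using w by (simp add: indicator_def of_bool_def)
  qed
  also have "\<dots> = s + (\<Sum>k<K'. 2 ^ k * s * prob {\<omega> \<in> space M. 2 ^ k * s < Y \<omega>})"
  proof -
    have "expectation (\<lambda>\<omega>. s + (\<Sum>k<K'. 2 ^ k * s * indicator {\<omega> \<in> space M. 2 ^ k * s < Y \<omega>} \<omega>))
        = expectation (\<lambda>\<omega>. s) + expectation (\<lambda>\<omega>. \<Sum>k<K'. 2 ^ k * s * indicator {\<omega> \<in> space M. 2 ^ k * s < Y \<omega>} \<omega>)"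
      by (intro Bochner_Integration.integral_add Bochner_Integration.integrable_sum integrable_mult_right iY) auto
    also have "expectation (\<lambda>\<omega>. \<Sum>k<K'. 2 ^ k * s * indicator {\<omega> \<in> space M. 2 ^ k * s < Y \<omega>} \<omega>)
        = (\<Sum>k<K'. expectation (\<lambda>\<omega>. 2 ^ k * s * indicator {\<omega> \<in> space M. 2 ^ k * s < Y \<omega>} \<omega>))"
      by (intro Bochner_Integration.integral_sum integrable_mult_right iY)
    also have "\<dots> = (\<Sum>k<K'. 2 ^ k * s * prob {\<omega> \<in> space M. 2 ^ k * s < Y \<omega>})"
    proof (rule sum.cong[OF refl])
      fix k
      have "{\<omega> \<in> space M. 2 ^ k * s < Y \<omega>} \<inter> space M = {\<omega> \<in> space M. 2 ^ k * s < Y \<omega>}" by blast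
      thus "expectation (\<lambda>\<omega>. 2 ^ k * s * indicator {\<omega> \<in> space M. 2 ^ k * s < Y \<omega>} \<omega>)
          = 2 ^ k * s * prob {\<omega> \<in> space M. 2 ^ k * s < Y \<omega>}"
        by (simp only: integral_mult_right_zero Bochner_Integration.integral_indicator)
    qed
    finally show ?thesis by (simp add: prob_space)
  qed
  also have "\<dots> = s + s * (\<Sum>k<K'. 2 ^ k * prob {\<omega> \<in> space M. 2 ^ k * s < Y \<omega>})"
    by (simp add: sum_distrib_left mult_ac)
  also have "\<dots> \<le> s + s * (\<Sum>k<K'. (2 powr (1 - 1 / \<delta>)) ^ k)"
    using s by (intro add_left_mono mult_left_mono sum_mono tail_k) auto
  also have "(\<Sum>k<K'. (2 powr (1 - 1 / \<delta>)) ^ k) \<le> 1 / (1 - 2 powr (1 - 1 / \<delta>) :: real)"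
  proof -
    have "(2 :: real) powr (1 - 1 / \<delta>) < 2 powr 0" using delta by (intro powr_less_mono) auto
    hence g: "(\<lambda>k. ((2 :: real) powr (1 - 1 / \<delta>)) ^ k) sums (1 / (1 - 2 powr (1 - 1 / \<delta>)))"
      by (intro geometric_sums) auto
    show ?thesis using sum_le_suminf[OF sums_summable[OF g], of "{..<K'}"] sums_unique[OF g] by simp
  qed
  finally show ?thesis using s unfolding Y_def[symmetric] s_def[symmetric] \<mu>_def[symmetric]
    by (simp add: algebra_simps)
qed

text \<open>Vertex \<open>i\<close> pays about \<open>((real i - 1) * p) powr (- \<delta>)\<close>.
  As \<delta> < 1, the sum has the order of \<open>n\<close> times its last term, so the early
  vertices with few predecessors do no harm.\<close>

lemma expectation_capped_total_le:
  assumes l: "0 \<le> l" "l \<le> 1"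
  shows "expectation (capped_total l) \<le> (1 + 1 / (1 - 2 powr (1 - 1 / \<delta>))) / (1 - \<delta>) * (n / (n * p) powr \<delta>)"
proof -
  let ?Y = "\<lambda>i \<omega>. Min ((\<lambda>j. capped_cost l \<omega> (j, i)) ` {1..<i})"
  let ?C = "1 + 1 / (1 - 2 powr (1 - 1 / \<delta>)) :: real"
  have C0: "0 \<le> ?C"
  proof -
    have "(2 :: real) powr (1 - 1 / \<delta>) < 2 powr 0" using delta by (intro powr_less_mono) auto
    thus ?thesis by simp
  qed
  have Yb: "\<bar>?Y i \<omega>\<bar> \<le> 1" if "2 \<le> i" for i \<omega>
  proof -
    have "0 \<le> ?Y i \<omega>" using that capped_cost_bounds[OF l(1)] by (subst Min_ge_iff) auto
    moreover have "?Y i \<omega> \<le> capped_cost l \<omega> (1, i)" using that by (intro Min_le) auto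
    ultimately show ?thesis using capped_cost_bounds(2)[OF l(1), of \<omega> "(1, i)"] l by simp
  qed
  have Yi: "integrable M (?Y i)" if "i \<in> {2..n}" for i
  proof (rule integrable_const_bound[of _ 1])
    show "?Y i \<in> borel_measurable M"
      by (intro borel_measurable_Min capped_cost_measurable) (use that in \<open>auto simp: complete_edges_def\<close>)
  qed (use Yb that in auto)
  have "expectation (capped_total l) \<le> expectation (\<lambda>\<omega>. \<Sum>i=2..n. ?Y i \<omega>)"
  proof (rule integral_mono)
    show "integrable M (capped_total l)"
      by (rule integrable_const_bound[of _ "n * l"]) (use capped_total_bounds[OF l(1)] capped_total_measurable in auto)
    show "integrable M (\<lambda>\<omega>. \<Sum>i=2..n. ?Y i \<omega>)" using Yi by (intro Bochner_Integration.integrable_sum) auto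
    fix \<omega>
    have "\<exists>j\<in>{1..<i}. ?Y i \<omega> = capped_cost l \<omega> (j, i)" if "2 \<le> i" for i
    proof -
      have "?Y i \<omega> \<in> (\<lambda>j. capped_cost l \<omega> (j, i)) ` {1..<i}" using that by (intro Min_in) auto
      thus ?thesis by blast
    qed
    then obtain par where par: "\<And>i. 2 \<le> i \<Longrightarrow> par i \<in> {1..<i} \<and> ?Y i \<omega> = capped_cost l \<omega> (par i, i)" by metis
    have "capped_total l \<omega> \<le> (\<Sum>i=2..n. capped_cost l \<omega> (par i, i))"
      unfolding capped_total_def by (rule connection_cost_le_recursive) (use par n2 in auto)
    also have "\<dots> = (\<Sum>i=2..n. ?Y i \<omega>)" by (rule sum.cong) (use par in auto)
    finally show "capped_total l \<omega> \<le> (\<Sum>i=2..n. ?Y i \<omega>)" .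
  qed
  also have "\<dots> = (\<Sum>i=2..n. expectation (?Y i))" by (rule Bochner_Integration.integral_sum) (rule Yi)
  also have "\<dots> \<le> (\<Sum>i=2..n. ?C * ((real i - 1) * p) powr (- \<delta>))"
    by (intro sum_mono expectation_min_capped_le[OF l]) auto
  also have "\<dots> = ?C * p powr (- \<delta>) * (\<Sum>i=2..n. (real i - 1) powr (- \<delta>))"
    using p01 unfolding sum_distrib_left by (intro sum.cong refl) (simp add: powr_mult mult_ac)
  also have "(\<Sum>i=2..n. (real i - 1) powr (- \<delta>)) = (\<Sum>j=1..n - 1. real j powr (- \<delta>))"
    by (rule sum.reindex_bij_witness[of _ Suc "\<lambda>i. i - 1"]) (auto simp: of_nat_diff)
  also have "\<dots> \<le> (\<Sum>j=1..n. real j powr (- \<delta>))" by (intro sum_mono2) auto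
  also have "\<dots> \<le> real n powr (1 - \<delta>) / (1 - \<delta>)" by (rule sum_powr_minus_le) (use delta in auto)
  also have "?C * p powr (- \<delta>) * (real n powr (1 - \<delta>) / (1 - \<delta>)) = ?C / (1 - \<delta>) * (n / (n * p) powr \<delta>)"
    using p01 n2 by (simp add: powr_mult powr_diff powr_minus divide_simps)
  finally show ?thesis using C0 p01 by (simp add: mult_left_mono)
qed

end

section \<open>The variance\<close>

context euclidean_mst
begin

text \<open>Product measures need one value type for all coordinates, so the Boolean and the real
  variables are coded as constant vectors of the plane.\<close>

definition encode :: "(nat \<times> nat) + (nat \<times> nat) + nat \<Rightarrow> 'a \<Rightarrow> real ^ 2" where
  "encode i \<omega> = (if i \<in> all_ix then case i of
       Inl h \<Rightarrow> (\<chi> _. if Z h \<omega> then 1 else 0)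
     | Inr (Inl h) \<Rightarrow> (\<chi> _. W h \<omega>)
     | Inr (Inr u) \<Rightarrow> X u \<omega> else 0)"

definition decoded_cost :: "real \<Rightarrow> ((nat \<times> nat) + (nat \<times> nat) + nat \<Rightarrow> real ^ 2) \<Rightarrow> nat \<times> nat \<Rightarrow> real" where
  "decoded_cost l y h = (let c = (dist (y (xi (fst h))) (y (xi (snd h))) / sqrt 2) powr \<alpha> * (y (wi h) $ 1)
     in if y (zi h) $ 1 = 1 \<and> c \<le> l then max 0 c else l)"

text \<open>A presence variable or a weight touches a single edge, a location all edges at its
  vertex. This difference decides how the influences are estimated.\<close>

definition touches :: "(nat \<times> nat) + (nat \<times> nat) + nat \<Rightarrow> nat \<times> nat \<Rightarrow> bool" where
  "touches i h \<longleftrightarrow> i = zi h \<or> i = wi h \<or> i = xi (fst h) \<or> i = xi (snd h)"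

lemma encode_events:
  assumes i: "i \<in> all_ix" and A: "A \<in> sets borel"
  shows "encode i -` A \<inter> space M \<in> var_events i"
proof -
  have m: "(\<lambda>w :: real. (\<chi> _. w) :: real ^ 2) \<in> borel_measurable borel"
    by (intro borel_measurable_continuous_onI continuous_on_vec_lambda continuous_intros)
  consider h where "i = zi h" | h where "i = wi h" | u where "i = xi u"
  proof (cases i)
    case (Inl h)
    thus ?thesis by (rule that(1))
  next
    case (Inr j)
    show ?thesis
    proof (cases j)
      case (Inl h)
      show ?thesis by (rule that(2)[of h]) (simp only: Inl \<open>i = Inr j\<close>)
    next
      case (Inr u)
      show ?thesis by (rule that(3)[of u]) (simp only: Inr \<open>i = Inr j\<close>)
    qed
  qed
  thus ?thesis
  proof cases
    case 1
    have "encode i -` A \<inter> space M = Z h -` {b. ((\<chi> _. if b then 1 else 0) :: real ^ 2) \<in> A} \<inter> space M"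
      using i 1 by (auto simp: encode_def)
    moreover have "{b. ((\<chi> _. if b then 1 else 0) :: real ^ 2) \<in> A} \<in> sets (count_space UNIV)" by simp
    ultimately have "encode i -` A \<inter> space M \<in> events_of M (count_space UNIV) (Z h)"
      unfolding events_of_def by (intro CollectI exI conjI)
    thus ?thesis by (simp add: 1 var_events_def)
  next
    case 2
    have "encode i -` A \<inter> space M = W h -` {w. ((\<chi> _. w) :: real ^ 2) \<in> A} \<inter> space M"
      using i 2 by (auto simp: encode_def)
    moreover have "{w. ((\<chi> _. w) :: real ^ 2) \<in> A} \<in> sets borel"
      using measurable_sets[OF m A] by (simp add: vimage_def)
    ultimately have "encode i -` A \<inter> space M \<in> events_of M borel (W h)"
      unfolding events_of_def by (intro CollectI exI conjI)
    thus ?thesis by (simp add: 2 var_events_def)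
  next
    case 3
    have "encode i -` A \<inter> space M = X u -` A \<inter> space M" using i 3 by (auto simp: encode_def)
    hence "encode i -` A \<inter> space M \<in> events_of M borel (X u)"
      unfolding events_of_def using A by (intro CollectI exI conjI)
    thus ?thesis by (simp add: 3 var_events_def)
  qed
qed

lemma encode_measurable: "encode i \<in> borel_measurable M"
proof (cases "i \<in> all_ix")
  case True
  thus ?thesis using encode_events[OF True] var_events_sets[OF True] by (intro measurableI) auto
next
  case False
  hence "encode i = (\<lambda>_. 0)" by (auto simp: encode_def)
  thus ?thesis by simp
qed

lemma indep_vars_encode: "indep_vars (\<lambda>_. borel) encode all_ix"
  unfolding indep_vars_def2
proof (intro conjI ballI)
  show "indep_sets (\<lambda>i. {encode i -` A \<inter> space M |A. A \<in> sets borel}) all_ix"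
    by (rule indep_sets_mono_sets[OF independent']) (use encode_events in auto)
qed (rule encode_measurable)

lemma decoded_cost_encode:
  "h \<in> K\<^sub>n \<Longrightarrow> decoded_cost l (\<lambda>i\<in>all_ix. encode i \<omega>) h = capped_cost l \<omega> h"
proof -
  assume h: "h \<in> K\<^sub>n"
  obtain u v where uv: "h = (u, v)" by (cases h)
  have "u \<in> {1..n}" "v \<in> {1..n}" using h uv by (auto simp: complete_edges_def)
  thus ?thesis using h unfolding uv
    by (simp add: decoded_cost_def capped_cost_def encode_def cost_def edge_cost_def Let_def)
qed

lemma decoded_cost_measurable:
  assumes "h \<in> K\<^sub>n" "\<And>i. sets (N i) = sets borel"
  shows "(\<lambda>y. decoded_cost l y h) \<in> borel_measurable (PiM all_ix N)"
proof -
  have c: "(\<lambda>y. y i) \<in> borel_measurable (PiM all_ix N)" if "i \<in> all_ix" for i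
    using measurable_component_singleton[OF that, of N] measurable_cong_sets[OF refl assms(2)] by blast
  have fs: "fst h \<in> {1..n}" "snd h \<in> {1..n}" using assms(1) by (auto simp: complete_edges_def)
  have [measurable]: "(\<lambda>y. y (zi h)) \<in> borel_measurable (PiM all_ix N)"
    "(\<lambda>y. y (wi h)) \<in> borel_measurable (PiM all_ix N)"
    "(\<lambda>y. y (xi (fst h))) \<in> borel_measurable (PiM all_ix N)"
    "(\<lambda>y. y (xi (snd h))) \<in> borel_measurable (PiM all_ix N)"
    using c assms(1) fs by auto
  have [measurable]: "(\<lambda>x :: real ^ 2. x $ 1) \<in> borel_measurable borel"
    by (intro borel_measurable_continuous_onI continuous_intros)
  show ?thesis unfolding decoded_cost_def Let_def by measurable
qed

text \<open>Edges that are not cheap have capped cost \<open>l\<close> already, so resetting the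
  touched edges to \<open>l\<close> moves only the cheap ones, each by at most
  \<open>l\<close>.\<close>

lemma touching_deviation:
  fixes l :: real
  assumes l: "0 \<le> l"
  shows "(\<Sum>h\<in>K\<^sub>n. \<bar>capped_cost l \<omega> h - (if touches i h then l else capped_cost l \<omega> h)\<bar>)
    \<le> l * card {h \<in> K\<^sub>n. touches i h \<and> h \<in> cheap_edges l \<omega>}"
proof -
  have "(\<Sum>h\<in>K\<^sub>n. \<bar>capped_cost l \<omega> h - (if touches i h then l else capped_cost l \<omega> h)\<bar>)
      \<le> (\<Sum>h\<in>K\<^sub>n. if touches i h \<and> h \<in> cheap_edges l \<omega> then l else 0)"
  proof (rule sum_mono)
    fix h assume "h \<in> K\<^sub>n"
    thus "\<bar>capped_cost l \<omega> h - (if touches i h then l else capped_cost l \<omega> h)\<bar>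
        \<le> (if touches i h \<and> h \<in> cheap_edges l \<omega> then l else 0)"
      using l by (auto simp: capped_cost_def cheap_edges_def)
  qed
  also have "\<dots> = l * card {h \<in> K\<^sub>n. touches i h \<and> h \<in> cheap_edges l \<omega>}"
    by (subst sum.inter_filter[symmetric]) auto
  finally show ?thesis .
qed

lemma capped_total_variance_le_influences:
  fixes l :: real
  assumes l: "0 \<le> l"
  shows "expectation (\<lambda>\<omega>. (capped_total l \<omega>)\<^sup>2) - (expectation (capped_total l))\<^sup>2
    \<le> (\<Sum>i\<in>all_ix. expectation (\<lambda>\<omega>. (l * card {h \<in> K\<^sub>n. touches i h \<and> h \<in> cheap_edges l \<omega>})\<^sup>2))"
proof -
  define N where "N i = distr M borel (encode i)" for i
  have sN: "sets (N i) = sets borel" for i by (simp add: N_def)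
  have pN: "prob_space (N i)" for i unfolding N_def by (rule prob_space_distr[OF encode_measurable])
  define Y where "Y \<omega> = (\<lambda>i\<in>all_ix. encode i \<omega>)" for \<omega>
  have finI: "finite all_ix" by (simp add: all_ix_def)
  have "xi 1 \<in> all_ix" using n2 by simp
  hence "all_ix \<noteq> {}" by blast
  \<comment> \<open>Independence of the coded variables says exactly that their joint law is a
    product measure, on which the Efron-Stein inequality applies.\<close>
  hence PiM_eq: "distr M (PiM all_ix (\<lambda>_. borel)) Y = PiM all_ix N"
    using indep_vars_iff_distr_eq_PiM'[of all_ix encode "\<lambda>_. borel"] encode_measurable indep_vars_encode
    unfolding Y_def N_def by simp
  have PiM_sets: "sets (PiM all_ix N) = sets (PiM all_ix (\<lambda>_. borel :: (real ^ 2) measure))"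
    by (intro sets_PiM_cong refl sN)
  have Ym: "Y \<in> measurable M (PiM all_ix N)"
    unfolding measurable_cong_sets[OF refl PiM_sets] Y_def using encode_measurable by measurable
  define \<Phi> where "\<Phi> y = connection_cost n (decoded_cost l y)" for y
  \<comment> \<open>Resetting all edges touched by \<open>i\<close> removes the dependence on
    coordinate \<open>i\<close>. With the cap as the new value only cheap edges count, instead of
    all \<open>n - 1\<close> edges at a vertex.\<close>
  define g where "g i y = connection_cost n (\<lambda>h. if touches i h then l else decoded_cost l y h)" for i y
  have Phim: "\<Phi> \<in> borel_measurable (PiM all_ix N)"
    unfolding \<Phi>_def[abs_def] by (rule connection_cost_measurable) (rule decoded_cost_measurable[OF _ sN])
  have gm: "g i \<in> borel_measurable (PiM all_ix N)" for i
    unfolding g_def[abs_def] by (rule connection_cost_measurable) (use decoded_cost_measurable[OF _ sN] in auto)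
  have db: "0 \<le> decoded_cost l y h" "decoded_cost l y h \<le> l" for y h
    using l by (auto simp: decoded_cost_def Let_def)
  have Phib: "\<bar>\<Phi> y\<bar> \<le> n * l" for y
    unfolding \<Phi>_def using connection_cost_nonneg[of n "decoded_cost l y"] connection_cost_le_star[of n "decoded_cost l y" l]
      db l n2 by auto
  have gb: "\<bar>g i y\<bar> \<le> n * l" for i y
    unfolding g_def using connection_cost_nonneg[of n "\<lambda>h. if touches i h then l else decoded_cost l y h"]
      connection_cost_le_star[of n "\<lambda>h. if touches i h then l else decoded_cost l y h" l] db l n2 by auto
  have ginv: "g i (y(i := z)) = g i y" for i y z
    unfolding g_def
  proof (rule connection_cost_cong)
    fix h
    show "(if touches i h then l else decoded_cost l (y(i := z)) h) = (if touches i h then l else decoded_cost l y h)"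
      by (auto simp: touches_def decoded_cost_def)
  qed
  have PhiY: "\<Phi> (Y \<omega>) = capped_total l \<omega>" for \<omega>
    unfolding \<Phi>_def capped_total_def Y_def by (rule connection_cost_cong) (rule decoded_cost_encode)
  have gY: "g i (Y \<omega>) = connection_cost n (\<lambda>h. if touches i h then l else capped_cost l \<omega> h)" for i \<omega>
    unfolding g_def Y_def by (rule connection_cost_cong) (simp add: decoded_cost_encode)
  have int: "(\<integral>y. u y \<partial>PiM all_ix N) = expectation (\<lambda>\<omega>. u (Y \<omega>))"
    if "u \<in> borel_measurable (PiM all_ix N)" for u :: "_ \<Rightarrow> real"
    unfolding PiM_eq[symmetric]
    by (rule integral_distr) (use that Ym measurable_cong_sets[OF refl PiM_sets] measurable_cong_sets[OF PiM_sets refl] in auto)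
  have "(\<integral>y. (\<Phi> y)\<^sup>2 \<partial>PiM all_ix N) - (\<integral>y. \<Phi> y \<partial>PiM all_ix N)\<^sup>2
      \<le> (\<Sum>i\<in>all_ix. \<integral>y. (\<Phi> y - g i y)\<^sup>2 \<partial>PiM all_ix N)"
    by (rule efron_stein[where B = "n * l"]) (use pN finI Phim Phib gm gb ginv in auto)
  also have "(\<Sum>i\<in>all_ix. \<integral>y. (\<Phi> y - g i y)\<^sup>2 \<partial>PiM all_ix N)
      = (\<Sum>i\<in>all_ix. expectation (\<lambda>\<omega>. (capped_total l \<omega> - g i (Y \<omega>))\<^sup>2))"
    using Phim gm by (intro sum.cong refl, subst int) (auto simp: PhiY)
  also have "\<dots> \<le> (\<Sum>i\<in>all_ix. expectation (\<lambda>\<omega>. (l * card {h \<in> K\<^sub>n. touches i h \<and> h \<in> cheap_edges l \<omega>})\<^sup>2))"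
  proof (rule sum_mono, rule integral_mono)
    fix i
    have n1: "1 \<le> n" using n2 by simp
    have cdm: "(\<lambda>\<omega>. real (card {h \<in> K\<^sub>n. touches i h \<and> h \<in> cheap_edges l \<omega>})) \<in> borel_measurable M"
    proof (rule borel_measurableI_le)
      fix a
      show "{\<omega> \<in> space M. real (card {h \<in> K\<^sub>n. touches i h \<and> h \<in> cheap_edges l \<omega>}) \<le> a} \<in> events"
        by (rule cheap_edges_pred)
    qed
    show le: "(capped_total l \<omega> - g i (Y \<omega>))\<^sup>2 \<le> (l * card {h \<in> K\<^sub>n. touches i h \<and> h \<in> cheap_edges l \<omega>})\<^sup>2" for \<omega>
    proof -
      have "\<bar>capped_total l \<omega> - g i (Y \<omega>)\<bar> \<le> l * card {h \<in> K\<^sub>n. touches i h \<and> h \<in> cheap_edges l \<omega>}"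
        unfolding gY capped_total_def
        by (rule order.trans[OF connection_cost_lipschitz[OF n1] touching_deviation[OF l]])
      from power_mono[OF this, of 2] show ?thesis by simp
    qed
    have bd: "(l * card {h \<in> K\<^sub>n. touches i h \<and> h \<in> cheap_edges l \<omega>})\<^sup>2 \<le> (l * card K\<^sub>n)\<^sup>2" for \<omega>
    proof (rule power_mono)
      have "card {h \<in> K\<^sub>n. touches i h \<and> h \<in> cheap_edges l \<omega>} \<le> card K\<^sub>n" by (rule card_mono) auto
      thus "l * card {h \<in> K\<^sub>n. touches i h \<and> h \<in> cheap_edges l \<omega>} \<le> l * card K\<^sub>n"
        using l by (intro mult_left_mono) auto
    qed (use l in simp)
    show "integrable M (\<lambda>\<omega>. (l * card {h \<in> K\<^sub>n. touches i h \<and> h \<in> cheap_edges l \<omega>})\<^sup>2)"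
      by (rule integrable_const_bound[of _ "(l * card K\<^sub>n)\<^sup>2"]) (use bd cdm in \<open>auto intro!: borel_measurable_power borel_measurable_times\<close>)
    have gYm: "(\<lambda>\<omega>. g i (Y \<omega>)) \<in> borel_measurable M" by (rule measurable_compose[OF Ym gm])
    show "integrable M (\<lambda>\<omega>. (capped_total l \<omega> - g i (Y \<omega>))\<^sup>2)"
      by (rule integrable_const_bound[of _ "(l * card K\<^sub>n)\<^sup>2"])
        (use order.trans[OF le bd] gYm capped_total_measurable in \<open>auto intro!: borel_measurable_power borel_measurable_diff\<close>)
  qed
  finally show ?thesis using Phim by (subst (asm) (1 2) int) (auto simp: PhiY)
qed

text \<open>The square of the number of cheap edges at \<open>u\<close> is expanded into pairs: the
  diagonal contributes at most \<open>n * q\<close>, the other pairs \<open>q\<^sup>2\<close> each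
  by the second clause of \<open>cheap_bound\<close>.\<close>

lemma star_second_moment:
  fixes l q :: real
  assumes cb: "cheap_bound q l" and u: "u \<in> {1..n}"
  shows "expectation (\<lambda>\<omega>. (real (card {h \<in> K\<^sub>n. touches (xi u) h \<and> h \<in> cheap_edges l \<omega>}))\<^sup>2)
    \<le> n * q + (n * q)\<^sup>2"
proof -
  let ?V = "{1..n} - {u}"
  let ?P = "\<lambda>v \<omega>. Z (edge u v) \<omega> \<and> cost (edge u v) \<omega> \<le> l"
  have eK: "edge u v \<in> K\<^sub>n" if "v \<in> ?V" for v using that u by (intro edge_in_complete) auto
  have Pm: "{\<omega> \<in> space M. ?P v \<omega>} \<in> events" if "v \<in> ?V" for v
    using Z_pred[OF eK[OF that]] cost_measurable[OF eK[OF that]] by measurable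
  have single: "prob {\<omega> \<in> space M. ?P v \<omega>} \<le> q" if "v \<in> ?V" for v
    using cb that u unfolding cheap_bound_def by auto
  have pair: "prob {\<omega> \<in> space M. ?P v \<omega> \<and> ?P w \<omega>} \<le> q\<^sup>2" if "v \<in> ?V" "w \<in> ?V" "v \<noteq> w" for v w
    using cb that u unfolding cheap_bound_def by auto
  obtain v0 where v0: "v0 \<in> ?V" using n2 u by (cases "u = 1") (auto intro: that[of 1] that[of 2])
  have q0: "0 \<le> q" using single[OF v0] measure_nonneg order.trans by blast
  have card_eq: "real (card {h \<in> K\<^sub>n. touches (xi u) h \<and> h \<in> cheap_edges l \<omega>})
      = (\<Sum>v\<in>?V. indicator {\<omega> \<in> space M. ?P v \<omega>} \<omega>)" if w: "\<omega> \<in> space M" for \<omega>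
  proof -
    have "{h \<in> K\<^sub>n. touches (xi u) h \<and> h \<in> cheap_edges l \<omega>} = edge u ` {v \<in> ?V. ?P v \<omega>}"
    proof (intro set_eqI iffI)
      fix h assume h: "h \<in> {h \<in> K\<^sub>n. touches (xi u) h \<and> h \<in> cheap_edges l \<omega>}"
      define v where "v = (if u = fst h then snd h else fst h)"
      have "h = edge u v" "v \<in> ?V"
        using h by (auto simp: v_def touches_def complete_edges_def edge_def)
      thus "h \<in> edge u ` {v \<in> ?V. ?P v \<omega>}" using h by (auto simp: cheap_edges_def)
    next
      fix h assume "h \<in> edge u ` {v \<in> ?V. ?P v \<omega>}"
      then obtain v where v: "v \<in> ?V" "h = edge u v" "?P v \<omega>" by auto
      have "touches (xi u) h" unfolding v(2) touches_def using edge_cases[of u v] by auto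
      thus "h \<in> {h \<in> K\<^sub>n. touches (xi u) h \<and> h \<in> cheap_edges l \<omega>}"
        using v eK[OF v(1)] by (auto simp: cheap_edges_def)
    qed
    moreover have "inj_on (edge u) {v \<in> ?V. ?P v \<omega>}" by (auto simp: inj_on_def edge_eq_iff)
    ultimately have "card {h \<in> K\<^sub>n. touches (xi u) h \<and> h \<in> cheap_edges l \<omega>} = card {v \<in> ?V. ?P v \<omega>}"
      by (simp add: card_image)
    also have "real \<dots> = (\<Sum>v\<in>?V. if ?P v \<omega> then 1 else 0)"
      by (subst sum.inter_filter[symmetric]) auto
    also have "\<dots> = (\<Sum>v\<in>?V. indicator {\<omega> \<in> space M. ?P v \<omega>} \<omega>)"
      using w by (intro sum.cong) (auto simp: indicator_def)
    finally show ?thesis .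
  qed
  let ?I = "\<lambda>v w \<omega>. indicator ({\<omega> \<in> space M. ?P v \<omega>} \<inter> {\<omega> \<in> space M. ?P w \<omega>}) \<omega> :: real"
  have iI: "integrable M (?I v w)" if "v \<in> ?V" "w \<in> ?V" for v w
    by (rule integrable_const_bound[of _ 1], simp, rule borel_measurable_indicator, rule sets.Int[OF Pm[OF that(1)] Pm[OF that(2)]])
  have "expectation (\<lambda>\<omega>. (real (card {h \<in> K\<^sub>n. touches (xi u) h \<and> h \<in> cheap_edges l \<omega>}))\<^sup>2)
      = expectation (\<lambda>\<omega>. \<Sum>v\<in>?V. \<Sum>w\<in>?V. ?I v w \<omega>)"
  proof (rule Bochner_Integration.integral_cong[OF refl])
    fix \<omega> assume "\<omega> \<in> space M"
    show "(real (card {h \<in> K\<^sub>n. touches (xi u) h \<and> h \<in> cheap_edges l \<omega>}))\<^sup>2 = (\<Sum>v\<in>?V. \<Sum>w\<in>?V. ?I v w \<omega>)"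
      unfolding card_eq[OF \<open>\<omega> \<in> space M\<close>] power2_eq_square sum_product indicator_inter_arith ..
  qed
  also have "\<dots> = (\<Sum>v\<in>?V. \<Sum>w\<in>?V. expectation (?I v w))"
  proof -
    have "expectation (\<lambda>\<omega>. \<Sum>v\<in>?V. \<Sum>w\<in>?V. ?I v w \<omega>) = (\<Sum>v\<in>?V. expectation (\<lambda>\<omega>. \<Sum>w\<in>?V. ?I v w \<omega>))"
      by (rule Bochner_Integration.integral_sum, rule Bochner_Integration.integrable_sum, rule iI)
    also have "\<dots> = (\<Sum>v\<in>?V. \<Sum>w\<in>?V. expectation (?I v w))"
      by (rule sum.cong[OF refl], rule Bochner_Integration.integral_sum, rule iI)
    finally show ?thesis .
  qed
  also have "\<dots> \<le> (\<Sum>v\<in>?V. \<Sum>w\<in>?V. (if v = w then q else 0) + q\<^sup>2)"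
  proof (intro sum_mono)
    fix v w assume vw: "v \<in> ?V" "w \<in> ?V"
    have "expectation (?I v w) = prob {\<omega> \<in> space M. ?P v \<omega> \<and> ?P w \<omega>}"
    proof -
      have "{\<omega> \<in> space M. ?P v \<omega>} \<inter> {\<omega> \<in> space M. ?P w \<omega>} \<inter> space M = {\<omega> \<in> space M. ?P v \<omega> \<and> ?P w \<omega>}" by blast
      thus ?thesis by (simp only: Bochner_Integration.integral_indicator)
    qed
    also have "\<dots> \<le> (if v = w then q else 0) + q\<^sup>2"
    proof (cases "v = w")
      case True
      have "prob {\<omega> \<in> space M. ?P v \<omega> \<and> ?P w \<omega>} \<le> q" using single[OF vw(1)] unfolding True by simp
      thus ?thesis using True by (simp add: add_increasing2)
    next
      case False
      thus ?thesis using pair[OF vw False] by simp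
    qed
    finally show "expectation (?I v w) \<le> (if v = w then q else 0) + q\<^sup>2" .
  qed
  also have "\<dots> = card ?V * q + card ?V * (card ?V * q\<^sup>2)"
    by (simp add: sum.distrib sum.delta distrib_left)
  also have "\<dots> \<le> n * q + n * (n * q\<^sup>2)"
    using q0 u by (intro add_mono mult_mono) auto
  finally show ?thesis by (simp add: power2_eq_square mult_ac)
qed

text \<open>At most \<open>n * n\<close> presence variables and as many weights have influence at
  most \<open>l\<^sup>2 * q\<close> each, in total \<open>2 * n * l\<^sup>2 * (n * q)\<close>. The
  locations add \<open>n\<close> times the second moment at a vertex.\<close>

lemma variance_capped_total_le:
  fixes l q :: real
  assumes l: "0 \<le> l" and cb: "cheap_bound q l"
  shows "expectation (\<lambda>\<omega>. (capped_total l \<omega> - expectation (capped_total l))\<^sup>2) \<le> n * l\<^sup>2 * (3 * (n * q) + (n * q)\<^sup>2)"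
proof -
  let ?N = "\<lambda>i \<omega>. real (card {h \<in> K\<^sub>n. touches i h \<and> h \<in> cheap_edges l \<omega>})"
  have Cq: "prob {\<omega> \<in> space M. Z h \<omega> \<and> cost h \<omega> \<le> l} \<le> q" if "h \<in> K\<^sub>n" for h
  proof -
    obtain u v where uv: "h = (u, v)" by (cases h)
    have "edge u v = h" "u \<in> {1..n}" "v \<in> {1..n}" "u \<noteq> v" using that uv by (auto simp: complete_edges_def edge_def)
    thus ?thesis using cb unfolding cheap_bound_def by blast
  qed
  have "(1, 2) \<in> K\<^sub>n" using n2 by (auto simp: complete_edges_def)
  hence q0: "0 \<le> q" using Cq[of "(1, 2)"] measure_nonneg order.trans by blast
  have one: "expectation (\<lambda>\<omega>. (?N i \<omega>)\<^sup>2) \<le> q" if i: "i = zi h \<or> i = wi h" and h: "h \<in> K\<^sub>n" for i h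
  proof -
    have "expectation (\<lambda>\<omega>. (?N i \<omega>)\<^sup>2) = expectation (indicator {\<omega> \<in> space M. Z h \<omega> \<and> cost h \<omega> \<le> l})"
    proof (rule Bochner_Integration.integral_cong[OF refl])
      fix \<omega> assume w: "\<omega> \<in> space M"
      have "{h' \<in> K\<^sub>n. touches i h' \<and> h' \<in> cheap_edges l \<omega>} = (if Z h \<omega> \<and> cost h \<omega> \<le> l then {h} else {})"
        using i h by (auto simp: touches_def cheap_edges_def)
      thus "(?N i \<omega>)\<^sup>2 = indicator {\<omega> \<in> space M. Z h \<omega> \<and> cost h \<omega> \<le> l} \<omega>" using w by simp
    qed
    also have "\<dots> = prob ({\<omega> \<in> space M. Z h \<omega> \<and> cost h \<omega> \<le> l} \<inter> space M)" by (rule Bochner_Integration.integral_indicator)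
    also have "{\<omega> \<in> space M. Z h \<omega> \<and> cost h \<omega> \<le> l} \<inter> space M = {\<omega> \<in> space M. Z h \<omega> \<and> cost h \<omega> \<le> l}" by blast
    finally show ?thesis using Cq[OF h] by simp
  qed
  have infl: "expectation (\<lambda>\<omega>. (l * ?N i \<omega>)\<^sup>2) = l\<^sup>2 * expectation (\<lambda>\<omega>. (?N i \<omega>)\<^sup>2)" for i
    by (simp add: power_mult_distrib)
  have ct: "integrable M (capped_total l)" "integrable M (\<lambda>\<omega>. (capped_total l \<omega>)\<^sup>2)"
  proof -
    show "integrable M (capped_total l)"
      by (rule integrable_const_bound[of _ "n * l"]) (use capped_total_bounds[OF l] capped_total_measurable in auto)
    show "integrable M (\<lambda>\<omega>. (capped_total l \<omega>)\<^sup>2)"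
      by (rule integrable_const_bound[of _ "(n * l)\<^sup>2"])
        (use capped_total_bounds[OF l] capped_total_measurable in \<open>auto intro!: power_mono borel_measurable_power\<close>)
  qed
  have "expectation (\<lambda>\<omega>. (capped_total l \<omega> - expectation (capped_total l))\<^sup>2)
      = expectation (\<lambda>\<omega>. (capped_total l \<omega>)\<^sup>2) - (expectation (capped_total l))\<^sup>2"
    by (rule variance_eq[OF ct])
  also have "\<dots> \<le> (\<Sum>i\<in>all_ix. l\<^sup>2 * expectation (\<lambda>\<omega>. (?N i \<omega>)\<^sup>2))"
    using capped_total_variance_le_influences[OF l] unfolding infl .
  also have "\<dots> = (\<Sum>h\<in>K\<^sub>n. l\<^sup>2 * expectation (\<lambda>\<omega>. (?N (zi h) \<omega>)\<^sup>2))
      + ((\<Sum>h\<in>K\<^sub>n. l\<^sup>2 * expectation (\<lambda>\<omega>. (?N (wi h) \<omega>)\<^sup>2))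
      + (\<Sum>u\<in>{1..n}. l\<^sup>2 * expectation (\<lambda>\<omega>. (?N (xi u) \<omega>)\<^sup>2)))"
    unfolding all_ix_def by (simp add: sum.Plus)
  also have "\<dots> \<le> (\<Sum>h\<in>K\<^sub>n. l\<^sup>2 * q) + ((\<Sum>h\<in>K\<^sub>n. l\<^sup>2 * q) + (\<Sum>u\<in>{1..n}. l\<^sup>2 * (n * q + (n * q)\<^sup>2)))"
    by (intro add_mono sum_mono mult_left_mono one star_second_moment[OF cb]) auto
  also have "\<dots> = 2 * card K\<^sub>n * (l\<^sup>2 * q) + n * (l\<^sup>2 * (n * q + (n * q)\<^sup>2))" by simp
  also have "\<dots> \<le> 2 * (real n * real n) * (l\<^sup>2 * q) + n * (l\<^sup>2 * (n * q + (n * q)\<^sup>2))"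
  proof -
    have "real (card K\<^sub>n) \<le> real n * real n" using card_complete_edges_le[of n] by (metis of_nat_le_iff of_nat_mult)
    thus ?thesis using q0 by (intro add_right_mono mult_right_mono mult_left_mono) auto
  qed
  also have "\<dots> = n * l\<^sup>2 * (3 * (n * q) + (n * q)\<^sup>2)" by (simp add: algebra_simps)
  finally show ?thesis .
qed

text \<open>The tree cost is centred at the mean of the capped total, which can only increase the
  mean square deviation; the square of the sum of the two deviations accounts for the factors
  2.\<close>

lemma variance_tree_cost_le:
  fixes l q :: real
  assumes rule: "largest_component_rule L" and l: "0 \<le> l" "l \<le> 1" and cb: "cheap_bound q l"
  shows "expectation (\<lambda>\<omega>. (tree_cost L \<omega> - expectation (tree_cost L))\<^sup>2)
    \<le> 2 * (n * l\<^sup>2 * (3 * (n * q) + (n * q)\<^sup>2))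
      + 2 * ((real n * real n)\<^sup>2 * prob {\<omega> \<in> space M. \<not> connected_graph {1..n} (cheap_edges l \<omega>)})"
proof -
  let ?m = "expectation (capped_total l)"
  note [measurable] = tree_cost_measurable[OF rule] capped_total_measurable[of l]
  have t1: "integrable M (tree_cost L)" and t2: "integrable M (\<lambda>\<omega>. (tree_cost L \<omega> - c)\<^sup>2)" for c
    using integrable_tree_cost[OF rule] by auto
  have c2: "integrable M (\<lambda>\<omega>. (capped_total l \<omega> - c)\<^sup>2)" for c
  proof (rule integrable_const_bound[of _ "(n * l + \<bar>c\<bar>)\<^sup>2"])
    have "(capped_total l \<omega> - c)\<^sup>2 \<le> (n * l + \<bar>c\<bar>)\<^sup>2" for \<omega>
    proof -
      have "\<bar>capped_total l \<omega> - c\<bar> \<le> n * l + \<bar>c\<bar>" using capped_total_bounds[OF l(1), of \<omega>] by linarith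
      from power_mono[OF this, of 2] show ?thesis by simp
    qed
    thus "AE \<omega> in M. norm ((capped_total l \<omega> - c)\<^sup>2) \<le> (n * l + \<bar>c\<bar>)\<^sup>2" by simp
  qed measurable
  have d2: "integrable M (\<lambda>\<omega>. (tree_cost L \<omega> - capped_total l \<omega>)\<^sup>2)"
  proof (rule Bochner_Integration.integrable_bound)
    show "integrable M (\<lambda>\<omega>. 2 * (tree_cost L \<omega> - 0)\<^sup>2 + 2 * (capped_total l \<omega> - 0)\<^sup>2)"
      using t2[of 0] c2[of 0] by simp
    have "(tree_cost L \<omega> - capped_total l \<omega>)\<^sup>2 \<le> 2 * (tree_cost L \<omega> - 0)\<^sup>2 + 2 * (capped_total l \<omega> - 0)\<^sup>2" for \<omega>
      using zero_le_power2[of "tree_cost L \<omega> + capped_total l \<omega>"] by (simp add: power2_diff power2_sum)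
    thus "AE \<omega> in M. norm ((tree_cost L \<omega> - capped_total l \<omega>)\<^sup>2) \<le> norm (2 * (tree_cost L \<omega> - 0)\<^sup>2 + 2 * (capped_total l \<omega> - 0)\<^sup>2)"
      by simp
  qed measurable
  have "expectation (\<lambda>\<omega>. (tree_cost L \<omega> - expectation (tree_cost L))\<^sup>2) \<le> expectation (\<lambda>\<omega>. (tree_cost L \<omega> - ?m)\<^sup>2)"
  proof -
    have t2': "integrable M (\<lambda>\<omega>. (tree_cost L \<omega>)\<^sup>2)" using t2[of 0] by simp
    have "expectation (\<lambda>\<omega>. (tree_cost L \<omega> - ?m)\<^sup>2)
        = expectation (\<lambda>\<omega>. (tree_cost L \<omega>)\<^sup>2 - 2 * ?m * tree_cost L \<omega> + ?m\<^sup>2)"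
      by (simp add: power2_diff algebra_simps)
    also have "\<dots> = expectation (\<lambda>\<omega>. (tree_cost L \<omega>)\<^sup>2) - 2 * ?m * expectation (tree_cost L) + ?m\<^sup>2"
      using t1 t2' by (simp add: prob_space)
    finally show ?thesis
      using variance_eq[OF t1 t2'] zero_le_power2[of "expectation (tree_cost L) - ?m"]
      by (simp add: power2_diff algebra_simps)
  qed
  also have "\<dots> \<le> expectation (\<lambda>\<omega>. 2 * (capped_total l \<omega> - ?m)\<^sup>2 + 2 * (tree_cost L \<omega> - capped_total l \<omega>)\<^sup>2)"
  proof (rule integral_mono[OF t2])
    show "integrable M (\<lambda>\<omega>. 2 * (capped_total l \<omega> - ?m)\<^sup>2 + 2 * (tree_cost L \<omega> - capped_total l \<omega>)\<^sup>2)"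
      using c2 d2 by simp
    show "(tree_cost L \<omega> - ?m)\<^sup>2 \<le> 2 * (capped_total l \<omega> - ?m)\<^sup>2 + 2 * (tree_cost L \<omega> - capped_total l \<omega>)\<^sup>2" for \<omega>
    proof -
      have "(a + b)\<^sup>2 \<le> 2 * a\<^sup>2 + 2 * b\<^sup>2" for a b :: real
        using zero_le_power2[of "a - b"] by (simp add: power2_diff power2_sum)
      from this[of "capped_total l \<omega> - ?m" "tree_cost L \<omega> - capped_total l \<omega>"] show ?thesis by simp
    qed
  qed
  also have "\<dots> = 2 * expectation (\<lambda>\<omega>. (capped_total l \<omega> - ?m)\<^sup>2)
      + 2 * expectation (\<lambda>\<omega>. (tree_cost L \<omega> - capped_total l \<omega>)\<^sup>2)"
    using c2 d2 by simp
  finally show ?thesis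
    using variance_capped_total_le[OF l(1) cb] expectation_diff_le(2)[OF rule l] by linarith
qed

end

section \<open>Asymptotics\<close>

text \<open>Linearises the binomial expression that the union bound over cuts produces.\<close>

lemma power_one_plus_le:
  fixes y :: real
  assumes "0 \<le> y" "n * y \<le> 1"
  shows "(1 + y) ^ n - 1 \<le> 2 * (n * y)"
proof -
  have "(1 + y) ^ n \<le> exp y ^ n" using assms by (intro power_mono exp_ge_add_one_self) auto
  also have "\<dots> = exp (n * y)" by (simp add: exp_of_nat_mult)
  also have "\<dots> \<le> 1 + n * y + (n * y)\<^sup>2" using assms by (intro exp_bound) auto
  also have "(n * y)\<^sup>2 \<le> n * y" using assms by (simp add: power2_eq_square mult_left_le)
  finally show ?thesis by (simp add: mult.commute)
qed

lemma cell_neighbours_dist: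
  assumes m: "0 < m" and nb: "cell m y \<in> neighbours (cell m x)"
  shows "dist x y / sqrt 2 \<le> 2 / real m"
proof -
  have "\<bar>x $ i - y $ i\<bar> \<le> 2 / real m" if "i = 1 \<or> i = 2" for i :: 2
  proof -
    have "\<lfloor>real m * y $ i\<rfloor> \<in> {\<lfloor>real m * x $ i\<rfloor> - 1..\<lfloor>real m * x $ i\<rfloor> + 1}"
      using nb that by (auto simp: cell_def neighbours_def)
    hence "\<bar>real m * x $ i - real m * y $ i\<bar> \<le> 2" by auto linarith
    hence "real m * \<bar>x $ i - y $ i\<bar> \<le> 2" by (simp add: abs_mult flip: right_diff_distrib)
    thus ?thesis using m by (simp add: field_simps)
  qed
  hence "(x $ i - y $ i)\<^sup>2 \<le> (2 / real m)\<^sup>2" if "i = 1 \<or> i = 2" for i :: 2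
    using power_mono[of "\<bar>x $ i - y $ i\<bar>" "2 / real m" 2] that by simp
  from this[of 1] this[of 2]
  have sq: "(x $ 1 - y $ 1)\<^sup>2 + (x $ 2 - y $ 2)\<^sup>2 \<le> 2 * (2 / real m)\<^sup>2" by simp
  have "dist x y \<le> sqrt (2 * (2 / real m)\<^sup>2)"
    using sq by (simp add: dist_norm norm_vec_def L2_set_def UNIV_2)
  also have "sqrt (2 * (2 / real m)\<^sup>2) = sqrt 2 * (2 / real m)"
    unfolding real_sqrt_mult by simp
  finally show ?thesis by (simp add: pos_divide_le_eq mult.commute)
qed

text \<open>The finitely many exceptional indices are absorbed by the minimum of the positive ratios
  \<open>E n / A n\<close>. Thus the bounds on the mean can be claimed for every \<open>n\<close>
  from 2 on.\<close>

lemma eventually_bound_imp_uniform: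
  fixes A E :: "nat \<Rightarrow> real"
  assumes ev: "\<forall>\<^sub>F n in sequentially. D * A n \<le> E n" and D: "0 < D"
    and pos: "\<And>n. n \<ge> 2 \<Longrightarrow> 0 < A n" "\<And>n. n \<ge> 2 \<Longrightarrow> 0 < E n"
  shows "\<exists>d>0. \<forall>n\<ge>2. d * A n \<le> E n"
proof -
  obtain n0 where n0: "\<And>n. n \<ge> n0 \<Longrightarrow> D * A n \<le> E n" using ev by (auto simp: eventually_sequentially)
  let ?S = "insert D ((\<lambda>n. E n / A n) ` {2..<n0})"
  have fin: "finite ?S" by simp
  show ?thesis
  proof (intro exI conjI allI impI)
    show "0 < Min ?S" using D pos by (subst Min_gr_iff[OF fin]) auto
    fix n :: nat assume n: "2 \<le> n"
    show "Min ?S * A n \<le> E n"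
    proof (cases "n < n0")
      case True
      have "Min ?S \<le> E n / A n" by (rule Min_le[OF fin]) (use n True in auto)
      thus ?thesis using pos(1)[OF n] by (simp add: pos_le_divide_eq)
    next
      case False
      have "Min ?S * A n \<le> D * A n" by (intro mult_right_mono Min_le[OF fin]) (use pos(1)[OF n] in auto)
      thus ?thesis using n0[of n] False by simp
    qed
  qed
qed

section \<open>Estimates at fixed size for connectivity and concentration\<close>

context euclidean_mst
begin

lemma prob_cheap_disconnected_le:
  assumes E: "\<And>h. h \<in> K\<^sub>n \<Longrightarrow> {\<omega> \<in> space M. E h \<omega>} \<in> events"
    and imp: "\<And>h \<omega>. h \<in> K\<^sub>n \<Longrightarrow> regular \<omega> \<Longrightarrow> E h \<omega> \<Longrightarrow> Z h \<omega> \<and> cost h \<omega> \<le> l"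
  shows "prob {\<omega> \<in> space M. \<not> connected_graph {1..n} (cheap_edges l \<omega>)}
    \<le> prob {\<omega> \<in> space M. \<not> connected_graph {1..n} {h \<in> K\<^sub>n. E h \<omega>}}"
proof (rule finite_measure_mono_AE)
  show "AE \<omega> in M. \<omega> \<in> {\<omega> \<in> space M. \<not> connected_graph {1..n} (cheap_edges l \<omega>)} \<longrightarrow>
      \<omega> \<in> {\<omega> \<in> space M. \<not> connected_graph {1..n} {h \<in> K\<^sub>n. E h \<omega>}}"
    using AE_regular
  proof eventually_elim
    case (elim \<omega>)
    have "{h \<in> K\<^sub>n. E h \<omega>} \<subseteq> cheap_edges l \<omega>" using imp elim by (auto simp: cheap_edges_def)
    thus ?case using connected_graph_mono by blast
  qed
qed (rule filter_events[OF E])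

lemma prob_cheap_disconnected_weights:
  assumes x: "0 < x" "x \<le> 1"
  shows "prob {\<omega> \<in> space M. \<not> connected_graph {1..n} (cheap_edges x \<omega>)}
    \<le> (1 + exp (- (p * x powr (1 / \<delta>)) * n / 2)) ^ n - 1"
proof -
  have "prob {\<omega> \<in> space M. \<not> connected_graph {1..n} (cheap_edges x \<omega>)}
      \<le> prob {\<omega> \<in> space M. \<not> connected_graph {1..n} {h \<in> K\<^sub>n. Z h \<omega> \<and> W h \<omega> \<le> x}}"
  proof (rule prob_cheap_disconnected_le)
    fix h assume "h \<in> K\<^sub>n"
    thus "{\<omega> \<in> space M. Z h \<omega> \<and> W h \<omega> \<le> x} \<in> events"
      by (intro depends_on_sets[OF depends_on_weight_edge]) auto
  next
    fix h \<omega> assume "h \<in> K\<^sub>n" "regular \<omega>" "Z h \<omega> \<and> W h \<omega> \<le> x"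
    thus "Z h \<omega> \<and> cost h \<omega> \<le> x" using regular_cost(3)[of \<omega> h] by auto
  qed
  also note prob_weight_disconnected[OF x]
  finally show ?thesis .
qed

lemma prob_cheap_disconnected_grid:
  assumes m: "0 < m" and l: "(2 / real m) powr \<alpha> \<le> l"
  shows "prob {\<omega> \<in> space M. \<not> connected_graph {1..n} (cheap_edges l \<omega>)}
    \<le> n * exp (- (p * (\<epsilon>1 / (real m)\<^sup>2)) * (n - 1)) + exp (- (n * (\<epsilon>1 / (real m)\<^sup>2) / 4))
      + ((1 + exp (- p * (n * (\<epsilon>1 / (real m)\<^sup>2) / 4) / 2)) ^ n - 1)"
proof -
  have "prob {\<omega> \<in> space M. \<not> connected_graph {1..n} (cheap_edges l \<omega>)}
      \<le> prob {\<omega> \<in> space M. \<not> connected_graph {1..n}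
          {h \<in> K\<^sub>n. Z h \<omega> \<and> cell m (X (snd h) \<omega>) \<in> neighbours (cell m (X (fst h) \<omega>))}}"
  proof (rule prob_cheap_disconnected_le)
    fix h assume h: "h \<in> K\<^sub>n"
    have fs: "fst h \<in> {1..n}" "snd h \<in> {1..n}" using h by (auto simp: complete_edges_def)
    have c: "(\<lambda>\<omega>. cell m (X u \<omega>)) \<in> measurable M (count_space UNIV)" if "u \<in> {1..n}" for u
    proof (subst measurable_count_space_eq_countable)
      show "(\<lambda>\<omega>. cell m (X u \<omega>)) \<in> space M \<rightarrow> UNIV \<and> (\<forall>a\<in>UNIV. (\<lambda>\<omega>. cell m (X u \<omega>)) -` {a} \<inter> space M \<in> events)"
      proof (intro conjI ballI)
        fix a
        have "(\<lambda>\<omega>. cell m (X u \<omega>)) -` {a} \<inter> space M = {\<omega> \<in> space M. cell m (X u \<omega>) \<in> {a}}" by auto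
        also have "\<dots> \<in> events" by (rule depends_on_sets[OF depends_on_cell]) (use that in simp)
        finally show "(\<lambda>\<omega>. cell m (X u \<omega>)) -` {a} \<inter> space M \<in> events" .
      qed simp
    qed auto
    have [measurable]: "Measurable.pred M (Z h)" by (rule Z_pred[OF h])
    note [measurable] = c[OF fs(1)] c[OF fs(2)]
    show "{\<omega> \<in> space M. Z h \<omega> \<and> cell m (X (snd h) \<omega>) \<in> neighbours (cell m (X (fst h) \<omega>))} \<in> events"
      by measurable
  next
    fix h \<omega> assume h: "h \<in> K\<^sub>n" and reg: "regular \<omega>"
      and E: "Z h \<omega> \<and> cell m (X (snd h) \<omega>) \<in> neighbours (cell m (X (fst h) \<omega>))"
    have W: "0 < W h \<omega>" "W h \<omega> \<le> 1" using reg h by (auto simp: regular_def)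
    have "(dist (X (fst h) \<omega>) (X (snd h) \<omega>) / sqrt 2) powr \<alpha> \<le> (2 / real m) powr \<alpha>"
      using cell_neighbours_dist[OF m] E alpha by (intro powr_mono2) auto
    hence "(dist (X (fst h) \<omega>) (X (snd h) \<omega>) / sqrt 2) powr \<alpha> * W h \<omega> \<le> (2 / real m) powr \<alpha> * 1"
      using W by (intro mult_mono) auto
    hence "cost h \<omega> \<le> l" using l by (simp add: cost_def edge_cost_def case_prod_beta)
    thus "Z h \<omega> \<and> cost h \<omega> \<le> l" using E by simp
  qed
  also note prob_grid_disconnected[OF m]
  finally show ?thesis .
qed

lemma connected_random_edges_prob:
  assumes b: "prob {\<omega> \<in> space M. \<not> connected_graph {1..n} (cheap_edges l \<omega>)} \<le> b"
  shows "1 - b \<le> prob {\<omega> \<in> space M. connected_graph {1..n} (random_edges n Z \<omega>)}"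
proof -
  have "1 - b \<le> prob {\<omega> \<in> space M. \<not> \<not> connected_graph {1..n} (cheap_edges l \<omega>)}"
    using b prob_not[OF cheap_edges_pred, of "\<lambda>E. \<not> connected_graph {1..n} E"] by simp
  also have "\<dots> \<le> prob {\<omega> \<in> space M. connected_graph {1..n} (random_edges n Z \<omega>)}"
  proof (rule finite_measure_mono)
    show "{\<omega> \<in> space M. \<not> \<not> connected_graph {1..n} (cheap_edges l \<omega>)}
        \<subseteq> {\<omega> \<in> space M. connected_graph {1..n} (random_edges n Z \<omega>)}"
    proof clarsimp
      fix \<omega> assume "connected_graph {Suc 0..n} (cheap_edges l \<omega>)"
      thus "connected_graph {Suc 0..n} (random_edges n Z \<omega>)"
        by (rule connected_graph_mono) (auto simp: cheap_edges_def random_edges_def)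
    qed
  qed (rule random_edges_pred)
  finally show ?thesis .
qed

text \<open>Chebyshev's inequality for a deviation of half the mean, whence the factor 4. Outside
  that event the cost lies between half the mean and twice the mean.\<close>

lemma prob_tree_cost_window:
  assumes rule: "largest_component_rule L"
    and b: "prob {\<omega> \<in> space M. \<not> connected_graph {1..n} (cheap_edges l \<omega>)} \<le> b"
    and lo: "lo \<le> expectation (tree_cost L) / 2" and hi: "2 * expectation (tree_cost L) \<le> hi"
  shows "1 - b - 4 * (expectation (\<lambda>\<omega>. (tree_cost L \<omega> - expectation (tree_cost L))\<^sup>2) / (expectation (tree_cost L))\<^sup>2)
    \<le> prob {\<omega> \<in> space M. connected_graph {1..n} (random_edges n Z \<omega>) \<and> lo \<le> tree_cost L \<omega> \<and> tree_cost L \<omega> \<le> hi}"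
proof -
  let ?m = "expectation (tree_cost L)"
  let ?A = "{\<omega> \<in> space M. connected_graph {1..n} (random_edges n Z \<omega>)}"
  let ?B = "{\<omega> \<in> space M. ?m / 2 \<le> \<bar>tree_cost L \<omega> - ?m\<bar>}"
  let ?G = "{\<omega> \<in> space M. connected_graph {1..n} (random_edges n Z \<omega>) \<and> lo \<le> tree_cost L \<omega> \<and> tree_cost L \<omega> \<le> hi}"
  note [measurable] = tree_cost_measurable[OF rule]
  have m: "0 < ?m" by (rule expectation_tree_cost_pos[OF rule])
  have "prob ?B \<le> expectation (\<lambda>\<omega>. (tree_cost L \<omega> - ?m)\<^sup>2) / (?m / 2)\<^sup>2"
    by (rule Chebyshev_inequality) (use m integrable_tree_cost(2)[OF rule, of 0] in auto)
  hence B: "prob ?B \<le> 4 * (expectation (\<lambda>\<omega>. (tree_cost L \<omega> - ?m)\<^sup>2) / ?m\<^sup>2)"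
    by (simp add: power_divide mult.commute)
  have "{\<omega> \<in> space M. lo \<le> tree_cost L \<omega> \<and> tree_cost L \<omega> \<le> hi} \<in> events" by measurable
  moreover have "?G = ?A \<inter> {\<omega> \<in> space M. lo \<le> tree_cost L \<omega> \<and> tree_cost L \<omega> \<le> hi}" by blast
  ultimately have G: "?G \<in> events" using sets.Int[OF random_edges_pred[of "connected_graph {1..n}"]] by simp
  have Bm: "?B \<in> events" by measurable
  have "?A \<subseteq> ?G \<union> ?B"
  proof
    fix \<omega> assume w: "\<omega> \<in> ?A"
    show "\<omega> \<in> ?G \<union> ?B"
    proof (cases "\<omega> \<in> ?B")
      case False
      hence "\<bar>tree_cost L \<omega> - ?m\<bar> < ?m / 2" using w by auto
      hence "?m / 2 \<le> tree_cost L \<omega>" "tree_cost L \<omega> \<le> 2 * ?m" using m by (auto simp: abs_if field_simps split: if_splits)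
      thus ?thesis using w lo hi by auto
    qed simp
  qed
  hence "prob ?A \<le> prob (?G \<union> ?B)" using G Bm by (intro finite_measure_mono) auto
  also have "\<dots> \<le> prob ?G + prob ?B" using G Bm by (intro measure_Un_le)
  finally show ?thesis using connected_random_edges_prob[OF b] B by linarith
qed

end

text \<open>The purely analytic part, in which \<open>real n powr (1 - \<beta>)\<close> stands for n
  p. The exponent of \<open>b\<close> is chosen such that n^4 times \<open>b\<close>, divided by the
  square of the lower bound on the mean, is still of order 1 / n.\<close>

lemma asymptotic_core:
  fixes E V b :: "nat \<Rightarrow> real" and \<gamma> \<beta> C0 C1 :: real
  assumes g: "0 < \<gamma>" and C: "0 < C0" "0 < C1" and beta: "0 < \<beta>" "\<beta> < 1"
    and b: "\<forall>\<^sub>F n in sequentially. b n \<le> real n powr (- (3 + 2 * \<gamma>))"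
    and lower: "\<And>n x. n \<ge> 2 \<Longrightarrow> 0 < x \<Longrightarrow>
        x * (n / 2 * (1 - b n) - n * (C1 * real n powr (1 - \<beta>) * x powr (1 / \<gamma>))) \<le> E n"
    and V0: "\<And>n. 0 \<le> V n"
    and var: "\<forall>\<^sub>F n in sequentially. V n \<le>
        2 * (n * ((C0 * ln n / real n powr (1 - \<beta>)) powr \<gamma>)\<^sup>2 * (3 * (C1 * C0 * ln n) + (C1 * C0 * ln n)\<^sup>2))
        + 2 * ((real n * real n)\<^sup>2 * b n)"
  shows "\<exists>D>0. \<forall>\<^sub>F n in sequentially. D * (n / (real n powr (1 - \<beta>)) powr \<gamma>) \<le> E n"
    and "(\<lambda>n. V n / (E n)\<^sup>2) \<longlonglongrightarrow> 0"
proof -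
  \<comment> \<open>With \<open>x = (c / real n powr (1 - \<beta>)) powr \<gamma>\<close> the bound
    on the mean number of cheap edges is n / 8. Once \<open>b n\<close> is below 1 / 2 the tree
    contributes n / 4, and the difference n / 8 gives the 8 in \<open>D\<close>.\<close>
  define c where "c = 1 / (8 * C1)"
  have c: "0 < c" using C by (simp add: c_def)
  define D where "D = c powr \<gamma> / 8"
  have D: "0 < D" using c by (simp add: D_def)
  have "(\<lambda>n. real n powr (- (3 + 2 * \<gamma>))) \<longlonglongrightarrow> 0" using g by real_asymp
  hence "\<forall>\<^sub>F n in sequentially. real n powr (- (3 + 2 * \<gamma>)) < 1 / 2" by (rule order_tendstoD) simp
  hence low: "\<forall>\<^sub>F n in sequentially. D * (n / (real n powr (1 - \<beta>)) powr \<gamma>) \<le> E n"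
    using b eventually_ge_at_top[of 2]
  proof eventually_elim
    case (elim n)
    let ?N = "real n powr (1 - \<beta>)"
    have N: "0 < ?N" using elim by simp
    define x where "x = (c / ?N) powr \<gamma>"
    have x: "0 < x" using c N by (simp add: x_def)
    have "x powr (1 / \<gamma>) = c / ?N" using c N g by (simp add: x_def powr_powr)
    hence "C1 * ?N * x powr (1 / \<gamma>) = 1 / 8" using C N by (simp add: c_def)
    hence le: "x * (n / 2 * (1 - b n) - n * (1 / 8)) \<le> E n" using lower[OF elim(3) x] by (simp only:)
    have "1 / 2 \<le> 1 - b n" using elim by simp
    hence "n / 2 * (1 / 2) \<le> n / 2 * (1 - b n)" by (intro mult_left_mono) auto
    hence "x * (n / 8) \<le> x * (n / 2 * (1 - b n) - n * (1 / 8))" using x by (intro mult_left_mono) auto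
    hence "x * (n / 8) \<le> E n" using le by linarith
    moreover have "x * (n / 8) = D * (n / ?N powr \<gamma>)" using c N by (simp add: x_def D_def powr_divide)
    ultimately show ?case by (simp only:)
  qed
  thus "\<exists>D>0. \<forall>\<^sub>F n in sequentially. D * (n / (real n powr (1 - \<beta>)) powr \<gamma>) \<le> E n" using D by blast
  \<comment> \<open>In the quotient the powers of \<open>real n powr (1 - \<beta>)\<close> cancel.
    What remains is a power of the logarithm over \<open>n\<close>, plus 1 / n from the exceptional
    event.\<close>
  define U where "U n = (2 * C0 powr (2 * \<gamma>) / D\<^sup>2) * (ln (real n) powr (2 * \<gamma>) * (3 * (C1 * C0 * ln n) + (C1 * C0 * ln n)\<^sup>2) / n)
      + 2 / D\<^sup>2 * (1 / n)" for n :: nat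
  have "(\<lambda>n :: nat. ln (real n) powr (2 * \<gamma>) * (3 * (C1 * C0 * ln n) + (C1 * C0 * ln n)\<^sup>2) / n) \<longlonglongrightarrow> 0"
    using g C by real_asymp
  hence U: "U \<longlonglongrightarrow> 0"
    unfolding U_def[abs_def] by (intro tendsto_add_zero tendsto_mult_right_zero lim_1_over_n)
  show "(\<lambda>n. V n / (E n)\<^sup>2) \<longlonglongrightarrow> 0"
  proof (rule real_tendsto_sandwich[OF _ _ tendsto_const U])
    show "\<forall>\<^sub>F n in sequentially. 0 \<le> V n / (E n)\<^sup>2" using V0 by simp
    show "\<forall>\<^sub>F n in sequentially. V n / (E n)\<^sup>2 \<le> U n"
      using low b var eventually_ge_at_top[of 2]
    proof eventually_elim
      case (elim n)
      let ?N = "real n powr (1 - \<beta>)"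
      let ?P = "3 * (C1 * C0 * ln n) + (C1 * C0 * ln n)\<^sup>2"
      have n: "0 < real n" "0 < ln (real n)" using elim by auto
      have N: "0 < ?N" using n by simp
      have low0: "0 < D * (n / ?N powr \<gamma>)" using D n N by simp
      have "0 < E n" using elim(1) low0 by linarith
      hence "V n / (E n)\<^sup>2 \<le> V n / (D * (n / ?N powr \<gamma>))\<^sup>2"
        using elim(1) low0 V0[of n] by (intro divide_left_mono power_mono mult_pos_pos[OF zero_less_power zero_less_power]) auto
      also have "\<dots> \<le> (2 * (n * ((C0 * ln n / ?N) powr \<gamma>)\<^sup>2 * ?P) + 2 * ((real n * real n)\<^sup>2 * b n)) / (D * (n / ?N powr \<gamma>))\<^sup>2"
        using elim(3) by (intro divide_right_mono) auto
      also have "\<dots> = 2 * (n * ((C0 * ln n / ?N) powr \<gamma>)\<^sup>2 * ?P) / (D * (n / ?N powr \<gamma>))\<^sup>2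
          + 2 * ((real n * real n)\<^sup>2 * b n) / (D * (n / ?N powr \<gamma>))\<^sup>2"
        by (rule add_divide_distrib)
      also have "2 * (n * ((C0 * ln n / ?N) powr \<gamma>)\<^sup>2 * ?P) / (D * (n / ?N powr \<gamma>))\<^sup>2
          = (2 * C0 powr (2 * \<gamma>) / D\<^sup>2) * (ln (real n) powr (2 * \<gamma>) * ?P / n)"
      proof -
        have "((C0 * ln n / ?N) powr \<gamma>)\<^sup>2 = C0 powr (2 * \<gamma>) * ln (real n) powr (2 * \<gamma>) / (?N powr \<gamma>)\<^sup>2"
          using C n N by (simp add: powr_divide powr_mult power_divide power_mult_distrib powr_power mult.commute)
        thus ?thesis using n N by (simp add: power_divide power_mult_distrib power2_eq_square)
      qed
      also have "2 * ((real n * real n)\<^sup>2 * b n) / (D * (n / ?N powr \<gamma>))\<^sup>2 \<le> 2 / D\<^sup>2 * (1 / n)"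
      proof -
        have e1: "2 * ((real n * real n)\<^sup>2 * b n) / (D * (n / ?N powr \<gamma>))\<^sup>2 = 2 / D\<^sup>2 * ((real n)\<^sup>2 * (?N powr \<gamma>)\<^sup>2 * b n)"
          using n N D by (simp add: power_divide power_mult_distrib power2_eq_square)
        have "(?N powr \<gamma>)\<^sup>2 \<le> real n powr (2 * \<gamma>)"
        proof -
          have "(?N powr \<gamma>)\<^sup>2 = real n powr ((1 - \<beta>) * (2 * \<gamma>))"
            using n by (simp add: powr_powr powr_power mult_ac)
          also have "\<dots> \<le> real n powr (1 * (2 * \<gamma>))"
            using elim(4) g beta by (intro powr_mono mult_right_mono) auto
          finally show ?thesis by simp
        qed
        hence "(real n)\<^sup>2 * (?N powr \<gamma>)\<^sup>2 * b n \<le> (real n)\<^sup>2 * real n powr (2 * \<gamma>) * real n powr (- (3 + 2 * \<gamma>))"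
        proof -
          assume a: "(?N powr \<gamma>)\<^sup>2 \<le> real n powr (2 * \<gamma>)"
          have "(real n)\<^sup>2 * (?N powr \<gamma>)\<^sup>2 * b n \<le> (real n)\<^sup>2 * (?N powr \<gamma>)\<^sup>2 * real n powr (- (3 + 2 * \<gamma>))"
            using elim(2) by (intro mult_left_mono) auto
          also have "\<dots> \<le> (real n)\<^sup>2 * real n powr (2 * \<gamma>) * real n powr (- (3 + 2 * \<gamma>))"
            using a by (intro mult_left_mono mult_right_mono) auto
          finally show ?thesis .
        qed
        also have "\<dots> = real n powr 2 * real n powr (2 * \<gamma>) * real n powr (- (3 + 2 * \<gamma>))"
          using n by (simp add: powr_numeral)
        also have "\<dots> = real n powr (- 1)" unfolding powr_add[symmetric] by simp
        also have "\<dots> = 1 / n" using n by (simp add: powr_neg_one)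
        finally show ?thesis unfolding e1 by (rule mult_left_mono) simp
      qed
      finally show ?case unfolding U_def by simp
    qed
  qed
qed

text \<open>Both regimes at once: they differ in the exponent \<gamma>, in the constants of the
  cheap-edge and connectivity bounds and in the upper bound \<open>B\<close>.\<close>

lemma regime_conclusion:
  fixes M :: "nat \<Rightarrow> 'a measure" and p B :: "nat \<Rightarrow> real" and \<tau> :: "nat \<Rightarrow> 'a \<Rightarrow> real"
    and \<alpha> \<beta> \<gamma> \<delta> C0 C1 D' :: real
  assumes mst: "\<And>n. n \<ge> 2 \<Longrightarrow> euclidean_mst (M n) n (p n) F f (Z n) (W n) (X n) \<alpha> \<delta> \<epsilon>1 \<epsilon>2"
    and p: "\<And>n. p n = 1 / real n powr \<beta>" and beta: "0 < \<beta>" "\<beta> < 1"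
    and rule: "largest_component_rule L"
    and tau: "\<And>n. \<tau> n = mst_cost L (\<lambda>x y. (dist x y / sqrt 2) powr \<alpha>) n (Z n) (W n) (X n)"
    and g: "0 < \<gamma>" and C: "0 < C0" "0 < C1"
    and cheap: "\<And>n x. n \<ge> 2 \<Longrightarrow> 0 < x \<Longrightarrow>
      euclidean_mst.cheap_bound (M n) n (Z n) (W n) (X n) \<alpha> (p n * (C1 * x powr (1 / \<gamma>))) x"
    and dis: "\<forall>\<^sub>F n in sequentially. measure (M n) {\<omega> \<in> space (M n). \<not> connected_graph {1..n}
      (euclidean_mst.cheap_edges n (Z n) (W n) (X n) \<alpha> ((C0 * ln n / real n powr (1 - \<beta>)) powr \<gamma>) \<omega>)}
        \<le> real n powr (- (3 + 2 * \<gamma>))"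
    and upper: "\<forall>\<^sub>F n in sequentially. integral\<^sup>L (M n) (\<tau> n) \<le> D' * B n" and D': "0 < D'"
    and B: "\<And>n. n \<ge> 2 \<Longrightarrow> 0 < B n"
  shows "(\<exists>D1>0. \<exists>D2>0.
      (\<lambda>n. measure (M n) {\<omega> \<in> space (M n). connected_graph {1..n} (random_edges n (Z n) \<omega>) \<and>
          D1 * (n / (n * p n) powr \<gamma>) \<le> \<tau> n \<omega> \<and> \<tau> n \<omega> \<le> D2 * B n}) \<longlonglongrightarrow> 1 \<and>
      (\<forall>n\<ge>2. D1 * (n / (n * p n) powr \<gamma>) \<le> integral\<^sup>L (M n) (\<tau> n) \<and> integral\<^sup>L (M n) (\<tau> n) \<le> D2 * B n)) \<and>
    tendsto_L2 M (\<lambda>n \<omega>. \<tau> n \<omega> / integral\<^sup>L (M n) (\<tau> n)) 1"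
proof -
  define E where "E n = integral\<^sup>L (M n) (\<tau> n)" for n
  define V where "V n = (\<integral>\<omega>. (\<tau> n \<omega> - E n)\<^sup>2 \<partial>M n)" for n
  define l where "l n = (C0 * ln (real n) / real n powr (1 - \<beta>)) powr \<gamma>" for n
  define b where "b n = measure (M n) {\<omega> \<in> space (M n). \<not> connected_graph {1..n}
      (euclidean_mst.cheap_edges n (Z n) (W n) (X n) \<alpha> (l n) \<omega>)}" for n
  define A where "A n = n / (n * p n) powr \<gamma>" for n
  have np: "real n * p n = real n powr (1 - \<beta>)" if "n \<ge> 2" for n
    using that by (simp add: p powr_diff)
  have tau_eq: "\<tau> n = euclidean_mst.tree_cost n (Z n) (W n) (X n) \<alpha> L" if "n \<ge> 2" for n
    using euclidean_mst.tree_cost_def[OF mst[OF that]] tau by auto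
  have Apos: "0 < A n" if "n \<ge> 2" for n
    using that np[OF that] by (simp add: A_def)
  have Epos: "0 < E n" if "n \<ge> 2" for n
    unfolding E_def tau_eq[OF that] by (rule euclidean_mst.expectation_tree_cost_pos[OF mst[OF that] rule])
  have b_small: "\<forall>\<^sub>F n in sequentially. b n \<le> real n powr (- (3 + 2 * \<gamma>))"
    using dis unfolding b_def l_def .
  have lower: "x * (n / 2 * (1 - b n) - n * (C1 * real n powr (1 - \<beta>) * x powr (1 / \<gamma>))) \<le> E n"
    if n: "n \<ge> 2" and x: "0 < x" for n x
  proof -
    interpret euclidean_mst "M n" n "p n" F f "Z n" "W n" "X n" \<alpha> \<delta> \<epsilon>1 \<epsilon>2 by (rule mst[OF n])
    have "x * (n / 2 * prob {\<omega> \<in> space (M n). connected_graph {1..n} (cheap_edges (l n) \<omega>)}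
        - real n * real n * (p n * (C1 * x powr (1 / \<gamma>)))) \<le> expectation (tree_cost L)"
    proof (rule expectation_tree_cost_ge[OF rule x cheap[OF n x]])
      fix \<omega> assume "connected_graph {1..n} (cheap_edges (l n) \<omega>)"
      thus "connected_graph {1..n} (random_edges n (Z n) \<omega>)"
        by (rule connected_graph_mono) (auto simp: cheap_edges_def random_edges_def)
    qed (rule cheap_edges_pred)
    moreover have "prob {\<omega> \<in> space (M n). connected_graph {1..n} (cheap_edges (l n) \<omega>)} = 1 - b n"
      using prob_not[OF cheap_edges_pred, of "connected_graph {1..n}" "l n"] by (simp add: b_def)
    moreover have "real n * real n * (p n * (C1 * x powr (1 / \<gamma>))) = n * (C1 * (real n * p n) * x powr (1 / \<gamma>))" by simp
    ultimately show ?thesis unfolding np[OF n] E_def tau_eq[OF n] by simp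
  qed
  have l_small: "\<forall>\<^sub>F n in sequentially. l n \<le> 1"
  proof -
    have "(\<lambda>n. C0 * ln (real n) / real n powr (1 - \<beta>)) \<longlonglongrightarrow> 0" using beta by real_asymp
    hence "\<forall>\<^sub>F n in sequentially. C0 * ln (real n) / real n powr (1 - \<beta>) < 1" by (rule order_tendstoD) simp
    thus ?thesis using eventually_ge_at_top[of 2]
      by eventually_elim (use C g in \<open>auto simp: l_def intro!: powr_le1 divide_nonneg_nonneg\<close>)
  qed
  have var: "\<forall>\<^sub>F n in sequentially. V n \<le>
      2 * (n * ((C0 * ln n / real n powr (1 - \<beta>)) powr \<gamma>)\<^sup>2 * (3 * (C1 * C0 * ln n) + (C1 * C0 * ln n)\<^sup>2))
      + 2 * ((real n * real n)\<^sup>2 * b n)"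
    using l_small eventually_ge_at_top[of 2]
  proof eventually_elim
    case (elim n)
    interpret euclidean_mst "M n" n "p n" F f "Z n" "W n" "X n" \<alpha> \<delta> \<epsilon>1 \<epsilon>2 by (rule mst[OF elim(2)])
    let ?q = "p n * (C1 * l n powr (1 / \<gamma>))"
    have ln0: "0 < ln (real n)" using elim by simp
    have l0: "0 < l n" using ln0 C elim by (simp add: l_def)
    have "l n powr (1 / \<gamma>) = C0 * ln n / real n powr (1 - \<beta>)"
      using g C ln0 elim by (simp add: l_def powr_powr)
    \<comment> \<open>At the cap \<open>l n\<close> the bound \<open>n * q\<close> on the mean
      number of cheap edges at a vertex is of order log n, so the variance exceeds
      \<open>n * (l n)\<^sup>2\<close> by logarithmic factors only, up to the exceptional
      event.\<close>
    hence nq: "real n * ?q = C1 * C0 * ln n"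
      using np[OF elim(2)] elim by (simp add: mult.assoc[symmetric])
    show ?case
      using variance_tree_cost_le[OF rule less_imp_le[OF l0] elim(1) cheap[OF elim(2) l0], unfolded nq]
      unfolding V_def E_def tau_eq[OF elim(2)] b_def l_def[symmetric] .
  qed
  have V0: "0 \<le> V n" for n unfolding V_def by simp
  note core = asymptotic_core[OF g C beta b_small lower V0 var]
  obtain D where D: "0 < D" "\<forall>\<^sub>F n in sequentially. D * (n / (real n powr (1 - \<beta>)) powr \<gamma>) \<le> E n"
    using core(1) by blast
  have DA: "\<forall>\<^sub>F n in sequentially. D * A n \<le> E n"
    using D(2) eventually_ge_at_top[of 2] by eventually_elim (simp add: A_def np)
  from eventually_bound_imp_uniform[OF DA D(1) Apos Epos]
  obtain d1 where d1: "0 < d1" "\<And>n. n \<ge> 2 \<Longrightarrow> d1 * A n \<le> E n" by blast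
  have "\<forall>\<^sub>F n in sequentially. 1 / D' * E n \<le> B n"
    using upper by eventually_elim (use D' in \<open>simp add: E_def pos_divide_le_eq mult.commute\<close>)
  \<comment> \<open>Read as a lower bound on \<open>B\<close> in terms of the mean, the upper bound
    becomes uniform by the same lemma.\<close>
  from eventually_bound_imp_uniform[OF this _ Epos B] D'
  obtain d2 where d2: "0 < d2" "\<And>n. n \<ge> 2 \<Longrightarrow> d2 * E n \<le> B n" by auto
  \<comment> \<open>The factors 1 / 2 and 2 make room for the window of Chebyshev's inequality, so
    that one pair of constants serves both for the cost and for its mean.\<close>
  have E_bounds: "d1 / 2 * A n \<le> E n / 2" "2 * E n \<le> 2 / d2 * B n" if "n \<ge> 2" for n
    using d1(2)[OF that] d2(2)[OF that] d2(1) by (auto simp: field_simps)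
  have b_lim: "b \<longlonglongrightarrow> 0"
  proof (rule real_tendsto_sandwich[OF _ b_small tendsto_const])
    show "(\<lambda>n. real n powr (- (3 + 2 * \<gamma>))) \<longlonglongrightarrow> 0" using g by real_asymp
  qed (simp add: b_def)
  have probs: "(\<lambda>n. measure (M n) {\<omega> \<in> space (M n). connected_graph {1..n} (random_edges n (Z n) \<omega>) \<and>
      d1 / 2 * A n \<le> \<tau> n \<omega> \<and> \<tau> n \<omega> \<le> 2 / d2 * B n}) \<longlonglongrightarrow> 1"
  proof (rule real_tendsto_sandwich[OF _ _ _ tendsto_const])
    show "(\<lambda>n. 1 - b n - 4 * (V n / (E n)\<^sup>2)) \<longlonglongrightarrow> 1"
      using tendsto_diff[OF tendsto_diff[OF tendsto_const b_lim] tendsto_mult[OF tendsto_const core(2)], of 1 4] by simp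
    show "\<forall>\<^sub>F n in sequentially. 1 - b n - 4 * (V n / (E n)\<^sup>2) \<le>
        measure (M n) {\<omega> \<in> space (M n). connected_graph {1..n} (random_edges n (Z n) \<omega>) \<and>
          d1 / 2 * A n \<le> \<tau> n \<omega> \<and> \<tau> n \<omega> \<le> 2 / d2 * B n}"
      using eventually_ge_at_top[of 2]
    proof eventually_elim
      case (elim n)
      interpret euclidean_mst "M n" n "p n" F f "Z n" "W n" "X n" \<alpha> \<delta> \<epsilon>1 \<epsilon>2 by (rule mst[OF elim])
      show ?case
        using prob_tree_cost_window[OF rule order.refl, of "d1 / 2 * A n" "2 / d2 * B n" "l n"] E_bounds[OF elim]
        unfolding V_def E_def tau_eq[OF elim] b_def by simp
    qed
    show "\<forall>\<^sub>F n in sequentially. measure (M n) {\<omega> \<in> space (M n). connected_graph {1..n} (random_edges n (Z n) \<omega>) \<and>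
          d1 / 2 * A n \<le> \<tau> n \<omega> \<and> \<tau> n \<omega> \<le> 2 / d2 * B n} \<le> 1"
      using eventually_ge_at_top[of 2]
    proof eventually_elim
      case (elim n)
      interpret euclidean_mst "M n" n "p n" F f "Z n" "W n" "X n" \<alpha> \<delta> \<epsilon>1 \<epsilon>2 by (rule mst[OF elim])
      show ?case by simp
    qed
  qed
  have L2: "tendsto_L2 M (\<lambda>n \<omega>. \<tau> n \<omega> / E n) 1"
    unfolding tendsto_L2_def
  proof
    have sq: "(t / E n - 1)\<^sup>2 = (t - E n)\<^sup>2 / (E n)\<^sup>2" if "n \<ge> 2" for n t
      using Epos[OF that] by (simp add: diff_divide_distrib flip: power_divide)
    show "\<forall>\<^sub>F n in sequentially. (\<lambda>\<omega>. \<tau> n \<omega> / E n) \<in> borel_measurable (M n) \<and>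
        integrable (M n) (\<lambda>\<omega>. (\<tau> n \<omega> / E n - 1)\<^sup>2)"
      using eventually_ge_at_top[of 2]
    proof eventually_elim
      case (elim n)
      interpret euclidean_mst "M n" n "p n" F f "Z n" "W n" "X n" \<alpha> \<delta> \<epsilon>1 \<epsilon>2 by (rule mst[OF elim])
      show ?case
        unfolding sq[OF elim] unfolding tau_eq[OF elim]
        using tree_cost_measurable[OF rule] integrable_tree_cost(2)[OF rule, of "E n"] by simp
    qed
    show "(\<lambda>n. \<integral>\<omega>. (\<tau> n \<omega> / E n - 1)\<^sup>2 \<partial>M n) \<longlonglongrightarrow> 0"
    proof (rule Lim_transform_eventually[OF core(2)])
      show "\<forall>\<^sub>F n in sequentially. V n / (E n)\<^sup>2 = (\<integral>\<omega>. (\<tau> n \<omega> / E n - 1)\<^sup>2 \<partial>M n)"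
        using eventually_ge_at_top[of 2] by eventually_elim (simp add: sq V_def)
    qed
  qed
  have "\<forall>n\<ge>2. d1 / 2 * A n \<le> E n \<and> E n \<le> 2 / d2 * B n"
    using E_bounds Epos by (smt (verit) field_sum_of_halves)
  thus ?thesis
    using probs L2 d1(1) d2(1) unfolding A_def E_def
    by (intro conjI exI[of _ "d1 / 2"] exI[of _ "2 / d2"]) auto
qed

text \<open>The factor \<open>2 * (k + 2)\<close> makes the exponent in the cut bound equal to (k +
  2) log n. The union bound then gives twice \<open>n powr (- (k + 1))\<close>, and the spare factor
  1 / n absorbs the 2.\<close>

lemma weight_regime_connected:
  fixes p :: "nat \<Rightarrow> real"
  assumes mst: "\<And>n. n \<ge> 2 \<Longrightarrow> euclidean_mst (M n) n (p n) F f (Z n) (W n) (X n) \<alpha> \<delta> \<epsilon>1 \<epsilon>2"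
    and p: "\<And>n. p n = 1 / real n powr \<beta>" and beta: "0 < \<beta>" "\<beta> < 1" and delta: "0 < \<delta>" and k: "0 < k"
  shows "\<forall>\<^sub>F n in sequentially. measure (M n) {\<omega> \<in> space (M n). \<not> connected_graph {1..n}
      (euclidean_mst.cheap_edges n (Z n) (W n) (X n) \<alpha> ((2 * (k + 2) * ln n / real n powr (1 - \<beta>)) powr \<delta>) \<omega>)}
        \<le> real n powr (- k)"
proof -
  have "(\<lambda>n. 2 * (k + 2) * ln (real n) / real n powr (1 - \<beta>)) \<longlonglongrightarrow> 0" using beta by real_asymp
  hence "\<forall>\<^sub>F n in sequentially. 2 * (k + 2) * ln (real n) / real n powr (1 - \<beta>) < 1" by (rule order_tendstoD) simp
  thus ?thesis using eventually_ge_at_top[of 2]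
  proof eventually_elim
    case (elim n)
    interpret euclidean_mst "M n" n "p n" F f "Z n" "W n" "X n" \<alpha> \<delta> \<epsilon>1 \<epsilon>2 by (rule mst[OF elim(2)])
    let ?N = "real n powr (1 - \<beta>)"
    let ?x = "(2 * (k + 2) * ln n / ?N) powr \<delta>"
    have n: "0 < real n" "0 < ln (real n)" using elim by auto
    have np: "p n * real n = ?N" using n by (simp add: p powr_diff)
    have x: "0 < ?x" "?x \<le> 1" using n elim k delta by (auto intro!: powr_le1 divide_nonneg_nonneg)
    have xp: "?x powr (1 / \<delta>) = 2 * (k + 2) * ln n / ?N" using n k delta by (simp add: powr_powr)
    define q where "q = p n * ?x powr (1 / \<delta>)"
    have "q * real n = 2 * (k + 2) * ln n / ?N * (p n * real n)" unfolding q_def xp by simp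
    also have "\<dots> = 2 * ((k + 2) * ln n)" unfolding np using n by simp
    finally have "- q * real n / 2 = - ((k + 2) * ln n)" by simp
    hence "exp (- q * real n / 2) = real n powr (- (k + 2))"
      using n by (simp add: powr_def algebra_simps)
    hence "prob {\<omega> \<in> space (M n). \<not> connected_graph {1..n} (cheap_edges ?x \<omega>)}
        \<le> (1 + real n powr (- (k + 2))) ^ n - 1"
      using prob_cheap_disconnected_weights[OF x] unfolding q_def[symmetric] by simp
    also have "\<dots> \<le> 2 * (real n * real n powr (- (k + 2)))"
    proof (rule power_one_plus_le)
      have "real n * real n powr (- (k + 2)) = real n powr (1 + - (k + 2))" using n by (subst powr_add) simp
      also have "\<dots> \<le> real n powr 0" using elim k by (intro powr_mono) auto
      finally show "real n * real n powr (- (k + 2)) \<le> 1" using n by simp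
    qed simp
    also have "\<dots> = 2 / real n * real n powr (- k)"
      using n by (simp add: powr_diff powr_minus divide_simps powr_add power2_eq_square)
    also have "\<dots> \<le> 1 * real n powr (- k)" using elim by (intro mult_right_mono) auto
    finally show ?case by simp
  qed
qed

text \<open>The grid is as fine as connectivity permits: the mean number of neighbours in a given
  cell, n p times the probability of the cell, must stay above a multiple of log n. Squaring the
  cell width gives (log n) / (n p), which explains the exponent \<alpha> / 2.\<close>

lemma distance_regime_connected:
  fixes p :: "nat \<Rightarrow> real"
  assumes mst: "\<And>n. n \<ge> 2 \<Longrightarrow> euclidean_mst (M n) n (p n) F f (Z n) (W n) (X n) \<alpha> \<delta> \<epsilon>1 \<epsilon>2"
    and p: "\<And>n. p n = 1 / real n powr \<beta>" and beta: "0 < \<beta>" "\<beta> < 1" and alpha: "0 < \<alpha>"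
    and eps: "0 < \<epsilon>1" and k: "0 < k"
  shows "\<forall>\<^sub>F n in sequentially. measure (M n) {\<omega> \<in> space (M n). \<not> connected_graph {1..n}
      (euclidean_mst.cheap_edges n (Z n) (W n) (X n) \<alpha> ((16 * (8 * (k + 2) / \<epsilon>1) * ln n / real n powr (1 - \<beta>)) powr (\<alpha> / 2)) \<omega>)}
        \<le> real n powr (- k)"
proof -
  \<comment> \<open>The 8 compensates the smallest of the three exponents in the grid bound, that of
    the corner graph, which is an eighth of n p times \<open>s0\<close>.\<close>
  define c where "c = 8 * (k + 2) / \<epsilon>1"
  have c: "0 < c" using k eps by (simp add: c_def)
  have "(\<lambda>n. c * ln (real n) / real n powr (1 - \<beta>)) \<longlonglongrightarrow> 0" using beta by real_asymp
  hence "\<forall>\<^sub>F n in sequentially. c * ln (real n) / real n powr (1 - \<beta>) < 1" by (rule order_tendstoD) simp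
  thus ?thesis using eventually_ge_at_top[of 4] unfolding c_def[symmetric]
  proof eventually_elim
    case (elim n)
    have n2: "2 \<le> n" using elim by simp
    interpret euclidean_mst "M n" n "p n" F f "Z n" "W n" "X n" \<alpha> \<delta> \<epsilon>1 \<epsilon>2 by (rule mst[OF n2])
    let ?N = "real n powr (1 - \<beta>)"
    have n: "0 < real n" "0 < ln (real n)" using elim by auto
    have N: "0 < ?N" using n by simp
    have np: "p n * real n = ?N" using n by (simp add: p powr_diff)
    define t where "t = sqrt (?N / (c * ln n))"
    have "1 \<le> ?N / (c * ln n)" using elim(1) n c N by (simp add: field_simps)
    hence t1: "1 \<le> t" by (simp add: t_def)
    have t2: "t\<^sup>2 = ?N / (c * ln n)" unfolding t_def using N c n by simp
    \<comment> \<open>The number of cells per side is \<open>t\<close> rounded down, which loses at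
      most a factor of two as \<open>t\<close> is at least 1.\<close>
    define m where "m = nat \<lfloor>t\<rfloor>"
    have mi: "real m = real_of_int \<lfloor>t\<rfloor>" "1 \<le> \<lfloor>t\<rfloor>" using t1 by (auto simp: m_def)
    have m: "0 < m" "real m \<le> t" "t \<le> 2 * real m" using mi by linarith+
    \<comment> \<open>The factor 16 is the square of 4: adjacent cells are within 2 / m up to
      normalisation, and rounding \<open>t\<close> doubles this to 4 / t.\<close>
    let ?l = "(16 * c * ln n / ?N) powr (\<alpha> / 2)"
    have "(2 / real m) powr \<alpha> \<le> (4 / t) powr \<alpha>"
      using m t1 alpha by (intro powr_mono2) (auto simp: field_simps)
    also have "\<dots> = ((4 / t)\<^sup>2) powr (\<alpha> / 2)"
      using t1 by (simp add: powr_powr flip: powr_numeral)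
    also have "(4 / t)\<^sup>2 = 16 * c * ln n / ?N" unfolding power_divide t2 by simp
    finally have l: "(2 / real m) powr \<alpha> \<le> ?l" .
    define s0 where "s0 = \<epsilon>1 / (real m)\<^sup>2"
    have s0: "0 < s0" using eps m by (simp add: s0_def)
    have "(real m)\<^sup>2 \<le> t\<^sup>2" using m by (intro power_mono) auto
    hence "\<epsilon>1 / t\<^sup>2 \<le> s0" unfolding s0_def using eps m by (intro divide_left_mono) auto
    hence "8 * (k + 2) * ln n / ?N \<le> s0" unfolding t2 c_def using eps by (simp add: mult_ac)
    hence "(p n * real n) * (8 * (k + 2) * ln n / ?N) \<le> (p n * real n) * s0"
      using p01 n by (intro mult_left_mono) auto
    hence big: "8 * (k + 2) * ln n \<le> p n * real n * s0" unfolding np using N by simp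
    let ?y = "real n powr (- (k + 2))"
    define \<kappa> where "\<kappa> = (k + 2) * ln n"
    have kl: "0 \<le> \<kappa>" using k n by (simp add: \<kappa>_def)
    have big': "8 * \<kappa> \<le> p n * s0 * real n" using big by (simp add: \<kappa>_def mult_ac)
    have y: "?y = exp (- \<kappa>)" unfolding \<kappa>_def using n by (simp add: powr_def algebra_simps)
    have e1: "exp (- (p n * s0) * (n - 1)) \<le> ?y"
    proof -
      have "p n * s0 * (real n / 2) \<le> p n * s0 * (n - 1)"
        using n2 p01 s0 by (intro mult_left_mono) (auto simp: of_nat_diff)
      moreover have "p n * s0 * (real n / 2) = p n * s0 * real n / 2" by simp
      ultimately have "\<kappa> \<le> p n * s0 * (n - 1)" using big' kl by linarith
      thus ?thesis unfolding y by simp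
    qed
    \<comment> \<open>The exponent for the population of the corner cell lacks the factor
      \<open>p\<close>, so it is larger than the others up to constants.\<close>
    have e2: "exp (- (n * s0 / 4)) \<le> ?y"
    proof -
      have "p n * (real n * s0) \<le> 1 * (real n * s0)" using p01 s0 by (intro mult_right_mono) auto
      moreover have "p n * (real n * s0) = p n * s0 * real n" by simp
      ultimately have "\<kappa> \<le> n * s0 / 4" using big' kl by linarith
      thus ?thesis unfolding y by simp
    qed
    have e3: "exp (- p n * (n * s0 / 4) / 2) \<le> ?y"
    proof -
      have "p n * (n * s0 / 4) / 2 = p n * s0 * real n / 8" by simp
      hence "\<kappa> \<le> p n * (n * s0 / 4) / 2" using big' by linarith
      thus ?thesis unfolding y by simp
    qed
    have ny: "real n * ?y \<le> 1"
    proof -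
      have "real n * ?y = real n powr (1 + - (k + 2))" using n by (subst powr_add) simp
      also have "\<dots> \<le> real n powr 0" using elim k by (intro powr_mono) auto
      finally show ?thesis using n by simp
    qed
    have "prob {\<omega> \<in> space (M n). \<not> connected_graph {1..n} (cheap_edges ?l \<omega>)}
        \<le> n * exp (- (p n * s0) * (n - 1)) + exp (- (n * s0 / 4)) + ((1 + exp (- p n * (n * s0 / 4) / 2)) ^ n - 1)"
      using prob_cheap_disconnected_grid[OF m(1) l] unfolding s0_def[symmetric] .
    also have "\<dots> \<le> n * ?y + ?y + ((1 + ?y) ^ n - 1)"
      using e1 e2 e3 by (intro add_mono mult_left_mono diff_mono power_mono) (auto simp: add_nonneg_nonneg)
    also have "\<dots> \<le> n * ?y + n * ?y + 2 * (n * ?y)"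
    proof (intro add_mono power_one_plus_le order.refl ny)
      show "?y \<le> n * ?y" using elim by simp
    qed simp
    also have "\<dots> = 4 / real n * real n powr (- k)"
      using n by (simp add: powr_diff powr_minus divide_simps powr_add power2_eq_square)
    also have "\<dots> \<le> 1 * real n powr (- k)" using elim by (intro mult_right_mono) auto
    finally show ?case by simp
  qed
qed

theorem corollary4:
  fixes M :: "nat \<Rightarrow> 'a measure"
    and Z :: "nat \<Rightarrow> nat \<times> nat \<Rightarrow> 'a \<Rightarrow> bool"
    and W :: "nat \<Rightarrow> nat \<times> nat \<Rightarrow> 'a \<Rightarrow> real"
    and X :: "nat \<Rightarrow> nat \<Rightarrow> 'a \<Rightarrow> real ^ 2"
    and F :: "real \<Rightarrow> real"
    and f :: "real ^ 2 \<Rightarrow> real"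
    and L :: "nat \<Rightarrow> (nat \<times> nat) set \<Rightarrow> nat set"
    and p :: "nat \<Rightarrow> real"
    and \<tau> :: "nat \<Rightarrow> 'a \<Rightarrow> real"
    and \<alpha> \<beta> \<delta> \<epsilon>1 \<epsilon>2 :: real
  assumes model: "\<And>n. n \<ge> 2 \<Longrightarrow>
            marked_random_graph (M n) n (\<lambda>h. p n) F f (Z n) (W n) (X n)"
    and p: "\<And>n. p n = 1 / real n powr \<beta>"
    and beta: "0 < \<beta>" "\<beta> < 1"
    and eps: "0 < \<epsilon>1" "0 < \<epsilon>2"
    and f_bounds: "\<And>x. x \<in> unit_square \<Longrightarrow> \<epsilon>1 \<le> f x \<and> f x \<le> \<epsilon>2"
    and delta: "0 < \<delta>" "\<delta> < 1"
    and F: "\<And>x. 0 < x \<Longrightarrow> x < 1 \<Longrightarrow> F x = x powr (1 / \<delta>)"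
    and alpha: "0 < \<alpha>"
    and rule: "largest_component_rule L"
    and tau: "\<And>n. \<tau> n =
            mst_cost L (\<lambda>x y. (dist x y / sqrt 2) powr \<alpha>) n (Z n) (W n) (X n)"
  shows "(\<alpha> < 2 * \<delta> / (1 + \<delta>) \<longrightarrow>
            (\<exists>D1>0. \<exists>D2>0.
               (\<lambda>n. prob_space.prob (M n)
                  {\<omega> \<in> space (M n). connected_graph {1..n} (random_edges n (Z n) \<omega>) \<and>
                     D1 * real n / (real n * p n) powr \<delta> \<le> \<tau> n \<omega> \<and>
                     \<tau> n \<omega> \<le> D2 * real n / (real n * p n) powr \<delta>}) \<longlonglongrightarrow> 1 \<and>
               (\<forall>n\<ge>2.
                  D1 * real n / (real n * p n) powr \<delta> \<le> prob_space.expectation (M n) (\<tau> n) \<and>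
                  prob_space.expectation (M n) (\<tau> n) \<le> D2 * real n / (real n * p n) powr \<delta>)) \<and>
            tendsto_L2 M (\<lambda>n \<omega>. \<tau> n \<omega> / prob_space.expectation (M n) (\<tau> n)) 1)
       \<and> (\<alpha> > 2 * \<delta> / (1 - \<delta>) \<longrightarrow>
            (\<exists>\<theta>1>0. \<exists>\<theta>2>0.
               (\<lambda>n. prob_space.prob (M n)
                  {\<omega> \<in> space (M n). connected_graph {1..n} (random_edges n (Z n) \<omega>) \<and>
                     \<theta>1 * real n / (real n * p n) powr (\<alpha> / 2) \<le> \<tau> n \<omega> \<and>
                     \<tau> n \<omega> \<le> \<theta>2 * real n * (ln (real n) / (real n * p n)) powr (\<alpha> / 2)})
                 \<longlonglongrightarrow> 1 \<and>
               (\<forall>n\<ge>2.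
                  \<theta>1 * real n / (real n * p n) powr (\<alpha> / 2)
                    \<le> prob_space.expectation (M n) (\<tau> n) \<and>
                  prob_space.expectation (M n) (\<tau> n)
                    \<le> \<theta>2 * real n * (ln (real n) / (real n * p n)) powr (\<alpha> / 2))) \<and>
            (\<beta> > (\<alpha> - 2 * \<delta>) / (1 + \<alpha> - 2 * \<delta>) \<longrightarrow>
               tendsto_L2 M (\<lambda>n \<omega>. \<tau> n \<omega> / prob_space.expectation (M n) (\<tau> n)) 1))"
proof (intro conjI impI)
  have mst: "euclidean_mst (M n) n (p n) F f (Z n) (W n) (X n) \<alpha> \<delta> \<epsilon>1 \<epsilon>2" if "n \<ge> 2" for n
    using model[OF that] that eps alpha delta f_bounds F
    by (simp add: euclidean_mst_def euclidean_mst_axioms_def)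
  have tau_eq: "\<tau> n = euclidean_mst.tree_cost n (Z n) (W n) (X n) \<alpha> L" if "n \<ge> 2" for n
    using euclidean_mst.tree_cost_def[OF mst[OF that]] tau by auto
  have np: "real n * p n = real n powr (1 - \<beta>)" if "n \<ge> 2" for n
    using that by (simp add: p powr_diff)
  have expectation: "prob_space.expectation (M n) g = integral\<^sup>L (M n) g" for n and g :: "'a \<Rightarrow> real" ..
  \<comment> \<open>For the upper bound on the mean the tree cost is compared with the capped total.
    The exceptional event contributes n^2 times its probability, which is absorbed into
    \<open>B n\<close> in both regimes.\<close>
  have diff: "\<forall>\<^sub>F n in sequentially. integral\<^sup>L (M n) (\<tau> n)
      \<le> integral\<^sup>L (M n) (euclidean_mst.capped_total n (Z n) (W n) (X n) \<alpha> (l n)) + real n powr (- (1 + 2 * \<gamma>))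
      \<and> 0 \<le> l n \<and> l n \<le> 1"
    if dis: "\<forall>\<^sub>F n in sequentially. measure (M n) {\<omega> \<in> space (M n). \<not> connected_graph {1..n}
      (euclidean_mst.cheap_edges n (Z n) (W n) (X n) \<alpha> (l n) \<omega>)} \<le> real n powr (- (3 + 2 * \<gamma>))"
      and l: "\<And>n. l n = (C0 * ln n / real n powr (1 - \<beta>)) powr \<gamma>" and C0: "0 < C0" and g: "0 < \<gamma>"
    for l C0 \<gamma>
  proof -
    have "(\<lambda>n. C0 * ln (real n) / real n powr (1 - \<beta>)) \<longlonglongrightarrow> 0" using beta by real_asymp
    hence "\<forall>\<^sub>F n in sequentially. C0 * ln (real n) / real n powr (1 - \<beta>) < 1" by (rule order_tendstoD) simp
    thus ?thesis using dis eventually_ge_at_top[of 2]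
    proof eventually_elim
      case (elim n)
      interpret euclidean_mst "M n" n "p n" F f "Z n" "W n" "X n" \<alpha> \<delta> \<epsilon>1 \<epsilon>2 by (rule mst[OF elim(3)])
      have n: "0 < real n" "0 < ln (real n)" using elim(3) by auto
      have l01: "0 \<le> l n" "l n \<le> 1" using elim(1) n C0 g unfolding l by (auto intro!: powr_le1 divide_nonneg_nonneg)
      let ?b = "prob {\<omega> \<in> space (M n). \<not> connected_graph {1..n} (cheap_edges (l n) \<omega>)}"
      have "real n * real n * ?b \<le> real n powr 2 * real n powr (- (3 + 2 * \<gamma>))"
        using elim(2) n by (simp add: power2_eq_square mult_left_mono)
      also have "\<dots> = real n powr (- (1 + 2 * \<gamma>))" unfolding powr_add[symmetric] by simp
      finally show ?case
        using expectation_diff_le(1)[OF rule l01] l01 unfolding tau_eq[OF elim(3)] by linarith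
    qed
  qed
  {
    assume "\<alpha> < 2 * \<delta> / (1 + \<delta>)"
    also have "\<dots> \<le> 2 * \<delta>" using delta by (simp add: pos_divide_le_eq)
    \<comment> \<open>Brings the hypothesis into the form under which the dyadic series over lengths
      converges.\<close>
    finally have a: "\<alpha> < 2 * \<delta>" .
    define C1 where "C1 = 72 * \<epsilon>2 * 2 powr (\<alpha> / \<delta>) / (1 - 2 powr (\<alpha> / \<delta>) / 4)"
    have "2 powr (\<alpha> / \<delta>) < (2 :: real) powr 2" using a delta by (intro powr_less_mono) (auto simp: field_simps)
    hence C1: "0 < C1" using eps by (simp add: C1_def)
    define k where "k = 3 + 2 * \<delta>"
    define C0 where "C0 = 2 * (k + 2)"
    have C0: "0 < C0" "0 < k" using delta by (auto simp: C0_def k_def)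
    have dis: "\<forall>\<^sub>F n in sequentially. measure (M n) {\<omega> \<in> space (M n). \<not> connected_graph {1..n}
      (euclidean_mst.cheap_edges n (Z n) (W n) (X n) \<alpha> ((C0 * ln n / real n powr (1 - \<beta>)) powr \<delta>) \<omega>)}
        \<le> real n powr (- (3 + 2 * \<delta>))"
      using weight_regime_connected[OF mst p beta delta(1) C0(2)] unfolding C0_def k_def .
    define K where "K = (1 + 1 / (1 - 2 powr (1 - 1 / \<delta>))) / (1 - \<delta>)"
    have "(2 :: real) powr (1 - 1 / \<delta>) < 2 powr 0" using delta by (intro powr_less_mono) auto
    hence K: "0 < K" using delta by (simp add: K_def add_pos_nonneg)
    define B where "B n = real n / (real n * p n) powr \<delta>" for n
    have B: "0 < B n" if "n \<ge> 2" for n using that np[OF that] by (simp add: B_def)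
    have upper: "\<forall>\<^sub>F n in sequentially. integral\<^sup>L (M n) (\<tau> n) \<le> (K + 1) * B n"
      using diff[OF dis refl C0(1) delta(1)] eventually_ge_at_top[of 2]
    proof eventually_elim
      case (elim n)
      interpret euclidean_mst "M n" n "p n" F f "Z n" "W n" "X n" \<alpha> \<delta> \<epsilon>1 \<epsilon>2 by (rule mst[OF elim(2)])
      let ?l = "(C0 * ln n / real n powr (1 - \<beta>)) powr \<delta>"
      have "expectation (capped_total ?l) \<le> K * B n"
        using expectation_capped_total_le[of ?l] elim(1) unfolding K_def B_def by blast
      moreover have "real n powr (- (1 + 2 * \<delta>)) \<le> B n"
      proof -
        have "B n = real n powr (1 - (1 - \<beta>) * \<delta>)"
          unfolding B_def np[OF elim(2)] powr_powr using elim(2) by (simp add: powr_diff)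
        moreover have "(1 - \<beta>) * \<delta> \<le> 1 * \<delta>" using beta delta by (intro mult_right_mono) auto
        hence "- (1 + 2 * \<delta>) \<le> 1 - (1 - \<beta>) * \<delta>" using delta by linarith
        ultimately show ?thesis using elim(2) powr_mono by simp
      qed
      ultimately show ?case using elim(1) by (simp add: distrib_right)
    qed
    have concl: "(\<exists>D1>0. \<exists>D2>0.
      (\<lambda>n. measure (M n) {\<omega> \<in> space (M n). connected_graph {1..n} (random_edges n (Z n) \<omega>) \<and>
          D1 * (n / (n * p n) powr \<delta>) \<le> \<tau> n \<omega> \<and> \<tau> n \<omega> \<le> D2 * B n}) \<longlonglongrightarrow> 1 \<and>
      (\<forall>n\<ge>2. D1 * (n / (n * p n) powr \<delta>) \<le> integral\<^sup>L (M n) (\<tau> n) \<and> integral\<^sup>L (M n) (\<tau> n) \<le> D2 * B n)) \<and>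
      tendsto_L2 M (\<lambda>n \<omega>. \<tau> n \<omega> / integral\<^sup>L (M n) (\<tau> n)) 1"
    proof (rule regime_conclusion[OF mst p beta rule tau delta(1) C0(1) C1 _ dis upper _ B])
      fix n :: nat and x :: real assume n: "n \<ge> 2" and x: "0 < x"
      show "euclidean_mst.cheap_bound (M n) n (Z n) (W n) (X n) \<alpha> (p n * (C1 * x powr (1 / \<delta>))) x"
        using euclidean_mst.cheap_bound_weights[OF mst[OF n] a x] by (simp add: C1_def)
    qed (use K in auto)
    show "\<exists>D1>0. \<exists>D2>0.
               (\<lambda>n. prob_space.prob (M n)
                  {\<omega> \<in> space (M n). connected_graph {1..n} (random_edges n (Z n) \<omega>) \<and>
                     D1 * real n / (real n * p n) powr \<delta> \<le> \<tau> n \<omega> \<and>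
                     \<tau> n \<omega> \<le> D2 * real n / (real n * p n) powr \<delta>}) \<longlonglongrightarrow> 1 \<and>
               (\<forall>n\<ge>2.
                  D1 * real n / (real n * p n) powr \<delta> \<le> prob_space.expectation (M n) (\<tau> n) \<and>
                  prob_space.expectation (M n) (\<tau> n) \<le> D2 * real n / (real n * p n) powr \<delta>)"
      using conjunct1[OF concl] unfolding B_def times_divide_eq_right .
    show "tendsto_L2 M (\<lambda>n \<omega>. \<tau> n \<omega> / prob_space.expectation (M n) (\<tau> n)) 1"
      by (rule conjunct2[OF concl])
  }
  {
    assume "\<alpha> > 2 * \<delta> / (1 - \<delta>)"
    moreover have "2 * \<delta> \<le> 2 * \<delta> / (1 - \<delta>)" using delta by (simp add: pos_le_divide_eq mult_left_le)
    \<comment> \<open>Brings the hypothesis into the form under which the dyadic series over weights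
      converges.\<close>
    ultimately have a: "2 * \<delta> < \<alpha>" by linarith
    define C1 where "C1 = 72 * \<epsilon>2 * 2 powr (2 / \<alpha>) / (1 - 2 powr (2 / \<alpha> - 1 / \<delta>))"
    have "2 powr (2 / \<alpha> - 1 / \<delta>) < (2 :: real) powr 0" using a alpha delta by (intro powr_less_mono) (auto simp: field_simps)
    hence C1: "0 < C1" using eps by (simp add: C1_def)
    define \<gamma> where "\<gamma> = \<alpha> / 2"
    have g: "0 < \<gamma>" using alpha by (simp add: \<gamma>_def)
    define k where "k = 3 + 2 * \<gamma>"
    define C0 where "C0 = 16 * (8 * (k + 2) / \<epsilon>1)"
    have C0: "0 < C0" "0 < k" using g eps by (auto simp: C0_def k_def)
    have dis: "\<forall>\<^sub>F n in sequentially. measure (M n) {\<omega> \<in> space (M n). \<not> connected_graph {1..n}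
      (euclidean_mst.cheap_edges n (Z n) (W n) (X n) \<alpha> ((C0 * ln n / real n powr (1 - \<beta>)) powr \<gamma>) \<omega>)}
        \<le> real n powr (- (3 + 2 * \<gamma>))"
      using distance_regime_connected[OF mst p beta alpha eps(1) C0(2)] unfolding C0_def k_def \<gamma>_def .
    define B where "B n = real n * (ln (real n) / (real n * p n)) powr \<gamma>" for n
    have B: "0 < B n" if "n \<ge> 2" for n using that np[OF that] by (simp add: B_def)
    have upper: "\<forall>\<^sub>F n in sequentially. integral\<^sup>L (M n) (\<tau> n) \<le> (C0 powr \<gamma> + 1) * B n"
      using diff[OF dis refl C0(1) g] eventually_ge_at_top[of 3]
    proof eventually_elim
      case (elim n)
      have n2: "n \<ge> 2" using elim by simp
      interpret euclidean_mst "M n" n "p n" F f "Z n" "W n" "X n" \<alpha> \<delta> \<epsilon>1 \<epsilon>2 by (rule mst[OF n2])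
      let ?l = "(C0 * ln n / real n powr (1 - \<beta>)) powr \<gamma>"
      \<comment> \<open>From 3 on the logarithm is at least 1, so the logarithmic factor in
        \<open>B n\<close> only helps when the comparison error is absorbed.\<close>
      have ln1: "1 \<le> ln (real n)"
      proof -
        have "exp 1 \<le> real n" using exp_le elim(2) by linarith
        thus ?thesis using n2 by (simp add: ln_ge_iff)
      qed
      have "expectation (capped_total ?l) \<le> expectation (\<lambda>_. n * ?l)"
      proof (rule integral_mono)
        show "integrable (M n) (capped_total ?l)"
          by (rule integrable_const_bound[of _ "n * ?l"]) (use capped_total_bounds[of ?l] elim(1) capped_total_measurable in auto)
      qed (use capped_total_bounds[of ?l] elim(1) in auto)
      also have "\<dots> = C0 powr \<gamma> * B n"
        unfolding B_def np[OF n2] using C0 ln1 n2 by (simp add: prob_space powr_mult powr_divide)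
      finally have "expectation (capped_total ?l) \<le> C0 powr \<gamma> * B n" .
      moreover have "real n powr (- (1 + 2 * \<gamma>)) \<le> B n"
      proof -
        have "real n powr (- (1 + 2 * \<gamma>)) \<le> real n powr (1 - (1 - \<beta>) * \<gamma>)"
        proof (intro powr_mono)
          have "(1 - \<beta>) * \<gamma> \<le> 1 * \<gamma>" using beta g by (intro mult_right_mono) auto
          thus "- (1 + 2 * \<gamma>) \<le> 1 - (1 - \<beta>) * \<gamma>" using g by linarith
        qed (use n2 in auto)
        also have "\<dots> = real n * (1 / real n powr (1 - \<beta>)) powr \<gamma>"
          using n2 powr_powr[of "real n" "1 - \<beta>" \<gamma>] powr_diff[of "real n" 1 "(1 - \<beta>) * \<gamma>"]
            powr_divide[of 1 "real n powr (1 - \<beta>)" \<gamma>] by (simp del: powr_powr)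
        also have "\<dots> \<le> B n"
          unfolding B_def np[OF n2] using ln1 g by (intro mult_left_mono powr_mono2 divide_right_mono) auto
        finally show ?thesis .
      qed
      ultimately show ?case using elim(1) by (simp add: distrib_right)
    qed
    have concl: "(\<exists>D1>0. \<exists>D2>0.
      (\<lambda>n. measure (M n) {\<omega> \<in> space (M n). connected_graph {1..n} (random_edges n (Z n) \<omega>) \<and>
          D1 * (n / (n * p n) powr \<gamma>) \<le> \<tau> n \<omega> \<and> \<tau> n \<omega> \<le> D2 * B n}) \<longlonglongrightarrow> 1 \<and>
      (\<forall>n\<ge>2. D1 * (n / (n * p n) powr \<gamma>) \<le> integral\<^sup>L (M n) (\<tau> n) \<and> integral\<^sup>L (M n) (\<tau> n) \<le> D2 * B n)) \<and>
      tendsto_L2 M (\<lambda>n \<omega>. \<tau> n \<omega> / integral\<^sup>L (M n) (\<tau> n)) 1"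
    proof (rule regime_conclusion[OF mst p beta rule tau g C0(1) C1 _ dis upper _ B])
      fix n :: nat and x :: real assume n: "n \<ge> 2" and x: "0 < x"
      show "euclidean_mst.cheap_bound (M n) n (Z n) (W n) (X n) \<alpha> (p n * (C1 * x powr (1 / \<gamma>))) x"
        using euclidean_mst.cheap_bound_distances[OF mst[OF n] a x] by (simp add: C1_def \<gamma>_def)
    qed (auto intro: add_nonneg_pos)
    show "\<exists>\<theta>1>0. \<exists>\<theta>2>0.
               (\<lambda>n. prob_space.prob (M n)
                  {\<omega> \<in> space (M n). connected_graph {1..n} (random_edges n (Z n) \<omega>) \<and>
                     \<theta>1 * real n / (real n * p n) powr (\<alpha> / 2) \<le> \<tau> n \<omega> \<and>
                     \<tau> n \<omega> \<le> \<theta>2 * real n * (ln (real n) / (real n * p n)) powr (\<alpha> / 2)})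
                 \<longlonglongrightarrow> 1 \<and>
               (\<forall>n\<ge>2.
                  \<theta>1 * real n / (real n * p n) powr (\<alpha> / 2)
                    \<le> prob_space.expectation (M n) (\<tau> n) \<and>
                  prob_space.expectation (M n) (\<tau> n)
                    \<le> \<theta>2 * real n * (ln (real n) / (real n * p n)) powr (\<alpha> / 2))"
      using conjunct1[OF concl] unfolding B_def \<gamma>_def times_divide_eq_right mult.assoc[symmetric] .
    show "tendsto_L2 M (\<lambda>n \<omega>. \<tau> n \<omega> / prob_space.expectation (M n) (\<tau> n)) 1"
      by (rule conjunct2[OF concl])
  }
qed

end
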